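(* To any pure $\Gamma$-sheaf $\mathcal{M}$ (in the sense of Braden–MacPherson, over a moment graph $\Gamma$) there is a canonically associated GKM-sheaf $\mathcal{M}'$ such that $H^0(\mathcal{M})\cong H^0(\mathcal{M}')$.
   Context: $T$ is a compact torus, $\mathfrak{t}=\mathrm{Lie}(T)\otimes\mathbb{C}$, $A=S(\mathfrak{t}^* )$ graded with $\mathfrak{t}^*$ in degree 2. $\Lambda=\mathrm{Hom}(T,U(1))\subset\mathfrak{t}^*$ is the weight lattice and $\mathbb{P}(\Lambda)$ is the set of nonzero weights modulo scalar multiplication; when $\alpha\in\mathbb{P}(\Lambda)$ is used as an element of $A$, a primitive representative in $\Lambda$ is meant. A GKM-hypergraph $\Gamma=(\mathcal{V},\sim)$ is a finite set $\mathcal{V}$ of vertices with an equivalence relation $\sim_\alpha$ on $\mathcal{V}$ for each $\alpha\in\mathbb{P}(\Lambda)$. Its hyperedges are the pairs $e=(S,\alpha)$ with $S$ a (nonempty) equivalence class of $\sim_\alpha$; write $I(e)=S$, $\alpha(e)=\alpha$, and let $\mathcal{E}$ be the set of hyperedges. $\mathrm{Top}(\Gamma)$ is the topological space with underlying set $\mathcal{V}\cup\mathcal{E}$ and basic open sets $U_v=\{v\}$ ($v\in\mathcal{V}$) and $U_e=\{e\}\cup I(e)$ ($e\in\mathcal{E}$). A GKM-sheaf over $\Gamma$ is a sheaf $\mathcal{F}$ of finitely generated $\mathbb{Z}$-graded $A$-modules on $\mathrm{Top}(\Gamma)$ such that: (1) $\mathcal{F}(U_x)$ is a free $A$-module for every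 $x\in\mathcal{V}\cup\mathcal{E}$; (2) for every $e\in\mathcal{E}$ the restriction map $\mathrm{res}_e:\mathcal{F}(U_e)\to\mathcal{F}(I(e))$ becomes an isomorphism after inverting $\alpha(e)$; (3) $\mathrm{res}_e$ is an isomorphism for all but finitely many $e$. $H^0$ of a GKM-sheaf is its module of global sections. A GKM-graph is a GKM-hypergraph in which no hyperedge is incident to more than two vertices, i.e. $|I(e)|\le 2$; $\mathcal{E}^{nd}$ denotes the set of nondegenerate edges, those with $|I(e)|=2$. Moment graphs, $\Gamma$-sheaves and pure $\Gamma$-sheaves are those of Braden and MacPherson ("From moment graphs to intersection cohomology"), whose full definitions are in force. In the present language: a moment graph is essentially the same thing as a GKM-graph $\Gamma=(\mathcal{V},\mathcal{E},I,\alpha)$ with only finitely many nondegenerate edges, together with an ordering $I(e)=\{v_s,v_t\}$ of the endpoints of each $e\in\mathcal{E}^{nd}$, subject to the further conditions in Braden–MacPherson's definition. A $\Gamma$-sheaf $\mathcal{M}$ consists of $A$-modules $\mathcal{M}(v)$ ($v\in\mathcal{V}$) and $\mathcal{M}(e)$ ($e\in\mathcal{E}^{nd}$) and homomorphisms $\rho_{v,e}:\mathcal{M}(v)\to\mathcal{M}(e)$ for every pair with $v\in I(e)$. Its module of global sections is $$H^0(\mathcal{M})=\Big\{(m_x)\in\bigoplus_{x\in\mathcal{V}\cup\mathcal{E}^{nd}}\mathcal{M}(x)\ :\ \rho_{v,e}(m_v)=m_e\text{ whenever }v\in I(e)\Big\}.$$ A pure $\Gamma$-sheaf is one for which $\mathcal{M}(v)$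 is a free $A$-module for every $v\in\mathcal{V}$ and, for every $e\in\mathcal{E}^{nd}$ with $I(e)=\{v_s,v_t\}$, $\mathcal{M}(e)\cong\mathcal{M}(v_s)/\alpha(e)\mathcal{M}(v_s)$ with $\rho_{v_s,e}:\mathcal{M}(v_s)\to\mathcal{M}(e)$ the projection, and which in addition satisfies the remaining conditions in Braden–MacPherson's definition of purity. *)

theory Defs
  imports
    "HOL-Algebra.Module"
    "HOL-Algebra.AbelCoset"
    "HOL-Library.Poly_Mapping"
    "HOL-Analysis.Abstract_Topology"
begin

section \<open>The torus, its weights, and the graded ring $A = S(\mathfrak t^*)$\<close>

text \<open>
  A compact torus of rank r is taken in coordinates, as the r-fold product of U(1).  Its characters
  are the Laurent monomials with exponent vectors in the integer lattice of rank r (functions on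
  \<open>nat\<close> vanishing from index \<open>r\<close> on), and the symmetric algebra on the dual of the
  complexified Lie algebra is the ring of complex polynomials in \<open>r\<close> variables.  The case
  \<open>r = 0\<close> is allowed.
\<close>

type_synonym poly_elt = "(nat \<Rightarrow>\<^sub>0 nat) \<Rightarrow>\<^sub>0 complex"
type_synonym weight = "nat \<Rightarrow> int"
type_synonym dir = "weight set"

definition sym_alg :: "nat \<Rightarrow> poly_elt ring" where
  "sym_alg r =
    \<lparr>carrier = {p. \<forall>m \<in> Poly_Mapping.keys p. Poly_Mapping.keys m \<subseteq> {..<r}},
     mult = (*), one = 1, zero = 0, add = (+)\<rparr>"

definition sym_deg :: "nat \<Rightarrow> int \<Rightarrow> poly_elt set" where
  "sym_deg r d = {p \<in> carrier (sym_alg r).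
     \<forall>m \<in> Poly_Mapping.keys p. 2 * int (\<Sum>i \<in> Poly_Mapping.keys m. Poly_Mapping.lookup m i) = d}"

definition weights :: "nat \<Rightarrow> weight set" where
  "weights r = {w. \<forall>i\<ge>r. w i = 0}"

definition proj_weights :: "nat \<Rightarrow> dir set" where
  "proj_weights r = (weights r - {\<lambda>_. 0}) //
     {(w, w'). w \<in> weights r - {\<lambda>_. 0} \<and> w' \<in> weights r - {\<lambda>_. 0} \<and>
        (\<exists>c::complex. \<forall>i. of_int (w' i) = c * of_int (w i))}"

definition primitive_weight :: "nat \<Rightarrow> weight \<Rightarrow> bool" where
  "primitive_weight r w \<longleftrightarrow> w \<in> weights r \<and> w \<noteq> (\<lambda>_. 0) \<and>
     (\<forall>k v. v \<in> weights r \<and> w = (\<lambda>i. k * v i) \<longrightarrow> k = 1 \<or> k = -1)"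

definition lin_form :: "nat \<Rightarrow> weight \<Rightarrow> poly_elt" where
  "lin_form r w = (\<Sum>i<r. Poly_Mapping.single (Poly_Mapping.single i 1) (of_int (w i)))"

text \<open>The primitive representative is unique up to sign; the sign plays no role below.\<close>

definition dir_elt :: "nat \<Rightarrow> dir \<Rightarrow> poly_elt" where
  "dir_elt r \<alpha> = lin_form r (SOME w. w \<in> \<alpha> \<and> primitive_weight r w)"


section \<open>Finitely generated graded $A$-modules\<close>

text \<open>
  The library's module record inherits the ring fields \<open>mult\<close> and \<open>one\<close>, which carry no
  meaning for a module.
\<close>

record ('a, 'm) gmodule = "('a, 'm) module" +
  hdeg :: "int \<Rightarrow> 'm set"

definition graded_module :: "nat \<Rightarrow> (poly_elt, 'm) gmodule \<Rightarrow> bool" where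
  "graded_module r M \<longleftrightarrow>
     Module.module (sym_alg r) M \<and>
     (\<forall>d. subgroup (hdeg M d) (add_monoid M)) \<and>
     (\<forall>m \<in> carrier M. \<exists>!c. (\<forall>d. c d \<in> hdeg M d) \<and> finite {d. c d \<noteq> \<zero>\<^bsub>M\<^esub>} \<and>
        m = finsum M c {d. c d \<noteq> \<zero>\<^bsub>M\<^esub>}) \<and>
     (\<forall>i d. \<forall>a \<in> sym_deg r i. \<forall>m \<in> hdeg M d. a \<odot>\<^bsub>M\<^esub> m \<in> hdeg M (i + d))"

definition fin_gen :: "nat \<Rightarrow> (poly_elt, 'm) gmodule \<Rightarrow> bool" where
  "fin_gen r M \<longleftrightarrow> (\<exists>S. finite S \<and> S \<subseteq> carrier M \<and>
     (\<forall>m \<in> carrier M. \<exists>c \<in> S \<rightarrow> carrier (sym_alg r). m = finsum M (\<lambda>s. c s \<odot>\<^bsub>M\<^esub> s) S))"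

definition fg_graded_module :: "nat \<Rightarrow> (poly_elt, 'm) gmodule \<Rightarrow> bool" where
  "fg_graded_module r M \<longleftrightarrow> graded_module r M \<and> fin_gen r M"

definition free_module :: "nat \<Rightarrow> (poly_elt, 'm) gmodule \<Rightarrow> bool" where
  "free_module r M \<longleftrightarrow> (\<exists>B \<subseteq> carrier M. \<forall>m \<in> carrier M.
     \<exists>!c. c \<in> B \<rightarrow>\<^sub>E carrier (sym_alg r) \<and> finite {b \<in> B. c b \<noteq> 0} \<and>
          m = finsum M (\<lambda>b. c b \<odot>\<^bsub>M\<^esub> b) {b \<in> B. c b \<noteq> 0})"

definition gmod_hom ::
    "nat \<Rightarrow> (poly_elt, 'm) gmodule \<Rightarrow> (poly_elt, 'n) gmodule \<Rightarrow> ('m \<Rightarrow> 'n) set" where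
  "gmod_hom r M N = {f. f \<in> carrier M \<rightarrow> carrier N \<and>
     (\<forall>x \<in> carrier M. \<forall>y \<in> carrier M. f (x \<oplus>\<^bsub>M\<^esub> y) = f x \<oplus>\<^bsub>N\<^esub> f y) \<and>
     (\<forall>a \<in> carrier (sym_alg r). \<forall>x \<in> carrier M. f (a \<odot>\<^bsub>M\<^esub> x) = a \<odot>\<^bsub>N\<^esub> f x) \<and>
     (\<forall>d. f ` hdeg M d \<subseteq> hdeg N d)}"

definition gmod_iso ::
    "nat \<Rightarrow> (poly_elt, 'm) gmodule \<Rightarrow> (poly_elt, 'n) gmodule \<Rightarrow> ('m \<Rightarrow> 'n) set" where
  "gmod_iso r M N = {f \<in> gmod_hom r M N. bij_betw f (carrier M) (carrier N)}"

definition quot_module ::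
    "(poly_elt, 'm) gmodule \<Rightarrow> 'm set \<Rightarrow> (poly_elt, 'm set) gmodule" where
  "quot_module M K =
    \<lparr>carrier = a_rcosets\<^bsub>M\<^esub> K, mult = undefined, one = undefined, zero = K, add = set_add M,
     smult = (\<lambda>a X. \<Union>x \<in> X. K +>\<^bsub>M\<^esub> (a \<odot>\<^bsub>M\<^esub> x)),
     hdeg = (\<lambda>d. (\<lambda>m. K +>\<^bsub>M\<^esub> m) ` hdeg M d)\<rparr>"

definition elt_mult_set :: "'a \<Rightarrow> ('a, 'm) gmodule \<Rightarrow> 'm set" where
  "elt_mult_set a M = (\<lambda>m. a \<odot>\<^bsub>M\<^esub> m) ` carrier M"

text \<open>
  The localization of \<open>M\<close> at the powers of \<open>a\<close>: the pair \<open>(m, i)\<close> stands for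
  the fraction of \<open>m\<close> by the \<open>i\<close>-th power of \<open>a\<close>.  A homomorphism becomes an
  isomorphism after inverting \<open>a\<close> iff the induced map on fractions, which is linear, is
  bijective.
\<close>

definition loc_rel ::
    "poly_elt \<Rightarrow> (poly_elt, 'm) gmodule \<Rightarrow> (('m \<times> nat) \<times> ('m \<times> nat)) set" where
  "loc_rel a M = {((m, i), (n, j)). m \<in> carrier M \<and> n \<in> carrier M \<and>
     (\<exists>k. (a ^ k) \<odot>\<^bsub>M\<^esub> ((a ^ j) \<odot>\<^bsub>M\<^esub> m) = (a ^ k) \<odot>\<^bsub>M\<^esub> ((a ^ i) \<odot>\<^bsub>M\<^esub> n))}"

definition localization ::
    "poly_elt \<Rightarrow> (poly_elt, 'm) gmodule \<Rightarrow> ('m \<times> nat) set set" where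
  "localization a M = (carrier M \<times> UNIV) // loc_rel a M"

definition loc_map ::
    "poly_elt \<Rightarrow> (poly_elt, 'n) gmodule \<Rightarrow> ('m \<Rightarrow> 'n) \<Rightarrow>
      ('m \<times> nat) set \<Rightarrow> ('n \<times> nat) set" where
  "loc_map a N f X = loc_rel a N `` ((\<lambda>(m, i). (f m, i)) ` X)"

definition iso_after_inverting ::
    "poly_elt \<Rightarrow> (poly_elt, 'm) gmodule \<Rightarrow> (poly_elt, 'n) gmodule \<Rightarrow> ('m \<Rightarrow> 'n) \<Rightarrow> bool"
  where
  "iso_after_inverting a M N f \<longleftrightarrow>
     bij_betw (loc_map a N f) (localization a M) (localization a N)"


section \<open>GKM-hypergraphs and GKM-sheaves\<close>

record 'v hypergraph =
  verts :: "'v set"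
  eqv :: "dir \<Rightarrow> ('v \<times> 'v) set"

type_synonym 'v hyperedge = "'v set \<times> dir"
type_synonym 'v point = "'v + 'v hyperedge"

definition gkm_hypergraph :: "nat \<Rightarrow> ('v, 'z) hypergraph_scheme \<Rightarrow> bool" where
  "gkm_hypergraph r G \<longleftrightarrow>
     finite (verts G) \<and> (\<forall>\<alpha> \<in> proj_weights r. equiv (verts G) (eqv G \<alpha>))"

definition hyperedges :: "nat \<Rightarrow> ('v, 'z) hypergraph_scheme \<Rightarrow> 'v hyperedge set" where
  "hyperedges r G = {(S, \<alpha>). \<alpha> \<in> proj_weights r \<and> S \<in> verts G // eqv G \<alpha>}"

abbreviation inc :: "'v hyperedge \<Rightarrow> 'v set" where
  "inc e \<equiv> fst e"

abbreviation edge_elt :: "nat \<Rightarrow> 'v hyperedge \<Rightarrow> poly_elt" where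
  "edge_elt r e \<equiv> dir_elt r (snd e)"

definition basic_open :: "'v point \<Rightarrow> 'v point set" where
  "basic_open x = (case x of Inl v \<Rightarrow> {Inl v} | Inr e \<Rightarrow> insert (Inr e) (Inl ` inc e))"

definition hg_points :: "nat \<Rightarrow> ('v, 'z) hypergraph_scheme \<Rightarrow> 'v point set" where
  "hg_points r G = Inl ` verts G \<union> Inr ` hyperedges r G"

definition Top :: "nat \<Rightarrow> ('v, 'z) hypergraph_scheme \<Rightarrow> 'v point topology" where
  "Top r G = topology_generated_by (basic_open ` hg_points r G)"

text \<open>
  \<open>rest F U W\<close> is the restriction from \<open>U\<close> to \<open>W\<close>; only open sets matter.
\<close>

record ('p, 'm) mod_sheaf =
  sec :: "'p set \<Rightarrow> (poly_elt, 'm) gmodule"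
  rest :: "'p set \<Rightarrow> 'p set \<Rightarrow> 'm \<Rightarrow> 'm"

definition sheaf_of_modules :: "nat \<Rightarrow> 'p topology \<Rightarrow> ('p, 'm) mod_sheaf \<Rightarrow> bool" where
  "sheaf_of_modules r X F \<longleftrightarrow>
     (\<forall>U. openin X U \<longrightarrow> fg_graded_module r (sec F U)) \<and>
     (\<forall>U W. openin X U \<and> openin X W \<and> W \<subseteq> U \<longrightarrow> rest F U W \<in> gmod_hom r (sec F U) (sec F W)) \<and>
     (\<forall>U. openin X U \<longrightarrow> (\<forall>s \<in> carrier (sec F U). rest F U U s = s)) \<and>
     (\<forall>U W Z. openin X U \<and> openin X W \<and> openin X Z \<and> Z \<subseteq> W \<and> W \<subseteq> U \<longrightarrow>
        (\<forall>s \<in> carrier (sec F U). rest F W Z (rest F U W s) = rest F U Z s)) \<and>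
     (\<forall>\<U> s. (\<forall>U \<in> \<U>. openin X U \<and> s U \<in> carrier (sec F U)) \<and>
        (\<forall>U \<in> \<U>. \<forall>W \<in> \<U>. rest F U (U \<inter> W) (s U) = rest F W (U \<inter> W) (s W)) \<longrightarrow>
        (\<exists>!t. t \<in> carrier (sec F (\<Union>\<U>)) \<and> (\<forall>U \<in> \<U>. rest F (\<Union>\<U>) U t = s U)))"

definition sheaf_hom ::
    "nat \<Rightarrow> 'p topology \<Rightarrow> ('p, 'm) mod_sheaf \<Rightarrow> ('p, 'n) mod_sheaf \<Rightarrow> ('p set \<Rightarrow> 'm \<Rightarrow> 'n) set"
  where
  "sheaf_hom r X F F' = {\<phi>.
     (\<forall>U. openin X U \<longrightarrow> \<phi> U \<in> gmod_hom r (sec F U) (sec F' U)) \<and>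
     (\<forall>U W. openin X U \<and> openin X W \<and> W \<subseteq> U \<longrightarrow>
        (\<forall>s \<in> carrier (sec F U). \<phi> W (rest F U W s) = rest F' U W (\<phi> U s)))}"

definition gkm_sheaf ::
    "nat \<Rightarrow> ('v, 'z) hypergraph_scheme \<Rightarrow> ('v point, 'm) mod_sheaf \<Rightarrow> bool" where
  "gkm_sheaf r G F \<longleftrightarrow>
     sheaf_of_modules r (Top r G) F \<and>
     (\<forall>x \<in> hg_points r G. free_module r (sec F (basic_open x))) \<and>
     (\<forall>e \<in> hyperedges r G.
        iso_after_inverting (edge_elt r e) (sec F (basic_open (Inr e))) (sec F (Inl ` inc e))
          (rest F (basic_open (Inr e)) (Inl ` inc e))) \<and>
     finite {e \<in> hyperedges r G. rest F (basic_open (Inr e)) (Inl ` inc e) \<notin>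
        gmod_iso r (sec F (basic_open (Inr e))) (sec F (Inl ` inc e))}"

definition sheaf_H0 ::
    "nat \<Rightarrow> ('v, 'z) hypergraph_scheme \<Rightarrow> ('v point, 'm) mod_sheaf \<Rightarrow> (poly_elt, 'm) gmodule" where
  "sheaf_H0 r G F = sec F (topspace (Top r G))"


section \<open>Moment graphs and pure sheaves on them\<close>

definition gkm_graph :: "nat \<Rightarrow> ('v, 'z) hypergraph_scheme \<Rightarrow> bool" where
  "gkm_graph r G \<longleftrightarrow> gkm_hypergraph r G \<and> (\<forall>e \<in> hyperedges r G. card (inc e) \<le> 2)"

definition nd_edges :: "nat \<Rightarrow> ('v, 'z) hypergraph_scheme \<Rightarrow> 'v hyperedge set" where
  "nd_edges r G = {e \<in> hyperedges r G. card (inc e) = 2}"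

text \<open>
  Braden and MacPherson's order: \<open>(x, y) \<in> vle G\<close> means \<open>x \<le> y\<close>.
\<close>

record 'v moment_graph = "'v hypergraph" +
  vle :: "('v \<times> 'v) set"

definition moment_graph :: "nat \<Rightarrow> 'v moment_graph \<Rightarrow> bool" where
  "moment_graph r G \<longleftrightarrow> gkm_graph r G \<and> finite (nd_edges r G) \<and>
     partial_order_on (verts G) (vle G) \<and>
     (\<forall>e \<in> nd_edges r G. \<forall>x \<in> inc e. \<forall>y \<in> inc e. (x, y) \<in> vle G \<or> (y, x) \<in> vle G)"

text \<open>
  The endpoint $v_s$ is the larger one: in Braden and MacPherson's definition of purity the
  module of an edge is a quotient of the module of its upper vertex.
\<close>

definition edge_src :: "'v moment_graph \<Rightarrow> 'v hyperedge \<Rightarrow> 'v" where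
  "edge_src G e = (THE s. s \<in> inc e \<and> (\<forall>v \<in> inc e. (v, s) \<in> vle G))"

definition above :: "'v moment_graph \<Rightarrow> 'v \<Rightarrow> 'v set" where
  "above G x = {y. (x, y) \<in> vle G \<and> y \<noteq> x}"

definition up_edges :: "nat \<Rightarrow> 'v moment_graph \<Rightarrow> 'v \<Rightarrow> 'v hyperedge set" where
  "up_edges r G x = {e \<in> nd_edges r G. x \<in> inc e \<and> edge_src G e \<noteq> x}"

record ('v, 'm) gamma_sheaf =
  stalk :: "'v point \<Rightarrow> (poly_elt, 'm) gmodule"
  rho :: "'v \<Rightarrow> 'v hyperedge \<Rightarrow> 'm \<Rightarrow> 'm"

definition sub_points :: "nat \<Rightarrow> ('v, 'z) hypergraph_scheme \<Rightarrow> 'v set \<Rightarrow> 'v point set" where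
  "sub_points r G W = Inl ` W \<union> Inr ` {e \<in> nd_edges r G. inc e \<subseteq> W}"

text \<open>As in Braden and MacPherson, all modules are finitely generated and graded, and all maps
  preserve degrees.\<close>

definition gamma_sheaf :: "nat \<Rightarrow> ('v, 'z) hypergraph_scheme \<Rightarrow> ('v, 'm) gamma_sheaf \<Rightarrow> bool" where
  "gamma_sheaf r G M \<longleftrightarrow>
     (\<forall>x \<in> sub_points r G (verts G). fg_graded_module r (stalk M x)) \<and>
     (\<forall>e \<in> nd_edges r G. \<forall>v \<in> inc e.
        rho M v e \<in> gmod_hom r (stalk M (Inl v)) (stalk M (Inr e)))"

text \<open>Sections over the full subgraph with vertex set \<open>W\<close>.\<close>

definition gamma_sections ::
    "nat \<Rightarrow> ('v, 'z) hypergraph_scheme \<Rightarrow> ('v, 'm) gamma_sheaf \<Rightarrow> 'v set \<Rightarrow>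
      (poly_elt, 'v point \<Rightarrow> 'm) gmodule" where
  "gamma_sections r G M W = (let P = sub_points r G W;
      C = {m \<in> \<Pi>\<^sub>E x \<in> P. carrier (stalk M x).
             \<forall>e \<in> nd_edges r G. inc e \<subseteq> W \<longrightarrow> (\<forall>v \<in> inc e. rho M v e (m (Inl v)) = m (Inr e))}
    in \<lparr>carrier = C, mult = undefined, one = undefined,
        zero = (\<lambda>x \<in> P. \<zero>\<^bsub>stalk M x\<^esub>),
        add = (\<lambda>m n. \<lambda>x \<in> P. m x \<oplus>\<^bsub>stalk M x\<^esub> n x),
        smult = (\<lambda>a m. \<lambda>x \<in> P. a \<odot>\<^bsub>stalk M x\<^esub> m x),
        hdeg = (\<lambda>d. {m \<in> C. \<forall>x \<in> P. m x \<in> hdeg (stalk M x) d})\<rparr>)"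

definition gamma_H0 ::
    "nat \<Rightarrow> ('v, 'z) hypergraph_scheme \<Rightarrow> ('v, 'm) gamma_sheaf \<Rightarrow>
      (poly_elt, 'v point \<Rightarrow> 'm) gmodule" where
  "gamma_H0 r G M = gamma_sections r G M (verts G)"

text \<open>
  The last clause says that the image of \<open>stalk M (Inl x)\<close> in the sum over the up-edges at
  \<open>x\<close> is $\mathcal M(\partial x)$, the image of the sections over the full subgraph
  on the vertices above \<open>x\<close>.
\<close>

definition pure_sheaf :: "nat \<Rightarrow> 'v moment_graph \<Rightarrow> ('v, 'm) gamma_sheaf \<Rightarrow> bool" where
  "pure_sheaf r G M \<longleftrightarrow>
     gamma_sheaf r G M \<and>
     (\<forall>v \<in> verts G. free_module r (stalk M (Inl v))) \<and>
     (\<forall>e \<in> nd_edges r G.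
        let S = stalk M (Inl (edge_src G e)); K = elt_mult_set (edge_elt r e) S in
        \<exists>\<phi> \<in> gmod_iso r (quot_module S K) (stalk M (Inr e)).
          \<forall>m \<in> carrier S. rho M (edge_src G e) e m = \<phi> (K +>\<^bsub>S\<^esub> m)) \<and>
     (\<forall>x \<in> verts G.
        (\<lambda>m. \<lambda>e \<in> up_edges r G x. rho M x e m) ` carrier (stalk M (Inl x)) =
        (\<lambda>s. \<lambda>e \<in> up_edges r G x. rho M (edge_src G e) e (s (Inl (edge_src G e)))) `
          carrier (gamma_sections r G M (above G x)))"

definition gamma_hom ::
    "nat \<Rightarrow> ('v, 'z) hypergraph_scheme \<Rightarrow> ('v, 'm) gamma_sheaf \<Rightarrow> ('v, 'm) gamma_sheaf \<Rightarrow>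
      ('v point \<Rightarrow> 'm \<Rightarrow> 'm) set" where
  "gamma_hom r G M N = {f.
     (\<forall>x \<in> sub_points r G (verts G). f x \<in> gmod_hom r (stalk M x) (stalk N x)) \<and>
     (\<forall>e \<in> nd_edges r G. \<forall>v \<in> inc e. \<forall>m \<in> carrier (stalk M (Inl v)).
        f (Inr e) (rho M v e m) = rho N v e (f (Inl v) m))}"

definition gamma_H0_map ::
    "nat \<Rightarrow> ('v, 'z) hypergraph_scheme \<Rightarrow> ('v point \<Rightarrow> 'm \<Rightarrow> 'm) \<Rightarrow>
      ('v point \<Rightarrow> 'm) \<Rightarrow> ('v point \<Rightarrow> 'm)" where
  "gamma_H0_map r G f s = (\<lambda>x \<in> sub_points r G (verts G). f x (s x))"


section \<open>Canonical association of GKM-sheaves\<close>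

text \<open>
  A functor (object map \<open>F\<close>, morphism map \<open>Fm\<close>) from pure sheaves to GKM-sheaves on
  the same graph.  Maps are compared on carriers only, so the two functor laws also say that
  \<open>Fm\<close> does not depend on values outside the carriers.
\<close>

definition pure_to_gkm_functor ::
    "nat \<Rightarrow> 'v moment_graph \<Rightarrow>
      (('v, 'm) gamma_sheaf \<Rightarrow> ('v point, 'n) mod_sheaf) \<Rightarrow>
      (('v, 'm) gamma_sheaf \<Rightarrow> ('v, 'm) gamma_sheaf \<Rightarrow> ('v point \<Rightarrow> 'm \<Rightarrow> 'm) \<Rightarrow>
        ('v point set \<Rightarrow> 'n \<Rightarrow> 'n)) \<Rightarrow> bool" where
  "pure_to_gkm_functor r G F Fm \<longleftrightarrow>
     (\<forall>M. pure_sheaf r G M \<longrightarrow> gkm_sheaf r G (F M)) \<and>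
     (\<forall>M N f. pure_sheaf r G M \<and> pure_sheaf r G N \<and> f \<in> gamma_hom r G M N \<longrightarrow>
        Fm M N f \<in> sheaf_hom r (Top r G) (F M) (F N)) \<and>
     (\<forall>M f. pure_sheaf r G M \<and> f \<in> gamma_hom r G M M \<and>
        (\<forall>x \<in> sub_points r G (verts G). \<forall>m \<in> carrier (stalk M x). f x m = m) \<longrightarrow>
        (\<forall>U. openin (Top r G) U \<longrightarrow> (\<forall>s \<in> carrier (sec (F M) U). Fm M M f U s = s))) \<and>
     (\<forall>M N K f g h. pure_sheaf r G M \<and> pure_sheaf r G N \<and> pure_sheaf r G K \<and>
        f \<in> gamma_hom r G M N \<and> g \<in> gamma_hom r G N K \<and> h \<in> gamma_hom r G M K \<and>
        (\<forall>x \<in> sub_points r G (verts G). \<forall>m \<in> carrier (stalk M x). h x m = g x (f x m)) \<longrightarrow>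
        (\<forall>U. openin (Top r G) U \<longrightarrow>
          (\<forall>s \<in> carrier (sec (F M) U). Fm M K h U s = Fm N K g U (Fm M N f U s))))"

end

theory Submission
  imports Defs
begin

text \<open>
  Over an open set take the families of elements of the stalks at its vertices and nondegenerate
  edges that are compatible with the maps \<open>\<rho>\<close>.  Let \<open>e\<close> be a nondegenerate edge with upper
  endpoint \<open>s\<close>, lower endpoint \<open>t\<close> and linear form \<open>\<alpha>\<close>.  Since \<open>M(e) = M(s)/\<alpha>M(s)\<close>, evaluation at
  \<open>t\<close> maps the sections over \<open>U\<^sub>e\<close> onto \<open>M(t)\<close> with kernel \<open>\<alpha>M(s)\<close>, which is isomorphic to \<open>M(s)\<close>;
  hence these sections form a free module.  As \<open>\<alpha>\<close> kills \<open>M(e)\<close>, their inclusion into \<open>M(s) \<oplus> M(t)\<close>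
  has a cokernel killed by \<open>\<alpha>\<close>.  Finite generation over an arbitrary open set rests on the
  Noetherianity of the polynomial ring, obtained from Dickson's lemma through leading monomials.
\<close>

section \<open>Noetherianity of the polynomial ring\<close>

text \<open>Sections over a basic open set are free, but an open set may contain several edges, and
  the compatible families over it are merely some submodule of a finite product of stalks. The sheaf
  axioms ask for finite generation there too; this is what Noetherianity is for. Monomials are
  exponent functions compared by the lexicographic order of their type. That order is linear and
  translation invariant, but well-founded only once the number of variables is bounded. Freeness
  over an edge is ungraded: a basis is assembled from bases of \<open>M(s)\<close> and
  \<open>M(t)\<close>, and it does no harm that multiplication by \<alpha> shifts degrees. This
  multiplication is injective because \<open>M(s)\<close> is free and \<alpha> is nonzero. As
  \<alpha> is defined by a choice, the latter needs a primitive representative in every direction.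
  There may be infinitely many hyperedges, but only vertices and nondegenerate edges carry
  coordinates, so every module of sections is a finite limit.\<close>

definition monomials :: "nat \<Rightarrow> (nat \<Rightarrow>\<^sub>0 nat) set" where
  "monomials r = {m. Poly_Mapping.keys m \<subseteq> {..<r}}"

definition mono_dvd :: "(nat \<Rightarrow>\<^sub>0 nat) \<Rightarrow> (nat \<Rightarrow>\<^sub>0 nat) \<Rightarrow> bool" where
  "mono_dvd m n \<longleftrightarrow> (\<forall>i. Poly_Mapping.lookup m i \<le> Poly_Mapping.lookup n i)"

lemma mono_dvd_add_diff: "mono_dvd m n \<Longrightarrow> m + (n - m) = n"
  by (rule poly_mapping_eqI) (simp add: mono_dvd_def lookup_add lookup_minus)

lemma monomial_nonneg: "(0 :: nat \<Rightarrow>\<^sub>0 nat) \<le> m"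
proof (rule ccontr)
  assume "\<not> 0 \<le> m"
  then have "m < 0" by simp
  then show False by transfer (simp add: less_fun_def)
qed

lemma mono_dvd_imp_le: "mono_dvd m n \<Longrightarrow> m \<le> n"
  using add_left_mono[OF monomial_nonneg[of "n - m"], of m] by (simp add: mono_dvd_add_diff)

text \<open>One variable is treated at a time: a sequence of naturals has a nondecreasing
  subsequence, and further thinning keeps the monotonicity already obtained for the other
  exponents.\<close>

lemma monomials_subseq:
  fixes f :: "nat \<Rightarrow> (nat \<Rightarrow>\<^sub>0 nat)"
  shows "\<exists>g::nat \<Rightarrow> nat. strict_mono g \<and> (\<forall>i<r. mono (\<lambda>n. Poly_Mapping.lookup (f (g n)) i))"
proof (induction r)
  case 0
  show ?case by (rule exI[of _ id]) (simp add: strict_mono_def)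
next
  case (Suc r)
  from Suc.IH obtain g :: "nat \<Rightarrow> nat" where g: "strict_mono g"
    "\<forall>i<r. mono (\<lambda>n. Poly_Mapping.lookup (f (g n)) i)" by blast
  define s where "s n = Poly_Mapping.lookup (f (g n)) r" for n
  obtain h :: "nat \<Rightarrow> nat" where h: "strict_mono h" "monoseq (\<lambda>n. s (h n))"
    using seq_monosub[of s] by auto
  obtain k :: "nat \<Rightarrow> nat" where k: "strict_mono k" "mono (\<lambda>n. s (h (k n)))"
  proof (cases "mono (\<lambda>n. s (h n))")
    case True
    then show ?thesis using that[of "\<lambda>n. n"] by (simp add: strict_mono_def)
  next
    case False
    then have dec: "decseq (\<lambda>n. s (h n))" using h(2) by (simp add: monoseq_iff)
    \<comment> \<open>A nonincreasing sequence of naturals is constant from the index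
      \<open>N\<close> at which it attains its minimum, so shifting by \<open>N\<close> gives a
      monotone subsequence.\<close>
    obtain N where N: "\<And>n. s (h N) \<le> s (h n)"
      using ex_has_least_nat[of "\<lambda>_. True" undefined "\<lambda>n. s (h n)"] by auto
    have "s (h (N + n)) = s (h N)" for n
      using N[of "N + n"] decseqD[OF dec, of N "N + n"] by simp
    then show ?thesis using that[of "\<lambda>n. N + n"] by (simp add: strict_mono_def mono_def)
  qed
  have hk: "strict_mono (h \<circ> k)" using h(1) k(1) by (rule strict_mono_o)
  have "mono (\<lambda>n. Poly_Mapping.lookup (f ((g \<circ> (h \<circ> k)) n)) i)" if "i < Suc r" for i
  proof (cases "i = r")
    case True
    then show ?thesis using k(2) by (simp add: s_def)
  next
    case False
    then have m: "mono (\<lambda>n. Poly_Mapping.lookup (f (g n)) i)" using g(2) that by simp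
    show ?thesis
      using monoD[OF m] monoD[OF strict_mono_mono[OF hk]] by (auto intro!: monoI)
  qed
  then show ?case using strict_mono_o[OF g(1) hk] by blast
qed

text \<open>This is the well-quasi-order property of divisibility. Two terms of a subsequence that
  is monotone in the first \<open>r\<close> exponents give the pair, as all later exponents
  vanish.\<close>

lemma monomials_good_pair:
  assumes "\<And>n. f n \<in> monomials r"
  obtains i j :: nat where "i < j" "mono_dvd (f i) (f j)"
proof -
  obtain g :: "nat \<Rightarrow> nat" where g: "strict_mono g"
    "\<forall>i<r. mono (\<lambda>n. Poly_Mapping.lookup (f (g n)) i)"
    using monomials_subseq[of r f] by blast
  have "Poly_Mapping.lookup (f (g 0)) i \<le> Poly_Mapping.lookup (f (g 1)) i" for i
  proof (cases "i < r")
    case True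
    then show ?thesis using g(2) monoD[of _ 0 1] by blast
  next
    case False
    then have "i \<notin> Poly_Mapping.keys (f (g 0))"
      using assms[of "g 0"] by (auto simp: monomials_def)
    then show ?thesis by (simp add: in_keys_iff)
  qed
  then show ?thesis using that[of "g 0" "g 1"] g(1) by (auto simp: mono_dvd_def strict_mono_def)
qed

text \<open>An infinite descent would contain an earlier term dividing a later one, hence an earlier
  term at most a later one. The bound \<open>r\<close> matters: with infinitely many variables the
  variables themselves form an infinite descending chain.\<close>

lemma wf_monomials: "wf {(m, n). m \<in> monomials r \<and> n \<in> monomials r \<and> m < n}"
proof (rule ccontr)
  assume "\<not> ?thesis"
  then obtain f :: "nat \<Rightarrow> (nat \<Rightarrow>\<^sub>0 nat)" where
    f: "\<And>n. f n \<in> monomials r" "\<And>n. f (Suc n) < f n"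
    unfolding wf_iff_no_infinite_down_chain by auto
  obtain i j where ij: "i < j" "mono_dvd (f i) (f j)"
    using monomials_good_pair[of f r] f(1) by blast
  have "f j < f i"
    using ij(1)
  proof (induction i j rule: less_Suc_induct)
    case (2 i j k)
    then show ?case by simp
  qed (rule f(2))
  then show False using mono_dvd_imp_le[OF ij(2)] by simp
qed

text \<open>If no finite subset sufficed, one could choose a sequence in \<open>L\<close> in which
  no term is divisible by an earlier one, against \<open>monomials_good_pair\<close>.\<close>

lemma dickson:
  assumes "L \<subseteq> monomials r"
  shows "\<exists>B. finite B \<and> B \<subseteq> L \<and> (\<forall>l\<in>L. \<exists>b\<in>B. mono_dvd b l)"
proof (rule ccontr)
  assume "\<not> ?thesis"
  then have "\<not> (\<forall>l\<in>L. \<exists>b\<in>B. mono_dvd b l)" if "finite B" "B \<subseteq> L" for B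
    using that by simp
  then have *: "\<exists>l\<in>L. \<forall>b\<in>B. \<not> mono_dvd b l" if "finite B" "B \<subseteq> L" for B
    using that by simp
  let ?P = "\<lambda>f n l. l \<in> L \<and> (\<forall>m<n. \<not> mono_dvd (f m) l)"
  have "\<exists>f::nat \<Rightarrow> _. \<forall>n. ?P f n (f n)"
  proof (rule dependent_wellorder_choice)
    fix n and f :: "nat \<Rightarrow> _"
    assume "\<And>y. y < n \<Longrightarrow> ?P f y (f y)"
    then have "f ` {..<n} \<subseteq> L" by blast
    from *[OF _ this] show "\<exists>l. ?P f n l" by auto
  qed simp
  then obtain f :: "nat \<Rightarrow> (nat \<Rightarrow>\<^sub>0 nat)" where f: "\<forall>n. ?P f n (f n)" by (rule exE)
  have "f n \<in> monomials r" for n using f assms by blast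
  then obtain i j where "i < j" "mono_dvd (f i) (f j)"
    by (rule monomials_good_pair)
  with f show False by blast
qed

section \<open>Polynomial arithmetic and Hilbert's basis theorem\<close>

lemma sym_alg_simps [simp]:
  "\<zero>\<^bsub>sym_alg r\<^esub> = 0" "\<one>\<^bsub>sym_alg r\<^esub> = 1"
  "a \<oplus>\<^bsub>sym_alg r\<^esub> b = a + b" "a \<otimes>\<^bsub>sym_alg r\<^esub> b = a * b"
  by (simp_all add: sym_alg_def)

lemma carrier_sym_alg: "carrier (sym_alg r) = {p. Poly_Mapping.keys p \<subseteq> monomials r}"
  by (auto simp: sym_alg_def monomials_def)

lemma monomials_add: "m \<in> monomials r \<Longrightarrow> n \<in> monomials r \<Longrightarrow> m + n \<in> monomials r"
  using keys_add[of m n] by (auto simp: monomials_def)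

lemma sym_alg_closed [simp]:
  "0 \<in> carrier (sym_alg r)" "1 \<in> carrier (sym_alg r)"
  "a \<in> carrier (sym_alg r) \<Longrightarrow> - a \<in> carrier (sym_alg r)"
  "a \<in> carrier (sym_alg r) \<Longrightarrow> b \<in> carrier (sym_alg r) \<Longrightarrow> a + b \<in> carrier (sym_alg r)"
  "a \<in> carrier (sym_alg r) \<Longrightarrow> b \<in> carrier (sym_alg r) \<Longrightarrow> a * b \<in> carrier (sym_alg r)"
proof -
  show "a + b \<in> carrier (sym_alg r)" if "a \<in> carrier (sym_alg r)" "b \<in> carrier (sym_alg r)"
    using that keys_add[of a b] by (auto simp: carrier_sym_alg)
  show "a * b \<in> carrier (sym_alg r)" if "a \<in> carrier (sym_alg r)" "b \<in> carrier (sym_alg r)"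
    using that keys_mult[of a b] monomials_add by (fastforce simp: carrier_sym_alg)
qed (auto simp: carrier_sym_alg monomials_def)

lemma sym_alg_diff_closed [simp]:
  "a \<in> carrier (sym_alg r) \<Longrightarrow> b \<in> carrier (sym_alg r) \<Longrightarrow> a - b \<in> carrier (sym_alg r)"
  using sym_alg_closed(4)[of a r "- b"] by simp

lemma sym_alg_pow_closed [simp]: "a \<in> carrier (sym_alg r) \<Longrightarrow> a ^ k \<in> carrier (sym_alg r)"
  by (induction k) auto

lemma cring_sym_alg: "cring (sym_alg r)"
proof (rule cringI)
  show "abelian_group (sym_alg r)"
    by (rule abelian_groupI) (auto simp: algebra_simps intro!: bexI[of _ "- x" for x])
  show "comm_monoid (sym_alg r)"
    by (rule comm_monoidI) (auto simp: algebra_simps)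
qed (auto simp: algebra_simps)

lemma lookup_single_mult:
  fixes p :: poly_elt
  shows "Poly_Mapping.lookup (Poly_Mapping.single k c * p) (k + m) = c * Poly_Mapping.lookup p m"
proof -
  have "Poly_Mapping.lookup (Poly_Mapping.single k c * p) (k + m)
    = (\<Sum>l. (c * (\<Sum>q. Poly_Mapping.lookup p q when k + m = l + q) when k = l))"
    unfolding lookup_mult by (rule Sum_any.cong) (auto simp: lookup_single when_def)
  also have "\<dots> = c * (\<Sum>q. Poly_Mapping.lookup p q when m = q)" by simp
  finally show ?thesis by simp
qed

text \<open>Ideals as bare sets of polynomials; negatives are supplied by multiplication with
  \<open>- 1\<close>.\<close>

definition ideal_like :: "nat \<Rightarrow> poly_elt set \<Rightarrow> bool" where
  "ideal_like r I \<longleftrightarrow> I \<subseteq> carrier (sym_alg r) \<and> 0 \<in> I \<and> (\<forall>p\<in>I. \<forall>q\<in>I. p + q \<in> I) \<and>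
     (\<forall>a \<in> carrier (sym_alg r). \<forall>p\<in>I. a * p \<in> I)"

text \<open>\<open>C\<close> is chosen so that every leading monomial of \<open>I\<close> is
  divisible by that of a member of \<open>C\<close>; subtracting multiples of such members lowers
  leading monomials until nothing is left. That \<open>C\<close> generates \<open>I\<close> is said
  through the ideals \<open>J\<close> containing \<open>C\<close>, which avoids coefficients and
  suits the comparison of two ideals in \<open>submodule_fin_gen\<close>.\<close>

lemma hilbert_basis:
  assumes I: "ideal_like r I"
  obtains C where "finite C" "C \<subseteq> I" "\<And>J. ideal_like r J \<Longrightarrow> C \<subseteq> J \<Longrightarrow> I \<subseteq> J"
proof -
  let ?k = "Poly_Mapping.keys :: poly_elt \<Rightarrow> _"
  have IA: "?k p \<subseteq> monomials r" if "p \<in> I" for p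
    using I that by (auto simp: ideal_like_def carrier_sym_alg)
  have Mx: "Max (?k p) \<in> ?k p" if "p \<noteq> 0" for p
    using that by (intro Max_in) auto
  define L where "L = (\<lambda>p. Max (?k p)) ` (I - {0})"
  have "L \<subseteq> monomials r" using IA Mx unfolding L_def by blast
  then obtain B where B: "finite B" "B \<subseteq> L" "\<And>l. l \<in> L \<Longrightarrow> \<exists>b\<in>B. mono_dvd b l"
    using dickson[of L r] by blast
  have "\<forall>b\<in>B. \<exists>p\<in>I - {0}. Max (?k p) = b" using B(2) by (auto simp: L_def)
  then obtain P where P: "\<And>b. b \<in> B \<Longrightarrow> P b \<in> I" "\<And>b. b \<in> B \<Longrightarrow> P b \<noteq> 0"
    "\<And>b. b \<in> B \<Longrightarrow> Max (?k (P b)) = b" by (metis DiffE singletonI)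
  show ?thesis
  proof (rule that[of "P ` B"])
    fix J assume J: "ideal_like r J" "P ` B \<subseteq> J"
    have "p \<in> J" if "l = Max (?k p)" "p \<in> I" "p \<noteq> 0" for l p
      using that
    proof (induction l arbitrary: p rule: wf_induct_rule[OF wf_monomials[of r]])
      case (1 l)
      then obtain b where b: "b \<in> B" "mono_dvd b l" using B(3)[of l] by (auto simp: L_def)
      let ?q = "P b"
      \<comment> \<open>This term gives \<open>s * ?q\<close> the leading monomial \<open>l\<close>
        with the coefficient that \<open>p\<close> has there.\<close>
      define s :: poly_elt where "s = Poly_Mapping.single (l - b)
        (Poly_Mapping.lookup p l / Poly_Mapping.lookup ?q b)"
      have l: "b + (l - b) = l" using b(2) by (rule mono_dvd_add_diff)
      have lm: "l \<in> monomials r" using Mx[of p] IA[of p] 1 by auto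
      have "Poly_Mapping.keys (l - b) \<subseteq> Poly_Mapping.keys l" by (auto simp: in_keys_iff lookup_minus)
      then have sA: "s \<in> carrier (sym_alg r)"
        using lm by (auto simp: s_def carrier_sym_alg monomials_def)
      have sq: "s * ?q \<in> I" "s * ?q \<in> J"
        using sA P(1)[OF b(1)] I J b(1) by (auto simp: ideal_like_def)
      \<comment> \<open>The difference is written with the factor \<open>- 1\<close>, the form in
        which closure of \<open>I\<close> applies.\<close>
      define p' where "p' = p + (- 1) * (s * ?q)"
      have "- 1 \<in> carrier (sym_alg r)" by simp
      then have p'I: "p' \<in> I"
        using I 1(3) sq(1) unfolding p'_def ideal_like_def by blast
      \<comment> \<open>Translation invariance of the order: shifting by \<open>l - b\<close>
        carries monomials at most \<open>b\<close> to monomials at most \<open>l\<close>.\<close>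
      have ks: "?k (s * ?q) \<subseteq> {..l}"
      proof
        fix m assume "m \<in> ?k (s * ?q)"
        then obtain n where n: "m = (l - b) + n" "n \<in> ?k ?q"
          using keys_mult[of s ?q] by (auto simp: s_def split: if_splits)
        then have "n \<le> b" using P(3)[OF b(1)] Max_ge[of "?k ?q" n] by simp
        then have "(l - b) + n \<le> (l - b) + b" by (rule add_left_mono)
        then show "m \<in> {..l}" using n l by (simp add: add.commute)
      qed
      have "?k p \<subseteq> {..l}" using 1(2) by auto
      then have k': "?k p' \<subseteq> {..l}"
        using ks keys_add[of p "- (s * ?q)"] unfolding p'_def by auto
      have qb: "Poly_Mapping.lookup ?q b \<noteq> 0"
        using Mx[OF P(2)[OF b(1)]] P(3)[OF b(1)] by (simp add: in_keys_iff)
      have "Poly_Mapping.lookup (s * ?q) l = Poly_Mapping.lookup p l"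
        using lookup_single_mult[of "l - b" "Poly_Mapping.lookup p l / Poly_Mapping.lookup ?q b" ?q b]
          l qb by (simp add: s_def add.commute)
      then have "Poly_Mapping.lookup p' l = 0" by (simp add: p'_def lookup_minus)
      then have nl: "l \<notin> ?k p'" by (simp add: in_keys_iff)
      have "p' \<in> J"
      proof (cases "p' = 0")
        case True
        then show ?thesis using J by (simp add: ideal_like_def)
      next
        case False
        have "Max (?k p') \<in> ?k p'" using Mx[OF False] .
        then have "Max (?k p') < l" "Max (?k p') \<in> monomials r"
          using k' nl IA[OF p'I] by (auto simp: order.strict_iff_order)
        then show ?thesis using 1(1)[of "Max (?k p')" p'] lm p'I False by auto
      qed
      then have "p' + s * ?q \<in> J" using J sq(2) by (simp add: ideal_like_def)
      then show ?case by (simp add: p'_def)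
    qed
    moreover have "0 \<in> J" using J by (simp add: ideal_like_def)
    ultimately show "I \<subseteq> J" by blast
  qed (use B P in auto)
qed

section \<open>Modules over the polynomial ring\<close>

text \<open>Adding one multiple of a generator at a time covers infinite \<open>S\<close> and
  provides an induction rule. Only zero, sum and scalar multiplication of \<open>M\<close> enter,
  not its carrier, so spans can be compared between modules that share these operations.\<close>

inductive_set lspan :: "nat \<Rightarrow> (poly_elt, 'm) gmodule \<Rightarrow> 'm set \<Rightarrow> 'm set"
  for r M S where
    lspan_zero: "\<zero>\<^bsub>M\<^esub> \<in> lspan r M S"
  | lspan_step: "a \<in> carrier (sym_alg r) \<Longrightarrow> s \<in> S \<Longrightarrow> x \<in> lspan r M S \<Longrightarrow>
      a \<odot>\<^bsub>M\<^esub> s \<oplus>\<^bsub>M\<^esub> x \<in> lspan r M S"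

locale sym_module = Module.module "sym_alg r" M for r :: nat and M :: "(poly_elt, 'm) gmodule"
begin

lemmas smult_simps [simp] = smult_one[simplified] smult_l_null[simplified]

lemmas smult_add_left = smult_l_distr[simplified]

lemmas smult_mult = smult_assoc1[simplified]

lemma minus_eq_smult: "x \<in> carrier M \<Longrightarrow> \<ominus>\<^bsub>M\<^esub> x = (- 1) \<odot>\<^bsub>M\<^esub> x"
  using smult_add_left[of "- 1" 1 x] by (intro M.minus_equality) auto

lemma submoduleI':
  assumes "H \<subseteq> carrier M" "\<zero>\<^bsub>M\<^esub> \<in> H" "\<And>a b. a \<in> H \<Longrightarrow> b \<in> H \<Longrightarrow> a \<oplus>\<^bsub>M\<^esub> b \<in> H"
    "\<And>a x. a \<in> carrier (sym_alg r) \<Longrightarrow> x \<in> H \<Longrightarrow> a \<odot>\<^bsub>M\<^esub> x \<in> H"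
  shows "submodule H (sym_alg r) M"
proof (rule submoduleI)
  show "\<ominus>\<^bsub>M\<^esub> a \<in> H" if "a \<in> H" for a
    using that assms(1) assms(4)[of "- 1" a] minus_eq_smult[of a] by auto
qed (use assms in auto)

lemma submodule_zero: "submodule H (sym_alg r) M \<Longrightarrow> \<zero>\<^bsub>M\<^esub> \<in> H"
  using submodule.axioms(1) subgroup.one_closed by fastforce

lemma finsum_in_submodule:
  assumes "submodule H (sym_alg r) M" "\<And>i. i \<in> I \<Longrightarrow> f i \<in> H"
  shows "finsum M f I \<in> H"
  using assms(2)
proof (induction I rule: infinite_finite_induct)
  case (insert i I)
  then have "f \<in> I \<rightarrow> carrier M" "f i \<in> carrier M"
    using submoduleE(1)[OF assms(1)] by auto
  then show ?case using insert submoduleE(5)[OF assms(1)] by simp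
qed (use submodule_zero[OF assms(1)] in \<open>auto simp: M.finsum_infinite\<close>)

lemma lspan_closed:
  assumes "S \<subseteq> carrier M" shows "lspan r M S \<subseteq> carrier M"
proof
  show "x \<in> carrier M" if "x \<in> lspan r M S" for x
    using that assms by induction auto
qed

lemma lspan_submodule:
  assumes S: "S \<subseteq> carrier M"
  shows "submodule (lspan r M S) (sym_alg r) M"
proof (rule submoduleI')
  note cl = subsetD[OF lspan_closed[OF S]]
  show "x \<oplus>\<^bsub>M\<^esub> y \<in> lspan r M S" if "x \<in> lspan r M S" "y \<in> lspan r M S" for x y
    using that
  proof induction
    case (lspan_step a s x)
    then have "a \<odot>\<^bsub>M\<^esub> s \<oplus>\<^bsub>M\<^esub> (x \<oplus>\<^bsub>M\<^esub> y) \<in> lspan r M S"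
      by (intro lspan.lspan_step) auto
    moreover have "x \<in> carrier M" "y \<in> carrier M" "a \<odot>\<^bsub>M\<^esub> s \<in> carrier M"
      using lspan_step cl S by auto
    ultimately show ?case by (simp add: M.a_assoc)
  qed (use cl in simp)
  show "b \<odot>\<^bsub>M\<^esub> x \<in> lspan r M S" if b: "b \<in> carrier (sym_alg r)" and "x \<in> lspan r M S" for b x
    using that(2)
  proof induction
    case (lspan_step a s x)
    have "(b * a) \<odot>\<^bsub>M\<^esub> s \<oplus>\<^bsub>M\<^esub> b \<odot>\<^bsub>M\<^esub> x \<in> lspan r M S"
      using lspan_step b by (intro lspan.lspan_step) auto
    moreover have "x \<in> carrier M" "s \<in> carrier M" using lspan_step cl S by auto
    ultimately show ?case using b lspan_step by (simp add: smult_r_distr smult_mult)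
  qed (use b lspan_zero in simp)
qed (use lspan_closed[OF S] lspan_zero in auto)

lemma lspan_incl:
  assumes "S \<subseteq> carrier M" shows "S \<subseteq> lspan r M S"
proof
  fix s assume "s \<in> S"
  then show "s \<in> lspan r M S"
    using lspan_step[of 1 r s S "\<zero>\<^bsub>M\<^esub>" M] lspan_zero[of M r S] assms by auto
qed

lemma lspan_least:
  assumes H: "submodule H (sym_alg r) M" and "S \<subseteq> H"
  shows "lspan r M S \<subseteq> H"
proof
  show "x \<in> H" if "x \<in> lspan r M S" for x
    using that
  proof induction
    case (lspan_step a s x)
    then show ?case using assms submoduleE(4)[OF H, of a s] submoduleE(5)[OF H] by auto
  qed (rule submodule_zero[OF H])
qed

lemma lspan_mono: "S \<subseteq> T \<Longrightarrow> lspan r M S \<subseteq> lspan r M T"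
proof
  show "x \<in> lspan r M T" if "x \<in> lspan r M S" "S \<subseteq> T" for x
    using that by induction (auto intro: lspan.intros)
qed

text \<open>The sums with coefficients on a finite \<open>S\<close> form a submodule containing
  \<open>S\<close>, and hence contain the span. This links \<open>lspan\<close> to the coefficient
  functions in \<open>fin_gen\<close> and \<open>free_module\<close>.\<close>

lemma lspan_eq_finsum:
  assumes S: "S \<subseteq> carrier M" "finite S" and x: "x \<in> lspan r M S"
  obtains c where "c \<in> S \<rightarrow> carrier (sym_alg r)" "x = finsum M (\<lambda>s. c s \<odot>\<^bsub>M\<^esub> s) S"
proof -
  define H where "H = {finsum M (\<lambda>s. c s \<odot>\<^bsub>M\<^esub> s) S |c. c \<in> S \<rightarrow> carrier (sym_alg r)}"
  have cl: "(\<lambda>s. c s \<odot>\<^bsub>M\<^esub> s) \<in> S \<rightarrow> carrier M" if "c \<in> S \<rightarrow> carrier (sym_alg r)" for c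
    using that S by auto
  have "submodule H (sym_alg r) M"
  proof (rule submoduleI')
    show "\<zero>\<^bsub>M\<^esub> \<in> H"
      unfolding H_def using S
      by (intro CollectI exI[of _ "\<lambda>_. 0"]) (auto intro!: M.add.finprod_one_eqI[symmetric])
    show "x \<oplus>\<^bsub>M\<^esub> y \<in> H" if xy: "x \<in> H" "y \<in> H" for x y
    proof -
      obtain c d where c: "c \<in> S \<rightarrow> carrier (sym_alg r)" "x = finsum M (\<lambda>s. c s \<odot>\<^bsub>M\<^esub> s) S"
        and d: "d \<in> S \<rightarrow> carrier (sym_alg r)" "y = finsum M (\<lambda>s. d s \<odot>\<^bsub>M\<^esub> s) S"
        using xy unfolding H_def by blast
      have "x \<oplus>\<^bsub>M\<^esub> y = finsum M (\<lambda>s. c s \<odot>\<^bsub>M\<^esub> s \<oplus>\<^bsub>M\<^esub> d s \<odot>\<^bsub>M\<^esub> s) S"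
        using cl[OF c(1)] cl[OF d(1)] c(2) d(2) by (simp add: M.finsum_addf)
      also have "\<dots> = finsum M (\<lambda>s. (c s + d s) \<odot>\<^bsub>M\<^esub> s) S"
        using c(1) d(1) S by (intro M.finsum_cong') (auto simp: smult_add_left Pi_iff subset_iff)
      finally show ?thesis using c(1) d(1) unfolding H_def
        by (intro CollectI exI[of _ "\<lambda>s. c s + d s"]) (auto simp: Pi_iff)
    qed
    show "a \<odot>\<^bsub>M\<^esub> x \<in> H" if a: "a \<in> carrier (sym_alg r)" and x: "x \<in> H" for a x
    proof -
      obtain c where c: "c \<in> S \<rightarrow> carrier (sym_alg r)" "x = finsum M (\<lambda>s. c s \<odot>\<^bsub>M\<^esub> s) S"
        using x unfolding H_def by blast
      have "a \<odot>\<^bsub>M\<^esub> x = finsum M (\<lambda>s. a \<odot>\<^bsub>M\<^esub> (c s \<odot>\<^bsub>M\<^esub> s)) S"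
        using finsum_smult_ldistr[OF S(2) a cl[OF c(1)]] c(2) by simp
      also have "\<dots> = finsum M (\<lambda>s. (a * c s) \<odot>\<^bsub>M\<^esub> s) S"
        using c(1) a S by (intro M.finsum_cong') (auto simp: smult_mult Pi_iff subset_iff)
      finally show ?thesis using c(1) a unfolding H_def
        by (intro CollectI exI[of _ "\<lambda>s. a * c s"]) (auto simp: Pi_iff)
    qed
  qed (use cl in \<open>auto simp: H_def intro!: M.finsum_closed\<close>)
  moreover have "S \<subseteq> H"
  proof
    fix s assume s: "s \<in> S"
    have "finsum M (\<lambda>t. (if s = t then 1 else 0) \<odot>\<^bsub>M\<^esub> t) S =
      finsum M (\<lambda>t. if s = t then t else \<zero>\<^bsub>M\<^esub>) S"
      using S by (intro M.finsum_cong') (auto simp: subset_iff)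
    also have "\<dots> = s" using M.finsum_singleton[OF s S(2), of "\<lambda>t. t"] S by auto
    finally show "s \<in> H" unfolding H_def
      by (intro CollectI exI[of _ "\<lambda>t. if s = t then 1 else 0"]) auto
  qed
  ultimately have "x \<in> H" using lspan_least x by blast
  then show ?thesis using that by (auto simp: H_def)
qed

lemma fin_gen_iff: "fin_gen r M \<longleftrightarrow> (\<exists>S. finite S \<and> S \<subseteq> carrier M \<and> carrier M \<subseteq> lspan r M S)"
proof
  assume "fin_gen r M"
  then obtain S where S: "finite S" "S \<subseteq> carrier M"
    and c: "\<And>m. m \<in> carrier M \<Longrightarrow> \<exists>c \<in> S \<rightarrow> carrier (sym_alg r). m = finsum M (\<lambda>s. c s \<odot>\<^bsub>M\<^esub> s) S"
    unfolding fin_gen_def by blast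
  note H = lspan_submodule[OF S(2)]
  have "m \<in> lspan r M S" if m: "m \<in> carrier M" for m
  proof -
    obtain c where c: "c \<in> S \<rightarrow> carrier (sym_alg r)" "m = finsum M (\<lambda>s. c s \<odot>\<^bsub>M\<^esub> s) S"
      using c[OF m] by blast
    have "c s \<odot>\<^bsub>M\<^esub> s \<in> lspan r M S" if "s \<in> S" for s
      using that c(1) lspan_incl[OF S(2)] submoduleE(4)[OF H] by auto
    then show ?thesis unfolding c(2) by (rule finsum_in_submodule[OF H])
  qed
  then show "\<exists>S. finite S \<and> S \<subseteq> carrier M \<and> carrier M \<subseteq> lspan r M S" using S by blast
next
  assume "\<exists>S. finite S \<and> S \<subseteq> carrier M \<and> carrier M \<subseteq> lspan r M S"
  then obtain S where S: "finite S" "S \<subseteq> carrier M" "carrier M \<subseteq> lspan r M S" by blast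
  have "\<exists>c \<in> S \<rightarrow> carrier (sym_alg r). m = finsum M (\<lambda>s. c s \<odot>\<^bsub>M\<^esub> s) S" if m: "m \<in> carrier M" for m
    using lspan_eq_finsum[OF S(2,1), of m] S(3) m by blast
  then show "fin_gen r M" unfolding fin_gen_def using S by blast
qed

text \<open>With \<open>N\<close> the span of the other generators, these are the coefficients at
  \<open>s\<close> that occur in elements of \<open>H\<close>. Hilbert's basis theorem is applied to
  this ideal.\<close>

lemma coefficient_ideal:
  assumes s: "s \<in> carrier M" and N: "submodule N (sym_alg r) M" and H: "submodule H (sym_alg r) M"
  shows "ideal_like r {a \<in> carrier (sym_alg r). \<exists>y\<in>N. a \<odot>\<^bsub>M\<^esub> s \<oplus>\<^bsub>M\<^esub> y \<in> H}"
proof -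
  have "\<exists>y\<in>N. (a + b) \<odot>\<^bsub>M\<^esub> s \<oplus>\<^bsub>M\<^esub> y \<in> H"
    if ab: "a \<in> carrier (sym_alg r)" "b \<in> carrier (sym_alg r)"
      and y: "y \<in> N" "a \<odot>\<^bsub>M\<^esub> s \<oplus>\<^bsub>M\<^esub> y \<in> H" and z: "z \<in> N" "b \<odot>\<^bsub>M\<^esub> s \<oplus>\<^bsub>M\<^esub> z \<in> H" for a b y z
  proof
    have "y \<in> carrier M" "z \<in> carrier M" using y z submoduleE(1)[OF N] by auto
    then have "(a + b) \<odot>\<^bsub>M\<^esub> s \<oplus>\<^bsub>M\<^esub> (y \<oplus>\<^bsub>M\<^esub> z) = (a \<odot>\<^bsub>M\<^esub> s \<oplus>\<^bsub>M\<^esub> y) \<oplus>\<^bsub>M\<^esub> (b \<odot>\<^bsub>M\<^esub> s \<oplus>\<^bsub>M\<^esub> z)"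
      using ab s by (simp add: smult_add_left M.a_ac)
    then show "(a + b) \<odot>\<^bsub>M\<^esub> s \<oplus>\<^bsub>M\<^esub> (y \<oplus>\<^bsub>M\<^esub> z) \<in> H" using y z submoduleE(5)[OF H] by simp
    show "y \<oplus>\<^bsub>M\<^esub> z \<in> N" using y z submoduleE(5)[OF N] by simp
  qed
  moreover have "\<exists>y\<in>N. (b * a) \<odot>\<^bsub>M\<^esub> s \<oplus>\<^bsub>M\<^esub> y \<in> H"
    if ab: "a \<in> carrier (sym_alg r)" "b \<in> carrier (sym_alg r)"
      and y: "y \<in> N" "a \<odot>\<^bsub>M\<^esub> s \<oplus>\<^bsub>M\<^esub> y \<in> H" for a b y
  proof
    have "y \<in> carrier M" using y submoduleE(1)[OF N] by auto
    then have "(b * a) \<odot>\<^bsub>M\<^esub> s \<oplus>\<^bsub>M\<^esub> b \<odot>\<^bsub>M\<^esub> y = b \<odot>\<^bsub>M\<^esub> (a \<odot>\<^bsub>M\<^esub> s \<oplus>\<^bsub>M\<^esub> y)"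
      using ab s by (simp add: smult_mult smult_r_distr)
    then show "(b * a) \<odot>\<^bsub>M\<^esub> s \<oplus>\<^bsub>M\<^esub> b \<odot>\<^bsub>M\<^esub> y \<in> H" using ab y submoduleE(4)[OF H] by simp
    show "b \<odot>\<^bsub>M\<^esub> y \<in> N" using ab y submoduleE(4)[OF N] by simp
  qed
  moreover have "0 \<odot>\<^bsub>M\<^esub> s \<oplus>\<^bsub>M\<^esub> \<zero>\<^bsub>M\<^esub> \<in> H" using s submodule_zero[OF H] by simp
  ultimately show ?thesis
    unfolding ideal_like_def using submodule_zero[OF N] by auto
qed

text \<open>Induction on the generators. With \<open>N\<close> the span of \<open>S\<close>, both
  \<open>K \<inter> N\<close> and the ideal of coefficients at \<open>s\<close> are finitely
  generated; generators of the former, together with elements of \<open>K\<close> realizing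
  generators of the latter, generate \<open>K\<close>.\<close>

lemma submodule_fin_gen:
  assumes "finite S" "S \<subseteq> carrier M" "submodule K (sym_alg r) M" "K \<subseteq> lspan r M S"
  shows "\<exists>B. finite B \<and> B \<subseteq> K \<and> K \<subseteq> lspan r M B"
  using assms
proof (induction S arbitrary: K rule: finite_induct)
  case empty
  have "lspan r M {} \<subseteq> {\<zero>\<^bsub>M\<^esub>}" by (auto elim: lspan.cases)
  then have "K \<subseteq> lspan r M {}" using empty lspan_zero by blast
  then show ?case by blast
next
  case (insert s S K)
  have S: "S \<subseteq> carrier M" and s: "s \<in> carrier M" using insert.prems by auto
  note K = submoduleE[OF insert.prems(2)] submodule_zero[OF insert.prems(2)]
  define N where "N = lspan r M S"
  have Nsub: "submodule N (sym_alg r) M" unfolding N_def using lspan_submodule[OF S] .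
  note N = submoduleE[OF Nsub] submodule_zero[OF Nsub]
  have KN: "submodule (K \<inter> N) (sym_alg r) M"
    using K N by (intro submoduleI') auto
  then obtain B where B: "finite B" "B \<subseteq> K" "K \<inter> N \<subseteq> lspan r M B"
    using insert.IH[OF S KN] by (auto simp: N_def)
  define I where "I H = {a \<in> carrier (sym_alg r). \<exists>y\<in>N. a \<odot>\<^bsub>M\<^esub> s \<oplus>\<^bsub>M\<^esub> y \<in> H}" for H
  obtain C where C: "finite C" "C \<subseteq> I K" "\<And>J. ideal_like r J \<Longrightarrow> C \<subseteq> J \<Longrightarrow> I K \<subseteq> J"
    using hilbert_basis[OF coefficient_ideal[OF s Nsub insert.prems(2)]] unfolding I_def by blast
  have "\<forall>c\<in>C. \<exists>y. y \<in> N \<and> c \<odot>\<^bsub>M\<^esub> s \<oplus>\<^bsub>M\<^esub> y \<in> K" using C(2) by (auto simp: I_def)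
  then obtain y where y: "\<And>c. c \<in> C \<Longrightarrow> y c \<in> N" "\<And>c. c \<in> C \<Longrightarrow> c \<odot>\<^bsub>M\<^esub> s \<oplus>\<^bsub>M\<^esub> y c \<in> K"
    by metis
  define D where "D = B \<union> (\<lambda>c. c \<odot>\<^bsub>M\<^esub> s \<oplus>\<^bsub>M\<^esub> y c) ` C"
  have D: "finite D" "D \<subseteq> K" using B C(1) y by (auto simp: D_def)
  then have DM: "D \<subseteq> carrier M" using K(1) by auto
  note Dsub = lspan_submodule[OF DM]
  have "c \<in> I (lspan r M D)" if "c \<in> C" for c
  proof -
    have "c \<odot>\<^bsub>M\<^esub> s \<oplus>\<^bsub>M\<^esub> y c \<in> lspan r M D"
      using lspan_incl[OF DM] that by (auto simp: D_def)
    then show ?thesis using that C(2) y(1) by (auto simp: I_def)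
  qed
  then have "C \<subseteq> I (lspan r M D)" by blast
  \<comment> \<open>Every coefficient at \<open>s\<close> that occurs in \<open>K\<close> already
    occurs in the span of \<open>D\<close>.\<close>
  then have IK: "I K \<subseteq> I (lspan r M D)"
    using C(3) coefficient_ideal[OF s Nsub Dsub] unfolding I_def by blast
  have "x \<in> lspan r M D" if x: "x \<in> K" for x
  proof -
    have "\<exists>a\<in>carrier (sym_alg r). \<exists>z\<in>N. x = a \<odot>\<^bsub>M\<^esub> s \<oplus>\<^bsub>M\<^esub> z"
      if "x \<in> lspan r M (insert s S)" for x
      using that
    proof induction
      case lspan_zero
      then show ?case using s N(7) by (intro bexI[of _ 0] bexI[of _ "\<zero>\<^bsub>M\<^esub>"]) auto
    next
      case (lspan_step b t x)
      then obtain a z where az: "a \<in> carrier (sym_alg r)" "z \<in> N" "x = a \<odot>\<^bsub>M\<^esub> s \<oplus>\<^bsub>M\<^esub> z" by blast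
      have zM: "z \<in> carrier M" using az N by auto
      show ?case
      proof (cases "t = s")
        case True
        then have "b \<odot>\<^bsub>M\<^esub> t \<oplus>\<^bsub>M\<^esub> x = (b + a) \<odot>\<^bsub>M\<^esub> s \<oplus>\<^bsub>M\<^esub> z"
          using az lspan_step s zM by (simp add: smult_add_left M.a_assoc)
        then show ?thesis using az lspan_step by (intro bexI[of _ "b + a"] bexI[of _ z]) auto
      next
        case False
        then have t: "t \<in> S" "t \<in> N" using lspan_step lspan_incl[OF S] by (auto simp: N_def)
        then have "b \<odot>\<^bsub>M\<^esub> t \<oplus>\<^bsub>M\<^esub> x = a \<odot>\<^bsub>M\<^esub> s \<oplus>\<^bsub>M\<^esub> (b \<odot>\<^bsub>M\<^esub> t \<oplus>\<^bsub>M\<^esub> z)"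
          unfolding az(3) using az(1) lspan_step.hyps(1) s zM subsetD[OF S, of t]
          by (simp add: M.a_ac)
        moreover have "b \<odot>\<^bsub>M\<^esub> t \<oplus>\<^bsub>M\<^esub> z \<in> N" using N(4,5) t az lspan_step by simp
        ultimately show ?thesis using az by blast
      qed
    qed
    then obtain a z where az: "a \<in> carrier (sym_alg r)" "z \<in> N" "x = a \<odot>\<^bsub>M\<^esub> s \<oplus>\<^bsub>M\<^esub> z"
      using x insert.prems(3) by blast
    then have "a \<in> I K" using x by (auto simp: I_def)
    then obtain w where w: "w \<in> N" "a \<odot>\<^bsub>M\<^esub> s \<oplus>\<^bsub>M\<^esub> w \<in> lspan r M D" using IK by (auto simp: I_def)
    have zw: "z \<in> carrier M" "w \<in> carrier M" using az w N by auto
    have DK: "lspan r M D \<subseteq> K" using lspan_least[OF insert.prems(2) D(2)] .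
    \<comment> \<open>The element \<open>x\<close> differs from an element of the span of
      \<open>D\<close> with the same coefficient \<open>a\<close> by an element of
      \<open>K \<inter> N\<close>, and that intersection is spanned by \<open>B\<close>.\<close>
    have eq: "x = (a \<odot>\<^bsub>M\<^esub> s \<oplus>\<^bsub>M\<^esub> w) \<oplus>\<^bsub>M\<^esub> (z \<ominus>\<^bsub>M\<^esub> w)"
    proof -
      have "w \<oplus>\<^bsub>M\<^esub> (z \<ominus>\<^bsub>M\<^esub> w) = z \<oplus>\<^bsub>M\<^esub> (w \<oplus>\<^bsub>M\<^esub> \<ominus>\<^bsub>M\<^esub> w)"
        using zw by (simp add: M.minus_eq M.a_lcomm)
      then show ?thesis using az zw s by (simp add: M.a_assoc M.r_neg)
    qed
    have zwN: "z \<ominus>\<^bsub>M\<^esub> w \<in> N" using N(3,5) az w by (simp add: M.minus_eq)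
    have "z \<ominus>\<^bsub>M\<^esub> w = \<ominus>\<^bsub>M\<^esub> (a \<odot>\<^bsub>M\<^esub> s \<oplus>\<^bsub>M\<^esub> w) \<oplus>\<^bsub>M\<^esub> x"
      unfolding eq using az zw s by (simp add: M.r_neg1)
    then have "z \<ominus>\<^bsub>M\<^esub> w \<in> K" using K(3,5) x w DK by auto
    then have "z \<ominus>\<^bsub>M\<^esub> w \<in> lspan r M B" using zwN B(3) by auto
    then have "z \<ominus>\<^bsub>M\<^esub> w \<in> lspan r M D" using lspan_mono[of B D] by (auto simp: D_def)
    then show ?thesis using eq w(2) submoduleE(5)[OF Dsub] by simp
  qed
  then show ?case using D by blast
qed

end

section \<open>Linear maps, bases and localization\<close>

text \<open>Degrees are left out on purpose: the embedding of \<open>M(s)\<close> into the sections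
  over an edge multiplies by \<alpha> and so raises degrees by two.\<close>

definition lin_maps :: "nat \<Rightarrow> (poly_elt, 'm) gmodule \<Rightarrow> (poly_elt, 'n) gmodule \<Rightarrow> ('m \<Rightarrow> 'n) set"
  where "lin_maps r M N = {f \<in> carrier M \<rightarrow> carrier N.
     (\<forall>x \<in> carrier M. \<forall>y \<in> carrier M. f (x \<oplus>\<^bsub>M\<^esub> y) = f x \<oplus>\<^bsub>N\<^esub> f y) \<and>
     (\<forall>a \<in> carrier (sym_alg r). \<forall>x \<in> carrier M. f (a \<odot>\<^bsub>M\<^esub> x) = a \<odot>\<^bsub>N\<^esub> f x)}"

lemma gmod_hom_lin_maps: "f \<in> gmod_hom r M N \<Longrightarrow> f \<in> lin_maps r M N"
  by (auto simp: gmod_hom_def lin_maps_def)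

locale lin_map = M: sym_module r M + N: sym_module r N
  for r :: nat and M :: "(poly_elt, 'm) gmodule" and N :: "(poly_elt, 'n) gmodule" +
  fixes f :: "'m \<Rightarrow> 'n"
  assumes lin: "f \<in> lin_maps r M N"
begin

lemma closed [simp]: "x \<in> carrier M \<Longrightarrow> f x \<in> carrier N"
  using lin by (auto simp: lin_maps_def)

lemma add [simp]: "x \<in> carrier M \<Longrightarrow> y \<in> carrier M \<Longrightarrow> f (x \<oplus>\<^bsub>M\<^esub> y) = f x \<oplus>\<^bsub>N\<^esub> f y"
  using lin by (auto simp: lin_maps_def)

lemma smult [simp]:
  "a \<in> carrier (sym_alg r) \<Longrightarrow> x \<in> carrier M \<Longrightarrow> f (a \<odot>\<^bsub>M\<^esub> x) = a \<odot>\<^bsub>N\<^esub> f x"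
  using lin by (auto simp: lin_maps_def)

lemma zero [simp]: "f \<zero>\<^bsub>M\<^esub> = \<zero>\<^bsub>N\<^esub>"
  using smult[of 0 "\<zero>\<^bsub>M\<^esub>"] by simp

lemma minus [simp]: "x \<in> carrier M \<Longrightarrow> f (\<ominus>\<^bsub>M\<^esub> x) = \<ominus>\<^bsub>N\<^esub> f x"
  by (simp add: M.minus_eq_smult N.minus_eq_smult)

lemma finsum: "g \<in> I \<rightarrow> carrier M \<Longrightarrow> f (finsum M g I) = finsum N (\<lambda>i. f (g i)) I"
proof (induction I rule: infinite_finite_induct)
  case (insert i I)
  then have "g \<in> I \<rightarrow> carrier M" "g i \<in> carrier M" by auto
  then show ?case using insert by (simp add: Pi_iff)
qed (auto simp: M.finsum_infinite N.finsum_infinite)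

lemma inj_onI:
  assumes "\<And>x. x \<in> carrier M \<Longrightarrow> f x = \<zero>\<^bsub>N\<^esub> \<Longrightarrow> x = \<zero>\<^bsub>M\<^esub>"
  shows "inj_on f (carrier M)"
proof (rule Fun.inj_onI)
  fix x y assume xy: "x \<in> carrier M" "y \<in> carrier M" "f x = f y"
  then have "f (x \<ominus>\<^bsub>M\<^esub> y) = \<zero>\<^bsub>N\<^esub>" by (simp add: M.minus_eq N.r_neg)
  then have "x \<ominus>\<^bsub>M\<^esub> y = \<zero>\<^bsub>M\<^esub>" using assms xy by simp
  then have "x = \<ominus>\<^bsub>M\<^esub> (\<ominus>\<^bsub>M\<^esub> y)" using xy by (intro M.minus_equality[symmetric]) (auto simp: M.minus_eq)
  then show "x = y" using xy by simp
qed

end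

section \<open>Linear independence and free modules\<close>

definition lin_indep :: "nat \<Rightarrow> (poly_elt, 'm) gmodule \<Rightarrow> 'm set \<Rightarrow> bool" where
  "lin_indep r M B \<longleftrightarrow> B \<subseteq> carrier M \<and>
     (\<forall>T c. finite T \<and> T \<subseteq> B \<and> c \<in> T \<rightarrow> carrier (sym_alg r) \<and>
        finsum M (\<lambda>b. c b \<odot>\<^bsub>M\<^esub> b) T = \<zero>\<^bsub>M\<^esub> \<longrightarrow> (\<forall>b\<in>T. c b = 0))"

lemma lin_indepD:
  assumes "lin_indep r M B" "finite T" "T \<subseteq> B" "c \<in> T \<rightarrow> carrier (sym_alg r)"
    "finsum M (\<lambda>b. c b \<odot>\<^bsub>M\<^esub> b) T = \<zero>\<^bsub>M\<^esub>" "b \<in> T"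
  shows "c b = 0"
  using assms unfolding lin_indep_def by blast

context sym_module
begin

lemma smult_fun_closed:
  "T \<subseteq> carrier M \<Longrightarrow> c \<in> T \<rightarrow> carrier (sym_alg r) \<Longrightarrow> (\<lambda>b. c b \<odot>\<^bsub>M\<^esub> b) \<in> T \<rightarrow> carrier M"
  by auto

lemma finsum_smult_support:
  assumes "finite T" "T \<subseteq> carrier M" "c \<in> T \<rightarrow> carrier (sym_alg r)" "S \<subseteq> T"
    and "\<And>b. b \<in> T - S \<Longrightarrow> c b = 0" "\<And>b. b \<in> S \<Longrightarrow> d b = c b"
  shows "finsum M (\<lambda>b. d b \<odot>\<^bsub>M\<^esub> b) S = finsum M (\<lambda>b. c b \<odot>\<^bsub>M\<^esub> b) T"
  using assms
  by (intro M.add.finprod_mono_neutral_cong_left smult_fun_closed) auto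

lemma lspan_finite_subset:
  assumes "x \<in> lspan r M B"
  shows "\<exists>T. finite T \<and> T \<subseteq> B \<and> x \<in> lspan r M T"
  using assms
proof induction
  case lspan_zero
  then show ?case using lspan.lspan_zero by blast
next
  case (lspan_step a s x)
  then obtain T where T: "finite T" "T \<subseteq> B" "x \<in> lspan r M T" by blast
  then have "x \<in> lspan r M (insert s T)" using lspan_mono[of T "insert s T"] by auto
  then have "a \<odot>\<^bsub>M\<^esub> s \<oplus>\<^bsub>M\<^esub> x \<in> lspan r M (insert s T)"
    using lspan_step by (intro lspan.lspan_step) auto
  then show ?case using T lspan_step by blast
qed

text \<open>Independence speaks of finite relations with arbitrary coefficients, which are easy to
  pull back and to split, whereas \<open>free_module\<close> speaks of coefficient functions on all
  of \<open>B\<close> summed over their supports. Two such expansions are therefore compared on the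
  union of their supports.\<close>

lemma basis_imp_free_module:
  assumes ind: "lin_indep r M B" and span: "carrier M \<subseteq> lspan r M B"
  shows "free_module r M"
  unfolding free_module_def
proof (intro exI[of _ B] conjI ballI)
  show B: "B \<subseteq> carrier M" using ind by (simp add: lin_indep_def)
  fix m assume m: "m \<in> carrier M"
  let ?Q = "\<lambda>c. c \<in> B \<rightarrow>\<^sub>E carrier (sym_alg r) \<and> finite {b \<in> B. c b \<noteq> 0} \<and>
          m = finsum M (\<lambda>b. c b \<odot>\<^bsub>M\<^esub> b) {b \<in> B. c b \<noteq> 0}"
  obtain T where T: "finite T" "T \<subseteq> B" "m \<in> lspan r M T"
    using lspan_finite_subset[OF subsetD[OF span m]] by blast
  have TM: "T \<subseteq> carrier M" using T B by auto
  obtain c where c: "c \<in> T \<rightarrow> carrier (sym_alg r)" "m = finsum M (\<lambda>b. c b \<odot>\<^bsub>M\<^esub> b) T"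
    using lspan_eq_finsum[OF TM T(1,3)] .
  define d where "d = (\<lambda>b\<in>B. if b \<in> T then c b else 0)"
  have supp: "{b \<in> B. d b \<noteq> 0} \<subseteq> T" by (auto simp: d_def)
  have "finsum M (\<lambda>b. d b \<odot>\<^bsub>M\<^esub> b) {b \<in> B. d b \<noteq> 0} = finsum M (\<lambda>b. c b \<odot>\<^bsub>M\<^esub> b) T"
    using T(2) by (intro finsum_smult_support[OF T(1) TM c(1) supp]) (auto simp: d_def split: if_splits)
  then have "?Q d" using c supp T(1) by (auto simp: d_def Pi_iff finite_subset)
  moreover have "e = e'" if e: "?Q e" and e': "?Q e'" for e e'
  proof -
    define S where "S = {b \<in> B. e b \<noteq> 0} \<union> {b \<in> B. e' b \<noteq> 0}"
    have S: "finite S" "S \<subseteq> B" "S \<subseteq> carrier M" using e e' B by (auto simp: S_def)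
    have sum: "m = finsum M (\<lambda>b. g b \<odot>\<^bsub>M\<^esub> b) S"
      if g: "?Q g" "{b \<in> B. g b \<noteq> 0} \<subseteq> S" for g
    proof -
      have "g \<in> S \<rightarrow> carrier (sym_alg r)" using g(1) S(2) by auto
      from finsum_smult_support[OF S(1,3) this g(2)]
      have "finsum M (\<lambda>b. g b \<odot>\<^bsub>M\<^esub> b) {b \<in> B. g b \<noteq> 0} = finsum M (\<lambda>b. g b \<odot>\<^bsub>M\<^esub> b) S"
        using S(2) by blast
      then show ?thesis using g by simp
    qed
    have eA: "e \<in> S \<rightarrow> carrier (sym_alg r)" "(\<lambda>b. - e' b) \<in> S \<rightarrow> carrier (sym_alg r)"
      "e' \<in> S \<rightarrow> carrier (sym_alg r)"
    proof -
      have "e b \<in> carrier (sym_alg r)" "e' b \<in> carrier (sym_alg r)" if "b \<in> S" for b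
        using conjunct1[OF e] conjunct1[OF e'] S(2) that by auto
      then show "e \<in> S \<rightarrow> carrier (sym_alg r)" "(\<lambda>b. - e' b) \<in> S \<rightarrow> carrier (sym_alg r)"
        "e' \<in> S \<rightarrow> carrier (sym_alg r)" by simp_all
    qed
    have "finsum M (\<lambda>b. (e b + - e' b) \<odot>\<^bsub>M\<^esub> b) S
      = finsum M (\<lambda>b. e b \<odot>\<^bsub>M\<^esub> b \<oplus>\<^bsub>M\<^esub> (- e' b) \<odot>\<^bsub>M\<^esub> b) S"
    proof (rule M.finsum_cong')
      fix b assume "b \<in> S"
      then have "e b \<in> carrier (sym_alg r)" "- e' b \<in> carrier (sym_alg r)" "b \<in> carrier M"
        using eA(1,2) S(3) by auto
      then show "(e b + - e' b) \<odot>\<^bsub>M\<^esub> b = e b \<odot>\<^bsub>M\<^esub> b \<oplus>\<^bsub>M\<^esub> (- e' b) \<odot>\<^bsub>M\<^esub> b"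
        by (rule smult_add_left)
    next
      show "(\<lambda>b. e b \<odot>\<^bsub>M\<^esub> b \<oplus>\<^bsub>M\<^esub> (- e' b) \<odot>\<^bsub>M\<^esub> b) \<in> S \<rightarrow> carrier M"
        using smult_fun_closed[OF S(3) eA(1)] smult_fun_closed[OF S(3) eA(2)] by (auto simp: Pi_iff)
    qed simp
    also have "\<dots> = finsum M (\<lambda>b. e b \<odot>\<^bsub>M\<^esub> b) S \<oplus>\<^bsub>M\<^esub> finsum M (\<lambda>b. (- e' b) \<odot>\<^bsub>M\<^esub> b) S"
      using smult_fun_closed[OF S(3) eA(1)] smult_fun_closed[OF S(3) eA(2)]
      by (simp add: M.finsum_addf)
    also have "finsum M (\<lambda>b. (- e' b) \<odot>\<^bsub>M\<^esub> b) S = finsum M (\<lambda>b. (- 1) \<odot>\<^bsub>M\<^esub> (e' b \<odot>\<^bsub>M\<^esub> b)) S"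
      using eA S by (intro M.finsum_cong') (auto simp: Pi_iff smult_mult[symmetric] subset_iff)
    also have "\<dots> = (- 1) \<odot>\<^bsub>M\<^esub> finsum M (\<lambda>b. e' b \<odot>\<^bsub>M\<^esub> b) S"
      using finsum_smult_ldistr[OF S(1) _ smult_fun_closed[OF S(3) eA(3)], of "- 1"] by simp
    also have "finsum M (\<lambda>b. e b \<odot>\<^bsub>M\<^esub> b) S = m" using sum[of e] e by (simp add: S_def)
    also have "finsum M (\<lambda>b. e' b \<odot>\<^bsub>M\<^esub> b) S = m" using sum[of e'] e' by (simp add: S_def)
    also have "m \<oplus>\<^bsub>M\<^esub> (- 1) \<odot>\<^bsub>M\<^esub> m = \<zero>\<^bsub>M\<^esub>" using m minus_eq_smult[OF m] M.r_neg[OF m] by simp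
    finally have "\<forall>b\<in>S. e b + - e' b = 0"
      using lin_indepD[OF ind S(1,2), of "\<lambda>b. e b + - e' b"] eA by (auto simp: Pi_iff)
    then have "e b = e' b" if "b \<in> S" for b using that by simp
    moreover have "e b = e' b" if "b \<in> B" "b \<notin> S" for b using that by (simp add: S_def)
    ultimately have "e b = e' b" if "b \<in> B" for b using that by blast
    then show ?thesis using PiE_ext[OF conjunct1[OF e] conjunct1[OF e']] by blast
  qed
  ultimately show "\<exists>!c. ?Q c" by blast
qed

text \<open>A relation extended by zero to \<open>B\<close> and the zero function are two expansions
  of the zero element, so uniqueness makes the coefficients of the relation vanish.\<close>

lemma free_module_imp_basis:
  assumes "free_module r M"
  obtains B where "lin_indep r M B" "carrier M \<subseteq> lspan r M B"
proof -
  obtain B where B: "B \<subseteq> carrier M" and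
    ex: "\<forall>m \<in> carrier M. \<exists>!c. c \<in> B \<rightarrow>\<^sub>E carrier (sym_alg r) \<and> finite {b \<in> B. c b \<noteq> 0} \<and>
          m = finsum M (\<lambda>b. c b \<odot>\<^bsub>M\<^esub> b) {b \<in> B. c b \<noteq> 0}"
    using assms unfolding free_module_def by (elim exE conjE) (rule that)
  note H = lspan_submodule[OF B]
  have "m \<in> lspan r M B" if m: "m \<in> carrier M" for m
  proof -
    obtain c where c: "c \<in> B \<rightarrow>\<^sub>E carrier (sym_alg r)"
      "m = finsum M (\<lambda>b. c b \<odot>\<^bsub>M\<^esub> b) {b \<in> B. c b \<noteq> 0}"
      using ex1_implies_ex[OF bspec[OF ex m]] by blast
    have "c b \<odot>\<^bsub>M\<^esub> b \<in> lspan r M B" if "b \<in> B" for b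
      using that c(1) lspan_incl[OF B] submoduleE(4)[OF H] by auto
    then show ?thesis unfolding c(2) by (intro finsum_in_submodule[OF H]) auto
  qed
  moreover have "lin_indep r M B"
    unfolding lin_indep_def
  proof (intro conjI allI impI ballI B)
    fix T c b
    assume "finite T \<and> T \<subseteq> B \<and> c \<in> T \<rightarrow> carrier (sym_alg r) \<and>
        finsum M (\<lambda>b. c b \<odot>\<^bsub>M\<^esub> b) T = \<zero>\<^bsub>M\<^esub>" and b: "b \<in> T"
    then have T: "finite T" "T \<subseteq> B" "c \<in> T \<rightarrow> carrier (sym_alg r)"
      "finsum M (\<lambda>b. c b \<odot>\<^bsub>M\<^esub> b) T = \<zero>\<^bsub>M\<^esub>" by auto
    have TM: "T \<subseteq> carrier M" using T B by auto
    define d where "d = (\<lambda>b\<in>B. if b \<in> T then c b else 0)"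
    have supp: "{b \<in> B. d b \<noteq> 0} \<subseteq> T" by (auto simp: d_def)
    have "finsum M (\<lambda>b. d b \<odot>\<^bsub>M\<^esub> b) {b \<in> B. d b \<noteq> 0} = finsum M (\<lambda>b. c b \<odot>\<^bsub>M\<^esub> b) T"
      using T(2) by (intro finsum_smult_support[OF T(1) TM T(3) supp]) (auto simp: d_def split: if_splits)
    then have d: "d \<in> B \<rightarrow>\<^sub>E carrier (sym_alg r) \<and> finite {b \<in> B. d b \<noteq> 0} \<and>
          \<zero>\<^bsub>M\<^esub> = finsum M (\<lambda>b. d b \<odot>\<^bsub>M\<^esub> b) {b \<in> B. d b \<noteq> 0}"
      using T supp by (auto simp: d_def Pi_iff finite_subset)
    define z where "z = (\<lambda>b\<in>B. 0 :: poly_elt)"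
    have zs: "{b \<in> B. z b \<noteq> 0} = {}" by (auto simp: z_def)
    have z: "z \<in> B \<rightarrow>\<^sub>E carrier (sym_alg r) \<and> finite {b \<in> B. z b \<noteq> 0} \<and>
          \<zero>\<^bsub>M\<^esub> = finsum M (\<lambda>b. z b \<odot>\<^bsub>M\<^esub> b) {b \<in> B. z b \<noteq> 0}"
      unfolding zs by (auto simp: z_def)
    define Q where "Q c \<longleftrightarrow> c \<in> B \<rightarrow>\<^sub>E carrier (sym_alg r) \<and> finite {b \<in> B. c b \<noteq> 0} \<and>
          \<zero>\<^bsub>M\<^esub> = finsum M (\<lambda>b. c b \<odot>\<^bsub>M\<^esub> b) {b \<in> B. c b \<noteq> 0}" for c
    have "\<exists>!c. Q c" unfolding Q_def by (rule bspec[OF ex M.zero_closed])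
    moreover have "Q d" unfolding Q_def by (rule d)
    moreover have "Q z" unfolding Q_def by (rule z)
    ultimately have "d = z" by blast
    then have "d b = z b" by (rule fun_cong)
    then show "c b = 0" using b T(2) by (auto simp: d_def z_def)
  qed
  ultimately show ?thesis using that by blast
qed

text \<open>Coordinates in a basis are multiplied by \<open>a\<close>, and polynomials have no zero
  divisors.\<close>

lemma free_module_torsion_free:
  assumes "free_module r M" and a: "a \<in> carrier (sym_alg r)" "a \<noteq> 0"
    and m: "m \<in> carrier M" "a \<odot>\<^bsub>M\<^esub> m = \<zero>\<^bsub>M\<^esub>"
  shows "m = \<zero>\<^bsub>M\<^esub>"
proof -
  obtain B where B: "lin_indep r M B" "carrier M \<subseteq> lspan r M B"
    using free_module_imp_basis[OF assms(1)] .
  obtain T where T: "finite T" "T \<subseteq> B" "m \<in> lspan r M T"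
    using lspan_finite_subset[OF subsetD[OF B(2) m(1)]] by blast
  have TM: "T \<subseteq> carrier M" using T B by (auto simp: lin_indep_def)
  obtain c where c: "c \<in> T \<rightarrow> carrier (sym_alg r)" "m = finsum M (\<lambda>b. c b \<odot>\<^bsub>M\<^esub> b) T"
    using lspan_eq_finsum[OF TM T(1,3)] .
  have "finsum M (\<lambda>b. (a * c b) \<odot>\<^bsub>M\<^esub> b) T = finsum M (\<lambda>b. a \<odot>\<^bsub>M\<^esub> (c b \<odot>\<^bsub>M\<^esub> b)) T"
    using c a TM by (intro M.finsum_cong') (auto simp: Pi_iff subset_iff smult_mult)
  also have "\<dots> = a \<odot>\<^bsub>M\<^esub> m"
    using finsum_smult_ldistr[OF T(1) a(1) smult_fun_closed[OF TM c(1)]] c(2) by simp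
  finally have "finsum M (\<lambda>b. (a * c b) \<odot>\<^bsub>M\<^esub> b) T = \<zero>\<^bsub>M\<^esub>" unfolding m(2) .
  moreover have "(\<lambda>b. a * c b) \<in> T \<rightarrow> carrier (sym_alg r)"
    using a(1) c(1) by (auto simp: Pi_iff)
  ultimately have "a * c b = 0" if "b \<in> T" for b
    using lin_indepD[OF B(1) T(1,2) _ _ that, of "\<lambda>b. a * c b"] by blast
  then have "c b = 0" if "b \<in> T" for b using a(2) that by (metis mult_eq_0_iff)
  then show ?thesis unfolding c(2) using TM by (intro M.add.finprod_one_eqI) (auto simp: subset_iff)
qed

end

text \<open>Reindexing along the injection exhibits a relation among images as the image of a
  relation.\<close>

lemma (in lin_map) lin_indep_image:
  assumes inj: "inj_on f (carrier M)" and B: "lin_indep r M B"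
  shows "lin_indep r N (f ` B)"
  unfolding lin_indep_def
proof (intro conjI allI impI)
  have BM: "B \<subseteq> carrier M" using B by (simp add: lin_indep_def)
  then show "f ` B \<subseteq> carrier N" by auto
  fix T c
  assume "finite T \<and> T \<subseteq> f ` B \<and> c \<in> T \<rightarrow> carrier (sym_alg r) \<and>
        finsum N (\<lambda>b. c b \<odot>\<^bsub>N\<^esub> b) T = \<zero>\<^bsub>N\<^esub>"
  then have T: "finite T" "T \<subseteq> f ` B" "c \<in> T \<rightarrow> carrier (sym_alg r)"
    "finsum N (\<lambda>b. c b \<odot>\<^bsub>N\<^esub> b) T = \<zero>\<^bsub>N\<^esub>" by auto
  obtain S where S: "S \<subseteq> B" "finite S" "T = f ` S"
    using finite_subset_image[OF T(1,2)] by blast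
  have SM: "S \<subseteq> carrier M" using S BM by auto
  have injS: "inj_on f S" using inj SM by (rule inj_on_subset)
  have cf: "(\<lambda>b. c (f b)) \<in> S \<rightarrow> carrier (sym_alg r)" using T(3) S by auto
  have cl: "(\<lambda>b. c (f b) \<odot>\<^bsub>M\<^esub> b) \<in> S \<rightarrow> carrier M" using M.smult_fun_closed[OF SM cf] .
  have fS: "f ` S \<subseteq> carrier N" using SM by auto
  have "f (finsum M (\<lambda>b. c (f b) \<odot>\<^bsub>M\<^esub> b) S) = finsum N (\<lambda>b. f (c (f b) \<odot>\<^bsub>M\<^esub> b)) S"
    by (rule finsum[OF cl])
  also have "\<dots> = finsum N (\<lambda>b. c (f b) \<odot>\<^bsub>N\<^esub> f b) S"
    using cf SM by (intro N.M.finsum_cong') (auto simp: Pi_iff subset_iff)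
  also have "\<dots> = finsum N (\<lambda>b. c b \<odot>\<^bsub>N\<^esub> b) T"
    unfolding S(3) using N.smult_fun_closed[OF fS] T(3) S(3) injS
    by (intro N.M.finsum_reindex[symmetric]) auto
  also have "\<dots> = f \<zero>\<^bsub>M\<^esub>" using T(4) by simp
  finally have "finsum M (\<lambda>b. c (f b) \<odot>\<^bsub>M\<^esub> b) S = \<zero>\<^bsub>M\<^esub>"
    using inj cl by (auto simp: inj_on_def)
  then have "c (f b) = 0" if "b \<in> S" for b
    by (rule lin_indepD[OF B S(2,1) cf _ that])
  then show "\<forall>b\<in>T. c b = 0" using S(3) by auto
qed

lemma (in lin_map) lspan_image:
  assumes "S \<subseteq> carrier M" "x \<in> lspan r M S"
  shows "f x \<in> lspan r N (f ` S)"
  using assms(2)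
proof induction
  case lspan_zero
  then show ?case using lspan.lspan_zero by auto
next
  case (lspan_step a s x)
  then have "x \<in> carrier M" "s \<in> carrier M" using M.lspan_closed[OF assms(1)] assms(1) by auto
  then show ?case using lspan_step by (auto intro!: lspan.lspan_step)
qed

lemma (in lin_map) free_module_iso:
  assumes "inj_on f (carrier M)" "carrier N \<subseteq> f ` carrier M" "free_module r M"
  shows "free_module r N"
proof -
  obtain B where B: "lin_indep r M B" "carrier M \<subseteq> lspan r M B"
    using M.free_module_imp_basis[OF assms(3)] .
  have BM: "B \<subseteq> carrier M" using B by (simp add: lin_indep_def)
  have "carrier N \<subseteq> lspan r N (f ` B)" using lspan_image[OF BM] B(2) assms(2) by blast
  then show ?thesis using N.basis_imp_free_module[OF lin_indep_image[OF assms(1) B(1)]] by blast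
qed

text \<open>A basis of the middle term is the image of a basis on the left together with lifts of a
  basis on the right.\<close>

lemma free_module_extension:
  assumes i: "lin_map r K M i" and p: "lin_map r M N p"
    and inj: "inj_on i (carrier K)" and surj: "carrier N \<subseteq> p ` carrier M"
    and ker: "\<And>x. x \<in> carrier M \<Longrightarrow> p x = \<zero>\<^bsub>N\<^esub> \<longleftrightarrow> x \<in> i ` carrier K"
    and free: "free_module r K" "free_module r N"
  shows "free_module r M"
proof -
  interpret K: sym_module r K using i by (rule lin_map.axioms)
  interpret M: sym_module r M using i by (rule lin_map.axioms)
  interpret N: sym_module r N using p by (rule lin_map.axioms)
  interpret i: lin_map r K M i by fact
  interpret p: lin_map r M N p by fact
  obtain B where B: "lin_indep r K B" "carrier K \<subseteq> lspan r K B"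
    using K.free_module_imp_basis[OF free(1)] .
  obtain C where C: "lin_indep r N C" "carrier N \<subseteq> lspan r N C"
    using N.free_module_imp_basis[OF free(2)] .
  have BK: "B \<subseteq> carrier K" and CN: "C \<subseteq> carrier N" using B C by (simp_all add: lin_indep_def)
  have "\<forall>c\<in>C. \<exists>x\<in>carrier M. p x = c" using surj CN by blast
  then obtain s where s: "\<And>c. c \<in> C \<Longrightarrow> s c \<in> carrier M" "\<And>c. c \<in> C \<Longrightarrow> p (s c) = c" by metis
  define D where "D = i ` B \<union> s ` C"
  have DM: "D \<subseteq> carrier M" using BK s by (auto simp: D_def)
  note H = M.submoduleE[OF M.lspan_submodule[OF DM]]
  have lift: "\<exists>y\<in>lspan r M D. p y = x" if "x \<in> lspan r N C" for x
    using that
  proof induction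
    case lspan_zero
    then show ?case using lspan.lspan_zero p.zero by blast
  next
    case (lspan_step a c x)
    then obtain y where y: "y \<in> lspan r M D" "p y = x" by blast
    have yM: "y \<in> carrier M" using y H by auto
    have "a \<odot>\<^bsub>M\<^esub> s c \<oplus>\<^bsub>M\<^esub> y \<in> lspan r M D"
      using lspan_step y by (intro lspan.lspan_step) (auto simp: D_def)
    moreover have "p (a \<odot>\<^bsub>M\<^esub> s c \<oplus>\<^bsub>M\<^esub> y) = a \<odot>\<^bsub>N\<^esub> c \<oplus>\<^bsub>N\<^esub> x"
      using lspan_step s[of c] y yM by simp
    ultimately show ?case by blast
  qed
  have "x \<in> lspan r M D" if x: "x \<in> carrier M" for x
  proof -
    have "p x \<in> lspan r N C" using x C(2) by auto
    then obtain y where y: "y \<in> lspan r M D" "p y = p x" using lift by blast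
    have yM: "y \<in> carrier M" using y H by auto
    have "p (x \<ominus>\<^bsub>M\<^esub> y) = \<zero>\<^bsub>N\<^esub>" using x yM y by (simp add: M.minus_eq N.r_neg)
    then obtain k where k: "k \<in> carrier K" "x \<ominus>\<^bsub>M\<^esub> y = i k" using ker x yM by auto
    have "i k \<in> lspan r M (i ` B)" using i.lspan_image[OF BK] k B by auto
    then have "x \<ominus>\<^bsub>M\<^esub> y \<in> lspan r M D" using k M.lspan_mono[of "i ` B" D] by (auto simp: D_def)
    then have "x \<ominus>\<^bsub>M\<^esub> y \<oplus>\<^bsub>M\<^esub> y \<in> lspan r M D" using H y by simp
    moreover have "x \<ominus>\<^bsub>M\<^esub> y \<oplus>\<^bsub>M\<^esub> y = x" using x yM by (simp add: M.minus_eq M.a_assoc M.l_neg)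
    ultimately show ?thesis by simp
  qed
  moreover have "lin_indep r M D"
    unfolding lin_indep_def
  proof (intro conjI allI impI DM)
    fix T c
    assume "finite T \<and> T \<subseteq> D \<and> c \<in> T \<rightarrow> carrier (sym_alg r) \<and>
        finsum M (\<lambda>b. c b \<odot>\<^bsub>M\<^esub> b) T = \<zero>\<^bsub>M\<^esub>"
    then have T: "finite T" "T \<subseteq> D" "c \<in> T \<rightarrow> carrier (sym_alg r)"
      "finsum M (\<lambda>b. c b \<odot>\<^bsub>M\<^esub> b) T = \<zero>\<^bsub>M\<^esub>" by auto
    define T1 where "T1 = T \<inter> i ` B"
    define T2 where "T2 = T - i ` B"
    have T12: "T = T1 \<union> T2" "T1 \<inter> T2 = {}" "finite T1" "finite T2"
      using T(1) by (auto simp: T1_def T2_def)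
    have cT: "c \<in> T1 \<rightarrow> carrier (sym_alg r)" "c \<in> T2 \<rightarrow> carrier (sym_alg r)"
      using T(3) T12 by auto
    have TM: "T1 \<subseteq> carrier M" "T2 \<subseteq> carrier M" using T(2) DM T12 by auto
    note cl = M.smult_fun_closed[OF TM(1) cT(1)] M.smult_fun_closed[OF TM(2) cT(2)]
    have sum: "finsum M (\<lambda>b. c b \<odot>\<^bsub>M\<^esub> b) T1 \<oplus>\<^bsub>M\<^esub> finsum M (\<lambda>b. c b \<odot>\<^bsub>M\<^esub> b) T2 = \<zero>\<^bsub>M\<^esub>"
      using T(4) T12 cl by (simp add: M.finsum_Un_disjoint)
    have "T2 \<subseteq> s ` C" using T(2) by (auto simp: T2_def D_def)
    then obtain S where S: "S \<subseteq> C" "finite S" "T2 = s ` S"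
      using finite_subset_image[OF T12(4)] by blast
    have injs: "inj_on s S" using s(2) S(1) by (auto intro!: Fun.inj_onI) (metis subsetD)
    have cs: "(\<lambda>b. c (s b)) \<in> S \<rightarrow> carrier (sym_alg r)" using cT(2) S(3) by auto
    have "p (c b \<odot>\<^bsub>M\<^esub> b) = \<zero>\<^bsub>N\<^esub>" if "b \<in> T1" for b
    proof -
      have "b \<in> i ` carrier K" "c b \<in> carrier (sym_alg r)" using that BK cT by (auto simp: T1_def)
      then show ?thesis using ker[of b] by auto
    qed
    then have p1: "p (finsum M (\<lambda>b. c b \<odot>\<^bsub>M\<^esub> b) T1) = \<zero>\<^bsub>N\<^esub>"
      unfolding p.finsum[OF cl(1)] by (intro N.add.finprod_one_eqI)
    have "p (finsum M (\<lambda>b. c b \<odot>\<^bsub>M\<^esub> b) T1 \<oplus>\<^bsub>M\<^esub> finsum M (\<lambda>b. c b \<odot>\<^bsub>M\<^esub> b) T2) = \<zero>\<^bsub>N\<^esub>"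
      using sum by simp
    then have "p (finsum M (\<lambda>b. c b \<odot>\<^bsub>M\<^esub> b) T2) = \<zero>\<^bsub>N\<^esub>" using p1 cl by simp
    moreover have "finsum M (\<lambda>b. c b \<odot>\<^bsub>M\<^esub> b) T2 = finsum M (\<lambda>b. c (s b) \<odot>\<^bsub>M\<^esub> s b) S"
      unfolding S(3) using cl(2) S(3) injs by (intro M.finsum_reindex) auto
    moreover have "p (finsum M (\<lambda>b. c (s b) \<odot>\<^bsub>M\<^esub> s b) S) = finsum N (\<lambda>b. p (c (s b) \<odot>\<^bsub>M\<^esub> s b)) S"
      using cl(2) S(3) by (intro p.finsum) auto
    moreover have "finsum N (\<lambda>b. p (c (s b) \<odot>\<^bsub>M\<^esub> s b)) S = finsum N (\<lambda>b. c (s b) \<odot>\<^bsub>N\<^esub> b) S"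
      using cs S(1) s CN by (intro N.finsum_cong') (auto simp: Pi_iff subset_iff)
    ultimately have "finsum N (\<lambda>b. c (s b) \<odot>\<^bsub>N\<^esub> b) S = \<zero>\<^bsub>N\<^esub>" by simp
    then have "c (s b) = 0" if "b \<in> S" for b
      by (rule lin_indepD[OF C(1) S(2,1) cs _ that])
    then have c2: "c b = 0" if "b \<in> T2" for b using that S(3) by auto
    then have "finsum M (\<lambda>b. c b \<odot>\<^bsub>M\<^esub> b) T2 = \<zero>\<^bsub>M\<^esub>"
      using TM by (intro M.add.finprod_one_eqI) (auto simp: subset_iff)
    then have "finsum M (\<lambda>b. c b \<odot>\<^bsub>M\<^esub> b) T1 = \<zero>\<^bsub>M\<^esub>" using sum cl by simp
    moreover have "T1 \<subseteq> i ` B" by (simp add: T1_def)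
    ultimately have "c b = 0" if "b \<in> T1" for b
      using lin_indepD[OF i.lin_indep_image[OF inj B(1)] T12(3) _ cT(1) _ that] by blast
    then show "\<forall>b\<in>T. c b = 0" using c2 T12(1) by blast
  qed
  ultimately show ?thesis by (intro M.basis_imp_free_module) auto
qed

section \<open>Localization at the powers of an element\<close>

lemma (in sym_module) loc_rel_iff:
  assumes "a \<in> carrier (sym_alg r)"
  shows "((m, i), (n, j)) \<in> loc_rel a M \<longleftrightarrow> m \<in> carrier M \<and> n \<in> carrier M \<and>
    (\<exists>k. a ^ (k + j) \<odot>\<^bsub>M\<^esub> m = a ^ (k + i) \<odot>\<^bsub>M\<^esub> n)"
  using assms by (auto simp: loc_rel_def power_add smult_mult)

lemma (in sym_module) equiv_loc_rel:
  assumes a: "a \<in> carrier (sym_alg r)"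
  shows "equiv (carrier M \<times> UNIV) (loc_rel a M)"
proof (rule equivI)
  show "loc_rel a M \<subseteq> (carrier M \<times> UNIV) \<times> (carrier M \<times> UNIV)" by (auto simp: loc_rel_def)
  show "refl_on (carrier M \<times> UNIV) (loc_rel a M)"
    by (auto simp: refl_on_def loc_rel_iff[OF a])
  show "sym (loc_rel a M)"
    by (rule symI) (auto simp: loc_rel_iff[OF a], metis)
  show "trans (loc_rel a M)"
  proof (rule transI, clarify)
    fix m i n j p h
    assume "((m, i), (n, j)) \<in> loc_rel a M" "((n, j), (p, h)) \<in> loc_rel a M"
    then obtain k l where mnp: "m \<in> carrier M" "n \<in> carrier M" "p \<in> carrier M"
      and k: "a ^ (k + j) \<odot>\<^bsub>M\<^esub> m = a ^ (k + i) \<odot>\<^bsub>M\<^esub> n"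
      and l: "a ^ (l + h) \<odot>\<^bsub>M\<^esub> n = a ^ (l + j) \<odot>\<^bsub>M\<^esub> p"
      by (auto simp: loc_rel_iff[OF a])
    have pw: "a ^ (x + y) \<odot>\<^bsub>M\<^esub> z = a ^ x \<odot>\<^bsub>M\<^esub> (a ^ y \<odot>\<^bsub>M\<^esub> z)" if "z \<in> carrier M" for x y z
      using that a by (simp add: power_add smult_mult)
    \<comment> \<open>The first relation is multiplied by the power \<open>l + h\<close> and the
      second by \<open>k + i\<close>; the exponent \<open>j\<close> of the middle denominator
      survives and is absorbed into the witness \<open>k + l + j\<close>.\<close>
    have "a ^ ((k + l + j) + h) \<odot>\<^bsub>M\<^esub> m = a ^ (l + h) \<odot>\<^bsub>M\<^esub> (a ^ (k + j) \<odot>\<^bsub>M\<^esub> m)"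
      using mnp by (simp add: pw[symmetric] ac_simps)
    also have "\<dots> = a ^ (k + i) \<odot>\<^bsub>M\<^esub> (a ^ (l + h) \<odot>\<^bsub>M\<^esub> n)"
      unfolding k using mnp by (simp only: pw[symmetric] ac_simps)
    also have "\<dots> = a ^ ((k + l + j) + i) \<odot>\<^bsub>M\<^esub> p"
      unfolding l using mnp by (simp add: pw[symmetric] ac_simps)
    finally show "((m, i), (p, h)) \<in> loc_rel a M" using mnp by (auto simp: loc_rel_iff[OF a])
  qed
qed

text \<open>Since \<open>f\<close> commutes with powers of \<open>a\<close>, its injectivity passes
  to fractions. For surjectivity, if the \<open>k\<close>-th power of \<open>a\<close> carries
  \<open>n\<close> to \<open>f m\<close>, then the fraction \<open>(n, j)\<close> equals
  \<open>(f m, k + j)\<close>.\<close>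

lemma (in lin_map) iso_after_invertingI:
  assumes a: "a \<in> carrier (sym_alg r)" and inj: "inj_on f (carrier M)"
    and cok: "\<And>n. n \<in> carrier N \<Longrightarrow> \<exists>k. a ^ k \<odot>\<^bsub>N\<^esub> n \<in> f ` carrier M"
  shows "iso_after_inverting a M N f"
proof -
  note eM = M.equiv_loc_rel[OF a] and eN = N.equiv_loc_rel[OF a]
  have resp: "((f m, i), (f n, j)) \<in> loc_rel a N \<longleftrightarrow> ((m, i), (n, j)) \<in> loc_rel a M"
    if "m \<in> carrier M" "n \<in> carrier M" for m i n j
  proof -
    have "a ^ (k + j) \<odot>\<^bsub>N\<^esub> f m = a ^ (k + i) \<odot>\<^bsub>N\<^esub> f n \<longleftrightarrow>
      a ^ (k + j) \<odot>\<^bsub>M\<^esub> m = a ^ (k + i) \<odot>\<^bsub>M\<^esub> n" for k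
    proof -
      have "a ^ (k + j) \<odot>\<^bsub>N\<^esub> f m = f (a ^ (k + j) \<odot>\<^bsub>M\<^esub> m)"
        "a ^ (k + i) \<odot>\<^bsub>N\<^esub> f n = f (a ^ (k + i) \<odot>\<^bsub>M\<^esub> n)"
        using that a by simp_all
      then show ?thesis using that a by (simp del: smult add: inj_on_eq_iff[OF inj])
    qed
    then show ?thesis using that by (simp add: N.loc_rel_iff[OF a] M.loc_rel_iff[OF a])
  qed
  \<comment> \<open>\<open>loc_map\<close> sends a class to the union of the classes of the images
    of its members; these all coincide.\<close>
  have cls: "loc_map a N f (loc_rel a M `` {(m, i)}) = loc_rel a N `` {(f m, i)}"
    if m: "m \<in> carrier M" for m i
  proof -
    have "loc_rel a N `` {(f n, j)} = loc_rel a N `` {(f m, i)}"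
      if "((m, i), (n, j)) \<in> loc_rel a M" for n j
    proof -
      have "n \<in> carrier M" using that by (simp add: loc_rel_def)
      then have "((f m, i), (f n, j)) \<in> loc_rel a N" using resp[OF m] that by simp
      then show ?thesis by (rule equiv_class_eq[OF eN, symmetric])
    qed
    moreover have "((m, i), (m, i)) \<in> loc_rel a M" using m by (auto simp: M.loc_rel_iff[OF a])
    moreover have "loc_map a N f (loc_rel a M `` {(m, i)}) =
        (\<Union>(n, j) \<in> loc_rel a M `` {(m, i)}. loc_rel a N `` {(f n, j)})"
      by (auto simp: loc_map_def Image_def)
    ultimately show ?thesis by blast
  qed
  show ?thesis
    unfolding iso_after_inverting_def
  proof (rule bij_betw_imageI)
    show "inj_on (loc_map a N f) (localization a M)"
    proof (rule Fun.inj_onI)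
      fix X Y
      assume "X \<in> localization a M" "Y \<in> localization a M" and eq: "loc_map a N f X = loc_map a N f Y"
      then obtain m i n j where X: "m \<in> carrier M" "X = loc_rel a M `` {(m, i)}"
        and Y: "n \<in> carrier M" "Y = loc_rel a M `` {(n, j)}"
        by (auto simp: localization_def elim!: quotientE)
      have "loc_rel a N `` {(f m, i)} = loc_rel a N `` {(f n, j)}"
        using eq unfolding X(2) Y(2) cls[OF X(1)] cls[OF Y(1)] .
      then have "((f m, i), (f n, j)) \<in> loc_rel a N"
        by (rule eq_equiv_class[OF _ eN]) (simp add: Y)
      then have "((m, i), (n, j)) \<in> loc_rel a M" using resp X Y by simp
      then show "X = Y" unfolding X(2) Y(2) by (rule equiv_class_eq[OF eM])
    qed
    show "loc_map a N f ` localization a M = localization a N"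
    proof (intro equalityI subsetI)
      fix Y assume "Y \<in> loc_map a N f ` localization a M"
      then obtain m i where "m \<in> carrier M" "Y = loc_rel a N `` {(f m, i)}"
        by (auto simp: localization_def cls elim!: quotientE)
      then show "Y \<in> localization a N" by (auto simp: localization_def intro!: quotientI)
    next
      fix Y assume "Y \<in> localization a N"
      then obtain n j where Y: "n \<in> carrier N" "Y = loc_rel a N `` {(n, j)}"
        by (auto simp: localization_def elim!: quotientE)
      obtain k m where m: "m \<in> carrier M" "a ^ k \<odot>\<^bsub>N\<^esub> n = f m" using cok[OF Y(1)] by blast
      have "a ^ (k + j) \<odot>\<^bsub>N\<^esub> n = a ^ j \<odot>\<^bsub>N\<^esub> f m"
        unfolding m(2)[symmetric] using a Y(1) by (simp add: N.smult_mult[symmetric] power_add mult.commute)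
      then have "((n, j), (f m, k + j)) \<in> loc_rel a N"
        using Y m a by (auto simp: N.loc_rel_iff[OF a] intro!: exI[of _ 0])
      then have "Y = loc_map a N f (loc_rel a M `` {(m, k + j)})"
        unfolding Y(2) cls[OF m(1)] by (rule equiv_class_eq[OF eN])
      then show "Y \<in> loc_map a N f ` localization a M"
        using m(1) by (auto simp: localization_def intro!: imageI quotientI)
    qed
  qed
qed

section \<open>Limits of diagrams of finitely generated graded modules\<close>

lemma graded_module_sym_module: "graded_module r M \<Longrightarrow> sym_module r M"
  by (simp add: graded_module_def sym_module_def)

definition hom_decomp :: "(poly_elt, 'm) gmodule \<Rightarrow> 'm \<Rightarrow> (int \<Rightarrow> 'm) \<Rightarrow> bool" where
  "hom_decomp M m c \<longleftrightarrow> (\<forall>d. c d \<in> hdeg M d) \<and> finite {d. c d \<noteq> \<zero>\<^bsub>M\<^esub>} \<and>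
     m = finsum M c {d. c d \<noteq> \<zero>\<^bsub>M\<^esub>}"

lemma graded_module_decomp:
  "graded_module r M \<Longrightarrow> m \<in> carrier M \<Longrightarrow> \<exists>!c. hom_decomp M m c"
  by (simp add: graded_module_def hom_decomp_def)

lemma hdeg_closed: "graded_module r M \<Longrightarrow> m \<in> hdeg M d \<Longrightarrow> m \<in> carrier M"
  using subgroup.subset[of "hdeg M d" "add_monoid M"] by (auto simp: graded_module_def)

lemma hdeg_zero: "graded_module r M \<Longrightarrow> \<zero>\<^bsub>M\<^esub> \<in> hdeg M d"
  using subgroup.one_closed[of "hdeg M d" "add_monoid M"] by (simp add: graded_module_def)

lemma hdeg_add:
  "graded_module r M \<Longrightarrow> m \<in> hdeg M d \<Longrightarrow> n \<in> hdeg M d \<Longrightarrow> m \<oplus>\<^bsub>M\<^esub> n \<in> hdeg M d"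
  using subgroup.m_closed[of "hdeg M d" "add_monoid M" m n] by (simp add: graded_module_def)

lemma hdeg_smult:
  "graded_module r M \<Longrightarrow> a \<in> sym_deg r i \<Longrightarrow> m \<in> hdeg M d \<Longrightarrow> a \<odot>\<^bsub>M\<^esub> m \<in> hdeg M (i + d)"
  by (simp add: graded_module_def)

lemma minus_one_sym_deg: "- 1 \<in> sym_deg r 0"
  by (simp add: sym_deg_def)

text \<open>Allowing a finite \<open>S\<close> larger than the support matters for limits: the
  components of a family have, at a given coordinate, a smaller support than the family.\<close>

lemma hom_decompI:
  assumes M: "graded_module r M" and c: "\<And>d. c d \<in> hdeg M d"
    and S: "finite S" "\<And>d. d \<notin> S \<Longrightarrow> c d = \<zero>\<^bsub>M\<^esub>" and m: "m = finsum M c S"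
  shows "hom_decomp M m c"
proof -
  interpret sym_module r M using M by (rule graded_module_sym_module)
  have sub: "{d. c d \<noteq> \<zero>\<^bsub>M\<^esub>} \<subseteq> S" using S(2) by blast
  have "c \<in> S \<rightarrow> carrier M" using c hdeg_closed[OF M] by blast
  then have "finsum M c {d. c d \<noteq> \<zero>\<^bsub>M\<^esub>} = finsum M c S"
    using S(1) sub by (intro M.add.finprod_mono_neutral_cong_left) auto
  then show ?thesis using c m finite_subset[OF sub S(1)] by (simp add: hom_decomp_def)
qed

lemma hom_decomp_finsum:
  assumes M: "graded_module r M" and c: "hom_decomp M m c"
    and S: "finite S" "{d. c d \<noteq> \<zero>\<^bsub>M\<^esub>} \<subseteq> S"
  shows "finsum M c S = m"
proof -
  interpret sym_module r M using M by (rule graded_module_sym_module)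
  have "c \<in> S \<rightarrow> carrier M" using c hdeg_closed[OF M] unfolding hom_decomp_def by blast
  then have "finsum M c {d. c d \<noteq> \<zero>\<^bsub>M\<^esub>} = finsum M c S"
    using S by (intro M.add.finprod_mono_neutral_cong_left) auto
  then show ?thesis using c by (simp add: hom_decomp_def)
qed

lemma lin_mapI: "sym_module r M \<Longrightarrow> sym_module r N \<Longrightarrow> f \<in> lin_maps r M N \<Longrightarrow> lin_map r M N f"
  by (simp add: lin_map_def lin_map_axioms_def)

text \<open>Together with uniqueness of decompositions this shows that the components of a
  compatible family are compatible again.\<close>

lemma hom_decomp_map:
  assumes M: "graded_module r M" and N: "graded_module r N" and f: "f \<in> gmod_hom r M N"
    and c: "hom_decomp M m c"
  shows "hom_decomp N (f m) (\<lambda>d. f (c d))"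
proof -
  interpret lin_map r M N f
    using M N f by (intro lin_mapI graded_module_sym_module gmod_hom_lin_maps)
  let ?S = "{d. c d \<noteq> \<zero>\<^bsub>M\<^esub>}"
  have cM: "c \<in> ?S \<rightarrow> carrier M" using c hdeg_closed[OF M] unfolding hom_decomp_def by blast
  show ?thesis
  proof (rule hom_decompI[OF N, of _ ?S])
    show "f (c d) \<in> hdeg N d" for d using c f unfolding hom_decomp_def gmod_hom_def by blast
    show "finite ?S" using c by (simp add: hom_decomp_def)
    have "m = finsum M c ?S" using c unfolding hom_decomp_def by blast
    then show "f m = finsum N (\<lambda>d. f (c d)) ?S" using finsum[OF cM] by simp
  qed simp
qed

text \<open>\<open>D\<close> is the set of arrows of the diagram; with \<open>D\<close> empty this
  is the product. Zero, sum and scalar multiplication are given by formulas in which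
  \<open>D\<close> does not occur, so the limit sits inside the product with the same
  operations.\<close>

definition limit_module ::
    "'i set \<Rightarrow> ('i \<times> 'i) set \<Rightarrow> ('i \<Rightarrow> (poly_elt, 'm) gmodule) \<Rightarrow> ('i \<Rightarrow> 'i \<Rightarrow> 'm \<Rightarrow> 'm) \<Rightarrow>
      (poly_elt, 'i \<Rightarrow> 'm) gmodule" where
  "limit_module X D N \<rho> =
    (let C = {m \<in> \<Pi>\<^sub>E x \<in> X. carrier (N x). \<forall>(x, y) \<in> D. \<rho> x y (m x) = m y}
     in \<lparr>carrier = C, mult = undefined, one = undefined,
         zero = (\<lambda>x \<in> X. \<zero>\<^bsub>N x\<^esub>),
         add = (\<lambda>m n. \<lambda>x \<in> X. m x \<oplus>\<^bsub>N x\<^esub> n x),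
         smult = (\<lambda>a m. \<lambda>x \<in> X. a \<odot>\<^bsub>N x\<^esub> m x),
         hdeg = (\<lambda>d. {m \<in> C. \<forall>x \<in> X. m x \<in> hdeg (N x) d})\<rparr>)"

lemma limit_module_simps:
  "carrier (limit_module X D N \<rho>) =
    {m \<in> \<Pi>\<^sub>E x \<in> X. carrier (N x). \<forall>(x, y) \<in> D. \<rho> x y (m x) = m y}"
  "\<zero>\<^bsub>limit_module X D N \<rho>\<^esub> = (\<lambda>x \<in> X. \<zero>\<^bsub>N x\<^esub>)"
  "m \<oplus>\<^bsub>limit_module X D N \<rho>\<^esub> n = (\<lambda>x \<in> X. m x \<oplus>\<^bsub>N x\<^esub> n x)"
  "a \<odot>\<^bsub>limit_module X D N \<rho>\<^esub> m = (\<lambda>x \<in> X. a \<odot>\<^bsub>N x\<^esub> m x)"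
  "hdeg (limit_module X D N \<rho>) d =
    {m \<in> carrier (limit_module X D N \<rho>). \<forall>x \<in> X. m x \<in> hdeg (N x) d}"
  by (simp_all add: limit_module_def Let_def)

locale limit_diagram =
  fixes r :: nat and X :: "'i set" and D :: "('i \<times> 'i) set"
    and N :: "'i \<Rightarrow> (poly_elt, 'm) gmodule" and \<rho> :: "'i \<Rightarrow> 'i \<Rightarrow> 'm \<Rightarrow> 'm"
  assumes finite_index: "finite X" and arrows: "D \<subseteq> X \<times> X"
    and objects: "x \<in> X \<Longrightarrow> fg_graded_module r (N x)"
    and maps: "(x, y) \<in> D \<Longrightarrow> \<rho> x y \<in> gmod_hom r (N x) (N y)"
begin

abbreviation L :: "(poly_elt, 'i \<Rightarrow> 'm) gmodule" where "L \<equiv> limit_module X D N \<rho>"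

lemma graded: "x \<in> X \<Longrightarrow> graded_module r (N x)"
  using objects by (simp add: fg_graded_module_def)

lemma obj: "x \<in> X \<Longrightarrow> sym_module r (N x)"
  using graded by (rule graded_module_sym_module)

lemma arrow: "(x, y) \<in> D \<Longrightarrow> lin_map r (N x) (N y) (\<rho> x y)"
  using arrows by (intro lin_mapI obj gmod_hom_lin_maps maps) auto

lemma L_iff: "m \<in> carrier L \<longleftrightarrow> m \<in> extensional X \<and> (\<forall>x\<in>X. m x \<in> carrier (N x)) \<and>
    (\<forall>(x, y) \<in> D. \<rho> x y (m x) = m y)"
  by (auto simp: limit_module_simps PiE_iff)

lemma L_at: "m \<in> carrier L \<Longrightarrow> x \<in> X \<Longrightarrow> m x \<in> carrier (N x)"
  by (simp add: L_iff)

lemma L_arrow: "m \<in> carrier L \<Longrightarrow> (x, y) \<in> D \<Longrightarrow> \<rho> x y (m x) = m y"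
  by (auto simp: L_iff)

lemma L_memI:
  assumes "\<And>x. x \<in> X \<Longrightarrow> m x \<in> carrier (N x)" "\<And>x y. (x, y) \<in> D \<Longrightarrow> \<rho> x y (m x) = m y"
  shows "(\<lambda>x\<in>X. m x) \<in> carrier L"
  using assms arrows by (auto simp: L_iff)

lemma L_eqI:
  assumes "m \<in> carrier L" "n \<in> carrier L" "\<And>x. x \<in> X \<Longrightarrow> m x = n x"
  shows "m = n"
  using assms by (auto simp: L_iff intro: extensionalityI)

lemma at_simps:
  assumes "x \<in> X"
  shows "\<zero>\<^bsub>L\<^esub> x = \<zero>\<^bsub>N x\<^esub>" "(m \<oplus>\<^bsub>L\<^esub> n) x = m x \<oplus>\<^bsub>N x\<^esub> n x" "(a \<odot>\<^bsub>L\<^esub> m) x = a \<odot>\<^bsub>N x\<^esub> m x"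
  using assms by (simp_all add: limit_module_simps)

lemma L_zero: "\<zero>\<^bsub>L\<^esub> \<in> carrier L"
  unfolding limit_module_simps(2)
proof (rule L_memI)
  show "\<zero>\<^bsub>N x\<^esub> \<in> carrier (N x)" if "x \<in> X" for x
  proof -
    interpret sym_module r "N x" using that by (rule obj)
    show ?thesis by simp
  qed
  show "\<rho> x y \<zero>\<^bsub>N x\<^esub> = \<zero>\<^bsub>N y\<^esub>" if "(x, y) \<in> D" for x y
    using lin_map.zero[OF arrow[OF that]] .
qed

lemma L_add:
  assumes "m \<in> carrier L" "n \<in> carrier L"
  shows "m \<oplus>\<^bsub>L\<^esub> n \<in> carrier L"
  unfolding limit_module_simps(3)
proof (rule L_memI)
  show "m x \<oplus>\<^bsub>N x\<^esub> n x \<in> carrier (N x)" if "x \<in> X" for x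
  proof -
    interpret sym_module r "N x" using that by (rule obj)
    show ?thesis using assms that by (simp add: L_at)
  qed
  show "\<rho> x y (m x \<oplus>\<^bsub>N x\<^esub> n x) = m y \<oplus>\<^bsub>N y\<^esub> n y" if "(x, y) \<in> D" for x y
  proof -
    have "x \<in> X" using that arrows by auto
    then show ?thesis using lin_map.add[OF arrow[OF that]] L_at assms L_arrow[OF _ that] by simp
  qed
qed

lemma L_smult:
  assumes "a \<in> carrier (sym_alg r)" "m \<in> carrier L"
  shows "a \<odot>\<^bsub>L\<^esub> m \<in> carrier L"
  unfolding limit_module_simps(4)
proof (rule L_memI)
  show "a \<odot>\<^bsub>N x\<^esub> m x \<in> carrier (N x)" if "x \<in> X" for x
  proof -
    interpret sym_module r "N x" using that by (rule obj)
    show ?thesis using assms that by (simp add: L_at)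
  qed
  show "\<rho> x y (a \<odot>\<^bsub>N x\<^esub> m x) = a \<odot>\<^bsub>N y\<^esub> m y" if "(x, y) \<in> D" for x y
  proof -
    have "x \<in> X" using that arrows by auto
    then show ?thesis using lin_map.smult[OF arrow[OF that]] L_at assms L_arrow[OF _ that] by simp
  qed
qed

lemma sym_module_L: "sym_module r L"
proof -
  note cl = L_zero L_add L_smult
  have at: "x \<in> X \<Longrightarrow> Module.module (sym_alg r) (N x)" for x
    using obj by (simp add: sym_module_def)
  then have ag: "x \<in> X \<Longrightarrow> abelian_group (N x)" for x by (simp add: Module.module_def)
  then have am: "x \<in> X \<Longrightarrow> abelian_monoid (N x)" for x by (simp add: abelian_group_def)
  have "abelian_group L"
  proof (rule abelian_groupI)
    fix m n p assume m: "m \<in> carrier L" and n: "n \<in> carrier L" and p: "p \<in> carrier L"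
    show "m \<oplus>\<^bsub>L\<^esub> n \<oplus>\<^bsub>L\<^esub> p = m \<oplus>\<^bsub>L\<^esub> (n \<oplus>\<^bsub>L\<^esub> p)"
      using m n p by (intro L_eqI cl) (simp_all add: at_simps L_at abelian_monoid.a_assoc[OF am])
    show "m \<oplus>\<^bsub>L\<^esub> n = n \<oplus>\<^bsub>L\<^esub> m"
      using m n by (intro L_eqI cl) (simp_all add: at_simps L_at abelian_monoid.a_comm[OF am])
  next
    fix m assume m: "m \<in> carrier L"
    show "\<zero>\<^bsub>L\<^esub> \<oplus>\<^bsub>L\<^esub> m = m"
      using m by (intro L_eqI cl) (simp_all add: at_simps L_at abelian_monoid.l_zero[OF am])
    \<comment> \<open>The scalar multiple by \<open>- 1\<close> serves as additive inverse, so no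
      separate coordinatewise negation is introduced.\<close>
    have "(- 1) \<odot>\<^bsub>L\<^esub> m \<oplus>\<^bsub>L\<^esub> m = \<zero>\<^bsub>L\<^esub>"
    proof (intro L_eqI cl m)
      fix x assume x: "x \<in> X"
      interpret sym_module r "N x" using x by (rule obj)
      show "((- 1) \<odot>\<^bsub>L\<^esub> m \<oplus>\<^bsub>L\<^esub> m) x = \<zero>\<^bsub>L\<^esub> x"
        using m x L_at[OF m x] minus_eq_smult[of "m x"] M.l_neg[of "m x"] by (simp add: at_simps)
    qed simp
    then show "\<exists>n\<in>carrier L. n \<oplus>\<^bsub>L\<^esub> m = \<zero>\<^bsub>L\<^esub>" using m cl by fastforce
  qed (use cl in auto)
  then have "Module.module (sym_alg r) L"
  proof (rule moduleI[OF cring_sym_alg])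
    fix a m assume a: "a \<in> carrier (sym_alg r)" and m: "m \<in> carrier L"
    show "a \<odot>\<^bsub>L\<^esub> m \<in> carrier L" using a m by (rule cl)
    fix n assume n: "n \<in> carrier L"
    show "a \<odot>\<^bsub>L\<^esub> (m \<oplus>\<^bsub>L\<^esub> n) = a \<odot>\<^bsub>L\<^esub> m \<oplus>\<^bsub>L\<^esub> a \<odot>\<^bsub>L\<^esub> n"
      using a m n by (intro L_eqI cl) (simp_all add: at_simps L_at Module.module.smult_r_distr[OF at])
  next
    fix m assume m: "m \<in> carrier L"
    show "\<one>\<^bsub>sym_alg r\<^esub> \<odot>\<^bsub>L\<^esub> m = m"
      using m cl(3)[OF _ m, of 1]
      by (intro L_eqI) (simp_all add: at_simps L_at sym_module.smult_simps[OF obj])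
  next
    fix a b m assume a: "a \<in> carrier (sym_alg r)" and b: "b \<in> carrier (sym_alg r)" and m: "m \<in> carrier L"
    show "(a \<oplus>\<^bsub>sym_alg r\<^esub> b) \<odot>\<^bsub>L\<^esub> m = a \<odot>\<^bsub>L\<^esub> m \<oplus>\<^bsub>L\<^esub> b \<odot>\<^bsub>L\<^esub> m"
      using a b m cl(3)[OF _ m, of "a + b"]
      by (intro L_eqI cl) (simp_all add: at_simps L_at sym_module.smult_add_left[OF obj])
    show "(a \<otimes>\<^bsub>sym_alg r\<^esub> b) \<odot>\<^bsub>L\<^esub> m = a \<odot>\<^bsub>L\<^esub> (b \<odot>\<^bsub>L\<^esub> m)"
      using a b m cl(3)[OF _ m, of "a * b"]
      by (intro L_eqI cl) (simp_all add: at_simps L_at sym_module.smult_mult[OF obj])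
  qed
  then show ?thesis by (simp add: sym_module_def)
qed

lemma eval_lin_map:
  assumes "x \<in> X" shows "lin_map r L (N x) (\<lambda>m. m x)"
  using assms by (intro lin_mapI sym_module_L obj) (auto simp: lin_maps_def at_simps L_at)

lemma L_hdeg: "m \<in> hdeg L d \<longleftrightarrow> m \<in> carrier L \<and> (\<forall>x\<in>X. m x \<in> hdeg (N x) d)"
  by (simp add: limit_module_simps)

text \<open>Homogeneous components are taken coordinatewise. They are compatible because the
  transition maps preserve degrees and decompositions are unique; only finitely many are nonzero
  because \<open>X\<close> is finite.\<close>

lemma graded_module_L: "graded_module r L"
proof -
  interpret sym_module r L by (rule sym_module_L)
  have mod: "Module.module (sym_alg r) L" using sym_module_L by (simp add: sym_module_def)
  have smult_deg: "a \<odot>\<^bsub>L\<^esub> m \<in> hdeg L (i + d)" if a: "a \<in> sym_deg r i" and m: "m \<in> hdeg L d" for a m i d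
    using m a hdeg_smult[OF graded] by (auto simp: L_hdeg at_simps sym_deg_def)
  have sub: "subgroup (hdeg L d) (add_monoid L)" for d
  proof (rule subgroup.intro)
    show "hdeg L d \<subseteq> carrier (add_monoid L)" by (auto simp: L_hdeg)
    show "m \<otimes>\<^bsub>add_monoid L\<^esub> n \<in> hdeg L d" if "m \<in> hdeg L d" "n \<in> hdeg L d" for m n
      using that hdeg_add[OF graded] by (auto simp: L_hdeg at_simps)
    show "\<one>\<^bsub>add_monoid L\<^esub> \<in> hdeg L d"
      using hdeg_zero[OF graded] by (auto simp: L_hdeg at_simps)
    show "inv\<^bsub>add_monoid L\<^esub> m \<in> hdeg L d" if m: "m \<in> hdeg L d" for m
      using smult_deg[OF minus_one_sym_deg m] minus_eq_smult[of m] m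
      by (simp add: a_inv_def L_hdeg)
  qed
  have decomp: "\<exists>!c. hom_decomp L m c" if m: "m \<in> carrier L" for m
  proof -
    have "\<forall>x\<in>X. \<exists>c. hom_decomp (N x) (m x) c"
      using graded_module_decomp[OF graded] L_at[OF m] by blast
    then obtain c where c: "\<And>x. x \<in> X \<Longrightarrow> hom_decomp (N x) (m x) (c x)" by metis
    have uniq: "c' = c x" if "x \<in> X" "hom_decomp (N x) (m x) c'" for x c'
      using graded_module_decomp[OF graded L_at[OF m], of x] that c[of x] by blast
    define C where "C d = (\<lambda>x\<in>X. c x d)" for d
    have cdeg: "c x d \<in> hdeg (N x) d" if "x \<in> X" for x d
      using c[OF that] by (simp add: hom_decomp_def)
    have CL: "C d \<in> carrier L" for d
      unfolding C_def
    proof (rule L_memI)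
      show "c x d \<in> carrier (N x)" if "x \<in> X" for x
        using cdeg[OF that] hdeg_closed[OF graded[OF that]] by blast
      show "\<rho> x y (c x d) = c y d" if xy: "(x, y) \<in> D" for x y
      proof -
        have X: "x \<in> X" "y \<in> X" using xy arrows by auto
        have "hom_decomp (N y) (\<rho> x y (m x)) (\<lambda>d. \<rho> x y (c x d))"
          using hom_decomp_map[OF graded graded maps c] X xy by blast
        then show ?thesis using uniq[OF X(2)] L_arrow[OF m xy] by (metis (no_types))
      qed
    qed
    have Cdeg: "C d \<in> hdeg L d" for d using CL cdeg by (auto simp: L_hdeg C_def)
    \<comment> \<open>The supports at the single coordinates differ, so all sums run over their
      union.\<close>
    define S where "S = (\<Union>x\<in>X. {d. c x d \<noteq> \<zero>\<^bsub>N x\<^esub>})"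
    have S: "finite S" using finite_index c by (auto simp: S_def hom_decomp_def)
    have "hom_decomp L m C"
    proof -
      have fin: "{d. C d \<noteq> \<zero>\<^bsub>L\<^esub>} \<subseteq> S"
      proof
        fix d assume "d \<in> {d. C d \<noteq> \<zero>\<^bsub>L\<^esub>}"
        then obtain x where "x \<in> X" "C d x \<noteq> \<zero>\<^bsub>L\<^esub> x" using L_eqI[OF CL L_zero] by blast
        then show "d \<in> S" by (auto simp: S_def C_def at_simps)
      qed
      have "m = finsum L C S"
      proof (rule L_eqI[OF m])
        show "finsum L C S \<in> carrier L" using CL by (intro M.finsum_closed) auto
        fix x assume x: "x \<in> X"
        interpret e: lin_map r L "N x" "\<lambda>m. m x" using x by (rule eval_lin_map)
        have "finsum L C S x = finsum (N x) (\<lambda>d. C d x) S" using CL by (intro e.finsum) auto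
        also have "(\<lambda>d. C d x) = c x" using x by (simp add: C_def)
        also have "finsum (N x) (c x) S = m x"
          using x by (intro hom_decomp_finsum[OF graded[OF x] c[OF x] S]) (auto simp: S_def)
        finally show "m x = finsum L C S x" by simp
      qed
      also have "finsum L C S = finsum L C {d. C d \<noteq> \<zero>\<^bsub>L\<^esub>}"
        using CL fin S by (intro M.add.finprod_mono_neutral_cong_left[symmetric]) auto
      finally show ?thesis using Cdeg finite_subset[OF fin S] by (simp add: hom_decomp_def)
    qed
    moreover have "C' = C" if C': "hom_decomp L m C'" for C'
    proof
      fix d
      have C'L: "C' d \<in> carrier L" for d using C' by (simp add: hom_decomp_def L_hdeg)
      show "C' d = C d"
      proof (rule L_eqI[OF C'L CL])
        fix x assume x: "x \<in> X"
        interpret e: lin_map r L "N x" "\<lambda>m. m x" using x by (rule eval_lin_map)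
        let ?S = "{d. C' d \<noteq> \<zero>\<^bsub>L\<^esub>}"
        have "hom_decomp (N x) (m x) (\<lambda>d. C' d x)"
        proof (rule hom_decompI[OF graded[OF x], of _ ?S])
          show "C' d x \<in> hdeg (N x) d" for d using C' x by (simp add: hom_decomp_def L_hdeg)
          show "finite ?S" using C' by (simp add: hom_decomp_def)
          show "C' d x = \<zero>\<^bsub>N x\<^esub>" if "d \<notin> ?S" for d using that x by (simp add: at_simps)
          have "m = finsum L C' ?S" using C' unfolding hom_decomp_def by blast
          then have "m x = finsum L C' ?S x" by (rule fun_cong)
          also have "\<dots> = finsum (N x) (\<lambda>d. C' d x) ?S" using C'L by (intro e.finsum) auto
          finally show "m x = finsum (N x) (\<lambda>d. C' d x) ?S" .
        qed
        then have "(\<lambda>d. C' d x) = c x" by (rule uniq[OF x])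
        then have "C' d x = c x d" by (rule fun_cong)
        then show "C' d x = C d x" using x by (simp add: C_def)
      qed
    qed
    ultimately show ?thesis by blast
  qed
  show ?thesis
    unfolding graded_module_def
    using mod sub smult_deg decomp[unfolded hom_decomp_def] by blast
qed

end

text \<open>A span depends only on zero, sum and scalar multiplication, and these ignore the arrows.
  Generators found for the limit as a submodule of the product thus generate it as a module in its
  own right.\<close>

lemma lspan_limit_module: "lspan r (limit_module X D N \<rho>) S = lspan r (limit_module X D' N \<rho>') S"
proof -
  have "x \<in> lspan r (limit_module X D' N \<rho>') S" if "x \<in> lspan r (limit_module X D N \<rho>) S"
    for x D D' \<rho> \<rho>'
    using that
  proof induction
    case lspan_zero
    then show ?case using lspan.lspan_zero[of "limit_module X D' N \<rho>'" r S]
      by (simp only: limit_module_simps)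
  next
    case (lspan_step a s x)
    then show ?case using lspan.lspan_step[of a r s S x "limit_module X D' N \<rho>'"]
      by (simp only: limit_module_simps)
  qed
  then show ?thesis by blast
qed

text \<open>The limit is a submodule of the product, so Noetherianity makes it finitely generated.\<close>

lemma (in limit_diagram) fin_gen_L: "fin_gen r L"
proof -
  interpret P: limit_diagram r X "{}" N \<rho>
    using finite_index objects by unfold_locales auto
  let ?P = "P.L"
  interpret PM: sym_module r ?P by (rule P.sym_module_L)
  interpret LM: sym_module r L by (rule sym_module_L)
  have "\<forall>x\<in>X. \<exists>S. finite S \<and> S \<subseteq> carrier (N x) \<and> carrier (N x) \<subseteq> lspan r (N x) S"
    using objects sym_module.fin_gen_iff[OF obj] by (auto simp: fg_graded_module_def)
  then obtain S where S: "\<And>x. x \<in> X \<Longrightarrow> finite (S x)" "\<And>x. x \<in> X \<Longrightarrow> S x \<subseteq> carrier (N x)"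
    "\<And>x. x \<in> X \<Longrightarrow> carrier (N x) \<subseteq> lspan r (N x) (S x)" by metis
  \<comment> \<open>The family concentrated at the coordinate \<open>x\<close>; such families built
    from generators of the factors generate the product.\<close>
  define \<delta> where "\<delta> x s = (\<lambda>y\<in>X. if y = x then s else \<zero>\<^bsub>N y\<^esub>)" for x and s :: 'm
  have zero: "\<zero>\<^bsub>N x\<^esub> \<in> carrier (N x)" if "x \<in> X" for x
    using P.L_at[OF P.L_zero that] that by (simp add: P.at_simps)
  have \<delta>P: "\<delta> x s \<in> carrier ?P" if "x \<in> X" "s \<in> carrier (N x)" for x s
    unfolding \<delta>_def using that zero by (intro P.L_memI) auto
  define G where "G = (\<Union>x\<in>X. \<delta> x ` S x)"
  have G: "finite G" "G \<subseteq> carrier ?P" using finite_index S(1) \<delta>P S(2) by (auto simp: G_def subset_iff)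
  note GS = PM.submoduleE[OF PM.lspan_submodule[OF G(2)]]
  have \<delta>lin: "\<delta> x s \<in> lspan r ?P G" if x: "x \<in> X" and "s \<in> lspan r (N x) (S x)" for x s
    using that(2)
  proof induction
    case lspan_zero
    have "\<delta> x \<zero>\<^bsub>N x\<^esub> = \<zero>\<^bsub>?P\<^esub>"
      using x zero by (intro P.L_eqI \<delta>P P.L_zero) (auto simp: P.at_simps \<delta>_def)
    then show ?case using lspan.lspan_zero[of ?P r G] by simp
  next
    case (lspan_step a s t)
    interpret Nx: sym_module r "N x" using x by (rule obj)
    have st: "s \<in> carrier (N x)" "t \<in> carrier (N x)"
      using lspan_step S(2)[OF x] Nx.lspan_closed[OF S(2)[OF x]] by auto
    have "\<delta> x (a \<odot>\<^bsub>N x\<^esub> s \<oplus>\<^bsub>N x\<^esub> t) = a \<odot>\<^bsub>?P\<^esub> \<delta> x s \<oplus>\<^bsub>?P\<^esub> \<delta> x t"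
    proof (rule P.L_eqI)
      fix y assume y: "y \<in> X"
      interpret Ny: sym_module r "N y" using y by (rule obj)
      show "\<delta> x (a \<odot>\<^bsub>N x\<^esub> s \<oplus>\<^bsub>N x\<^esub> t) y = (a \<odot>\<^bsub>?P\<^esub> \<delta> x s \<oplus>\<^bsub>?P\<^esub> \<delta> x t) y"
        using y lspan_step(1) by (simp add: P.at_simps \<delta>_def)
    qed (use x st lspan_step(1) \<delta>P in auto)
    moreover have "a \<odot>\<^bsub>?P\<^esub> \<delta> x s \<oplus>\<^bsub>?P\<^esub> \<delta> x t \<in> lspan r ?P G"
      using lspan_step x by (intro lspan.lspan_step) (auto simp: G_def)
    ultimately show ?case by simp
  qed
  \<comment> \<open>Induction on a finite set outside which \<open>m\<close> vanishes, splitting off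
    one coordinate at a time. \<open>Y\<close> may leave \<open>X\<close>, which accounts for the
    trivial case below.\<close>
  have supp: "m \<in> lspan r ?P G"
    if "finite Y" "m \<in> carrier ?P" "\<And>x. x \<in> X - Y \<Longrightarrow> m x = \<zero>\<^bsub>N x\<^esub>" for Y m
    using that
  proof (induction Y arbitrary: m rule: finite_induct)
    case empty
    then have "m = \<zero>\<^bsub>?P\<^esub>" by (intro P.L_eqI P.L_zero) (auto simp: P.at_simps)
    then show ?case using lspan.lspan_zero[of ?P r G] by simp
  next
    case (insert x Y)
    show ?case
    proof (cases "x \<in> X")
      case False
      then show ?thesis using insert.prems by (intro insert.IH) auto
    next
      case x: True
      define n where "n = (\<lambda>y\<in>X. if y = x then \<zero>\<^bsub>N y\<^esub> else m y)"
      have nP: "n \<in> carrier ?P"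
        unfolding n_def using zero P.L_at[OF insert.prems(1)] by (intro P.L_memI) auto
      have mx: "m x \<in> carrier (N x)" using P.L_at[OF insert.prems(1) x] .
      have n: "n \<in> lspan r ?P G"
      proof (rule insert.IH[OF nP])
        show "n y = \<zero>\<^bsub>N y\<^esub>" if "y \<in> X - Y" for y
          using that insert.prems(2)[of y] by (auto simp: n_def)
      qed
      have "m = \<delta> x (m x) \<oplus>\<^bsub>?P\<^esub> n"
      proof (rule P.L_eqI)
        fix y assume y: "y \<in> X"
        interpret Ny: sym_module r "N y" using y by (rule obj)
        show "m y = (\<delta> x (m x) \<oplus>\<^bsub>?P\<^esub> n) y"
        proof (cases "y = x")
          case True
          interpret Nx: sym_module r "N x" using x by (rule obj)
          show ?thesis using True x mx by (simp add: P.at_simps \<delta>_def n_def)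
        next
          case False
          then show ?thesis
            using y P.L_at[OF insert.prems(1) y] by (simp add: P.at_simps \<delta>_def n_def)
        qed
      qed (use insert.prems nP \<delta>P[OF x mx] in auto)
      moreover have "\<delta> x (m x) \<in> lspan r ?P G" using \<delta>lin[OF x] mx S(3)[OF x] by blast
      ultimately show ?thesis using GS(5) n by metis
    qed
  qed
  have incl: "carrier L \<subseteq> carrier ?P" by (auto simp: limit_module_simps)
  have "submodule (carrier L) (sym_alg r) ?P"
    using L_zero L_add L_smult incl
    by (intro PM.submoduleI') (auto simp: limit_module_simps(2-4))
  moreover have "carrier L \<subseteq> lspan r ?P G" using supp[OF finite_index] incl by blast
  ultimately have "\<exists>B. finite B \<and> B \<subseteq> carrier L \<and> carrier L \<subseteq> lspan r ?P B"
    by (rule PM.submodule_fin_gen[OF G])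
  then show ?thesis
    unfolding LM.fin_gen_iff lspan_limit_module[of r X "{}" N \<rho> _ D \<rho>] .
qed

lemma (in limit_diagram) fg_graded_module_L: "fg_graded_module r L"
  using graded_module_L fin_gen_L by (simp add: fg_graded_module_def)

section \<open>The linear form of a direction\<close>

lemma lookup_lin_form:
  assumes "j < r"
  shows "Poly_Mapping.lookup (lin_form r w) (Poly_Mapping.single j 1) = of_int (w j)"
proof -
  have "Poly_Mapping.single i (1::nat) = Poly_Mapping.single j 1 \<longleftrightarrow> i = j" for i
    by (metis keys_single singleton_inject zero_neq_one)
  then have "Poly_Mapping.lookup (lin_form r w) (Poly_Mapping.single j 1) =
    (\<Sum>i<r. if i = j then of_int (w i) else 0)"
    unfolding lin_form_def lookup_sum by (intro sum.cong) (auto simp: lookup_single)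
  then show ?thesis using assms by simp
qed

lemma lin_form_closed: "lin_form r w \<in> carrier (sym_alg r)"
proof -
  have "(\<Sum>i\<in>I. Poly_Mapping.single (Poly_Mapping.single i (1::nat)) (of_int (w i) :: complex))
    \<in> carrier (sym_alg r)" if "finite I" "I \<subseteq> {..<r}" for I
    using that
  proof induction
    case (insert i I)
    have "Poly_Mapping.single (Poly_Mapping.single i (1::nat)) (of_int (w i) :: complex)
      \<in> carrier (sym_alg r)"
      using insert.prems by (auto simp: carrier_sym_alg monomials_def)
    then show ?case using insert by simp
  qed simp
  then show ?thesis by (simp add: lin_form_def)
qed

lemma lin_form_nonzero:
  assumes "w \<in> weights r" "w \<noteq> (\<lambda>_. 0)"
  shows "lin_form r w \<noteq> 0"
proof
  assume "lin_form r w = 0"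
  then have "w j = 0" if "j < r" for j using lookup_lin_form[OF that, of w] by simp
  moreover have "w j = 0" if "\<not> j < r" for j using assms(1) that by (simp add: weights_def)
  ultimately show False using assms(2) by blast
qed

text \<open>A member \<open>w\<close> of the class with least sum of absolute values is primitive:
  if \<open>w\<close> is \<open>k\<close> times an integral weight \<open>v\<close>, then
  \<open>v\<close> lies in the same class, and the sum for \<open>w\<close> is that for
  \<open>v\<close> times the absolute value of \<open>k\<close>, so minimality leaves only
  \<open>k = 1\<close> and \<open>k = - 1\<close>.\<close>

lemma primitive_weight_exists:
  assumes "\<alpha> \<in> proj_weights r"
  shows "\<exists>w. w \<in> \<alpha> \<and> primitive_weight r w"
proof -
  obtain u where u: "u \<in> weights r" "u \<noteq> (\<lambda>_. 0)"
    and \<alpha>: "\<alpha> = {w. w \<in> weights r \<and> w \<noteq> (\<lambda>_. 0) \<and> (\<exists>c::complex. \<forall>i. of_int (w i) = c * of_int (u i))}"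
    using assms by (auto simp: proj_weights_def Image_def elim!: quotientE)
  define h where "h w = nat (\<Sum>i<r. \<bar>w i\<bar>)" for w :: weight
  have "u \<in> \<alpha>" using u by (auto simp: \<alpha> intro!: exI[of _ 1])
  then obtain w where w: "w \<in> \<alpha>" and least: "\<And>v. v \<in> \<alpha> \<Longrightarrow> h w \<le> h v"
    using ex_has_least_nat[of "\<lambda>w. w \<in> \<alpha>" u h] by blast
  have "k = 1 \<or> k = - 1" if v: "v \<in> weights r" and wv: "w = (\<lambda>i. k * v i)" for k v
  proof -
    obtain c :: complex where c: "\<And>i. of_int (w i) = c * of_int (u i)" using w by (auto simp: \<alpha>)
    have k: "k \<noteq> 0" "v \<noteq> (\<lambda>_. 0)" using w wv by (auto simp: \<alpha>)
    have "of_int (v i) = (c / of_int k) * of_int (u i)" for i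
    proof -
      have "of_int k * of_int (v i) = c * of_int (u i)" using c[of i] by (simp add: wv)
      then show ?thesis using k(1) by (simp add: field_simps)
    qed
    then have "\<exists>c::complex. \<forall>i. of_int (v i) = c * of_int (u i)" by blast
    then have "v \<in> \<alpha>" using v k(2) by (simp add: \<alpha>)
    then have le: "h w \<le> h v" by (rule least)
    obtain j where j: "v j \<noteq> 0" using k(2) by blast
    have "j < r"
    proof (rule ccontr)
      assume "\<not> j < r"
      then show False using v j by (simp add: weights_def)
    qed
    then have "0 < (\<Sum>i<r. \<bar>v i\<bar>)" using j by (intro sum_pos2[of _ j]) auto
    moreover have "(\<Sum>i<r. \<bar>w i\<bar>) = \<bar>k\<bar> * (\<Sum>i<r. \<bar>v i\<bar>)"
      by (simp add: wv abs_mult sum_distrib_left)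
    moreover have "(\<Sum>i<r. \<bar>w i\<bar>) \<le> (\<Sum>i<r. \<bar>v i\<bar>)"
      using le calculation(1) unfolding h_def by linarith
    ultimately have "\<bar>k\<bar> * (\<Sum>i<r. \<bar>v i\<bar>) \<le> 1 * (\<Sum>i<r. \<bar>v i\<bar>)" "0 < (\<Sum>i<r. \<bar>v i\<bar>)"
      by simp_all
    then have "\<bar>k\<bar> \<le> 1" by (rule mult_right_le_imp_le)
    then show ?thesis using k(1) by linarith
  qed
  then show ?thesis using w by (auto simp: primitive_weight_def \<alpha>)
qed

lemma dir_elt_closed: "dir_elt r \<alpha> \<in> carrier (sym_alg r)"
  by (simp add: dir_elt_def lin_form_closed)

lemma dir_elt_nonzero:
  assumes "\<alpha> \<in> proj_weights r" shows "dir_elt r \<alpha> \<noteq> 0"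
  using someI_ex[OF primitive_weight_exists[OF assms]] lin_form_nonzero
  by (simp add: dir_elt_def primitive_weight_def)

section \<open>The sheaf associated with a pure sheaf\<close>

definition sheaf_index :: "nat \<Rightarrow> ('v, 'z) hypergraph_scheme \<Rightarrow> 'v point set \<Rightarrow> 'v point set" where
  "sheaf_index r G U = U \<inter> sub_points r G (verts G)"

text \<open>Only the edge is asked to lie in \<open>U\<close>; for open \<open>U\<close> its
  endpoints then do as well.\<close>

definition sheaf_arrows ::
    "nat \<Rightarrow> ('v, 'z) hypergraph_scheme \<Rightarrow> 'v point set \<Rightarrow> ('v point \<times> 'v point) set" where
  "sheaf_arrows r G U = {(Inl v, Inr e) |v e. e \<in> nd_edges r G \<and> v \<in> inc e \<and> Inr e \<in> U}"

text \<open>Degenerate hyperedges carry no coordinate: over them, restriction to the vertex is the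
  identity.  The redundant coordinates at nondegenerate edges make the global sections literally
  those of the given sheaf.\<close>

definition gkm_sections ::
    "nat \<Rightarrow> ('v, 'z) hypergraph_scheme \<Rightarrow> ('v, 'm) gamma_sheaf \<Rightarrow> 'v point set \<Rightarrow>
      (poly_elt, 'v point \<Rightarrow> 'm) gmodule" where
  "gkm_sections r G M U = limit_module (sheaf_index r G U) (sheaf_arrows r G U) (stalk M)
     (\<lambda>x y. rho M (projl x) (projr y))"

definition assoc_sheaf ::
    "nat \<Rightarrow> ('v, 'z) hypergraph_scheme \<Rightarrow> ('v, 'm) gamma_sheaf \<Rightarrow> ('v point, 'v point \<Rightarrow> 'm) mod_sheaf"
  where "assoc_sheaf r G M =
    \<lparr>sec = gkm_sections r G M, rest = (\<lambda>U W s. restrict s (sheaf_index r G W))\<rparr>"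

definition assoc_map ::
    "nat \<Rightarrow> ('v, 'z) hypergraph_scheme \<Rightarrow> ('v point \<Rightarrow> 'm \<Rightarrow> 'm) \<Rightarrow> 'v point set \<Rightarrow>
      ('v point \<Rightarrow> 'm) \<Rightarrow> ('v point \<Rightarrow> 'm)" where
  "assoc_map r G f U s = (\<lambda>x \<in> sheaf_index r G U. f x (s x))"

text \<open>The form in which openness enters the modules of sections: with an edge, its endpoints
  are coordinates too, so every compatibility condition makes sense.\<close>

definition edge_closed :: "'v point set \<Rightarrow> bool" where
  "edge_closed U \<longleftrightarrow> (\<forall>e. Inr e \<in> U \<longrightarrow> Inl ` inc e \<subseteq> U)"

lemma edge_closedD: "edge_closed U \<Longrightarrow> Inr e \<in> U \<Longrightarrow> v \<in> inc e \<Longrightarrow> Inl v \<in> U"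
  unfolding edge_closed_def by blast

lemma sheaf_index_mono: "W \<subseteq> U \<Longrightarrow> sheaf_index r G W \<subseteq> sheaf_index r G U"
  by (auto simp: sheaf_index_def)

text \<open>Basic open sets contain the endpoints of their edge, and the property survives
  intersections and unions.\<close>

lemma openin_Top_edge_closed:
  assumes "openin (Top r G) U" shows "edge_closed U"
proof -
  have "generate_topology_on (basic_open ` hg_points r G) U"
    using assms by (simp add: Top_def openin_topology_generated_by_iff)
  then show ?thesis
  proof induction
    case (Basis U)
    then show ?case by (auto simp: edge_closed_def basic_open_def split: sum.splits)
  qed (fastforce simp: edge_closed_def)+
qed

text \<open>The multiples of \<open>a\<close> are closed under sums and negatives, so their cosets
  behave as those of a subgroup. This identifies the kernel of the projection in the definition of
  purity.\<close>

lemma (in sym_module) quotient_coset_eq_zero: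
  assumes a: "a \<in> carrier (sym_alg r)" and m: "m \<in> carrier M"
  defines "K \<equiv> elt_mult_set a M"
  shows "K +>\<^bsub>M\<^esub> m = K +>\<^bsub>M\<^esub> \<zero>\<^bsub>M\<^esub> \<longleftrightarrow> m \<in> K"
proof -
  have KM: "K \<subseteq> carrier M" using a by (auto simp: K_def elt_mult_set_def)
  have K0: "\<zero>\<^bsub>M\<^esub> \<in> K"
    using smult_r_null[OF a] M.zero_closed by (force simp: K_def elt_mult_set_def)
  have Kadd: "x \<oplus>\<^bsub>M\<^esub> y \<in> K" if xy: "x \<in> K" "y \<in> K" for x y
  proof -
    obtain u v where "u \<in> carrier M" "v \<in> carrier M" "x = a \<odot>\<^bsub>M\<^esub> u" "y = a \<odot>\<^bsub>M\<^esub> v"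
      using xy by (auto simp: K_def elt_mult_set_def)
    then have "x \<oplus>\<^bsub>M\<^esub> y = a \<odot>\<^bsub>M\<^esub> (u \<oplus>\<^bsub>M\<^esub> v)" "u \<oplus>\<^bsub>M\<^esub> v \<in> carrier M"
      using smult_r_distr[OF a] by auto
    then show ?thesis unfolding K_def elt_mult_set_def by blast
  qed
  have Kneg: "\<ominus>\<^bsub>M\<^esub> x \<in> K" if x: "x \<in> K" for x
  proof -
    obtain u where "u \<in> carrier M" "x = a \<odot>\<^bsub>M\<^esub> u"
      using x by (auto simp: K_def elt_mult_set_def)
    then have "\<ominus>\<^bsub>M\<^esub> x = a \<odot>\<^bsub>M\<^esub> (\<ominus>\<^bsub>M\<^esub> u)" "\<ominus>\<^bsub>M\<^esub> u \<in> carrier M"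
      using smult_r_minus[OF a] by auto
    then show ?thesis unfolding K_def elt_mult_set_def by blast
  qed
  have coset: "K +>\<^bsub>M\<^esub> x = (\<lambda>k. k \<oplus>\<^bsub>M\<^esub> x) ` K" for x
    by (auto simp: a_r_coset_def r_coset_def)
  have c0: "K +>\<^bsub>M\<^esub> \<zero>\<^bsub>M\<^esub> = K" unfolding coset using KM by (force simp: subset_iff)
  show ?thesis
  proof
    assume "K +>\<^bsub>M\<^esub> m = K +>\<^bsub>M\<^esub> \<zero>\<^bsub>M\<^esub>"
    then have "\<zero>\<^bsub>M\<^esub> \<oplus>\<^bsub>M\<^esub> m \<in> K" using K0 unfolding c0 unfolding coset by blast
    then show "m \<in> K" using m by simp
  next
    assume mK: "m \<in> K"
    have "k \<in> (\<lambda>k. k \<oplus>\<^bsub>M\<^esub> m) ` K" if k: "k \<in> K" for k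
    proof
      show "k \<oplus>\<^bsub>M\<^esub> \<ominus>\<^bsub>M\<^esub> m \<in> K" using k mK Kadd Kneg by blast
      show "k = k \<oplus>\<^bsub>M\<^esub> \<ominus>\<^bsub>M\<^esub> m \<oplus>\<^bsub>M\<^esub> m" using k m KM by (simp add: M.a_assoc M.l_neg subset_iff)
    qed
    then show "K +>\<^bsub>M\<^esub> m = K +>\<^bsub>M\<^esub> \<zero>\<^bsub>M\<^esub>" unfolding c0 unfolding coset using mK Kadd by blast
  qed
qed

section \<open>Moment graphs and modules of sections\<close>

context
  fixes r :: nat and G :: "'v moment_graph"
  assumes G: "moment_graph r G"
begin

lemma hypergraph: "finite (verts G)" "\<alpha> \<in> proj_weights r \<Longrightarrow> equiv (verts G) (eqv G \<alpha>)"
  using G by (auto simp: moment_graph_def gkm_graph_def gkm_hypergraph_def)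

lemma hyperedge_inc:
  assumes "e \<in> hyperedges r G"
  shows "inc e \<subseteq> verts G" "inc e \<noteq> {}" "card (inc e) \<le> 2"
proof -
  obtain S \<alpha> where e: "e = (S, \<alpha>)" "\<alpha> \<in> proj_weights r" "S \<in> verts G // eqv G \<alpha>"
    using assms by (auto simp: hyperedges_def)
  note eq = hypergraph(2)[OF e(2)]
  show "inc e \<subseteq> verts G" using in_quotient_imp_subset[OF eq e(3)] e(1) by simp
  show "inc e \<noteq> {}" using in_quotient_imp_non_empty[OF eq e(3)] e(1) by simp
  show "card (inc e) \<le> 2" using G assms by (simp add: moment_graph_def gkm_graph_def)
qed

lemma degenerate_inc:
  assumes "e \<in> hyperedges r G" "e \<notin> nd_edges r G"
  obtains v where "v \<in> verts G" "inc e = {v}"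
proof -
  have "finite (inc e)" using hyperedge_inc(1)[OF assms(1)] hypergraph(1) by (rule finite_subset)
  then have "card (inc e) \<noteq> 0" using hyperedge_inc(2)[OF assms(1)] by simp
  then have "card (inc e) = 1" using hyperedge_inc(3)[OF assms(1)] assms by (simp add: nd_edges_def)
  then obtain v where "inc e = {v}" by (auto simp: card_1_singleton_iff)
  then show ?thesis using that hyperedge_inc(1)[OF assms(1)] by auto
qed

lemma nd_edge_hyperedge: "e \<in> nd_edges r G \<Longrightarrow> e \<in> hyperedges r G"
  by (simp add: nd_edges_def)

lemma nd_edge_inc: "e \<in> nd_edges r G \<Longrightarrow> inc e \<subseteq> verts G"
  using hyperedge_inc(1) nd_edge_hyperedge by blast

lemma Inr_sub_points: "Inr e \<in> sub_points r G (verts G) \<longleftrightarrow> e \<in> nd_edges r G"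
  using nd_edge_inc[of e] by (cases e) (auto simp: sub_points_def image_iff)

lemma Inl_sub_points: "Inl v \<in> sub_points r G (verts G) \<longleftrightarrow> v \<in> verts G"
  by (auto simp: sub_points_def)

lemma finite_sheaf_index: "finite (sheaf_index r G U)"
proof -
  have "finite (nd_edges r G)" using G by (simp add: moment_graph_def)
  then show ?thesis using hypergraph(1) by (simp add: sheaf_index_def sub_points_def)
qed

lemma limit_diagram_gkm:
  assumes M: "gamma_sheaf r G M" and U: "edge_closed U"
  shows "limit_diagram r (sheaf_index r G U) (sheaf_arrows r G U) (stalk M)
    (\<lambda>x y. rho M (projl x) (projr y))"
proof
  show "finite (sheaf_index r G U)" by (rule finite_sheaf_index)
  show "sheaf_arrows r G U \<subseteq> sheaf_index r G U \<times> sheaf_index r G U"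
    using U nd_edge_inc
    by (fastforce simp: sheaf_arrows_def sheaf_index_def edge_closed_def Inr_sub_points Inl_sub_points)
  show "fg_graded_module r (stalk M x)" if "x \<in> sheaf_index r G U" for x
    using M that by (simp add: gamma_sheaf_def sheaf_index_def)
  show "rho M (projl x) (projr y) \<in> gmod_hom r (stalk M x) (stalk M y)"
    if "(x, y) \<in> sheaf_arrows r G U" for x y
    using M that by (auto simp: gamma_sheaf_def sheaf_arrows_def)
qed

lemma ball_sheaf_arrows:
  "(\<forall>p\<in>sheaf_arrows r G U. Q p) \<longleftrightarrow>
    (\<forall>e\<in>nd_edges r G. Inr e \<in> U \<longrightarrow> (\<forall>v\<in>inc e. Q (Inl v, Inr e)))"
  unfolding sheaf_arrows_def by blast

lemma gkm_sections_carrier: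
  "m \<in> carrier (gkm_sections r G M U) \<longleftrightarrow> m \<in> extensional (sheaf_index r G U) \<and>
    (\<forall>x\<in>sheaf_index r G U. m x \<in> carrier (stalk M x)) \<and>
    (\<forall>e\<in>nd_edges r G. Inr e \<in> U \<longrightarrow> (\<forall>v\<in>inc e. rho M v e (m (Inl v)) = m (Inr e)))"
  unfolding gkm_sections_def limit_module_simps(1) ball_sheaf_arrows mem_Collect_eq PiE_iff
  by auto

lemma gkm_sections_simps:
  "m \<oplus>\<^bsub>gkm_sections r G M U\<^esub> n = (\<lambda>x \<in> sheaf_index r G U. m x \<oplus>\<^bsub>stalk M x\<^esub> n x)"
  "a \<odot>\<^bsub>gkm_sections r G M U\<^esub> m = (\<lambda>x \<in> sheaf_index r G U. a \<odot>\<^bsub>stalk M x\<^esub> m x)"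
  "\<zero>\<^bsub>gkm_sections r G M U\<^esub> = (\<lambda>x \<in> sheaf_index r G U. \<zero>\<^bsub>stalk M x\<^esub>)"
  "m \<in> hdeg (gkm_sections r G M U) d \<longleftrightarrow> m \<in> carrier (gkm_sections r G M U) \<and>
    (\<forall>x \<in> sheaf_index r G U. m x \<in> hdeg (stalk M x) d)"
  by (simp_all add: gkm_sections_def limit_module_simps)

lemma vertex_index:
  "edge_closed U \<Longrightarrow> e \<in> nd_edges r G \<Longrightarrow> Inr e \<in> U \<Longrightarrow> v \<in> inc e \<Longrightarrow> Inl v \<in> sheaf_index r G U"
  using nd_edge_inc[of e] edge_closedD[of U e v] by (auto simp: sheaf_index_def Inl_sub_points)

lemma edge_index: "e \<in> nd_edges r G \<Longrightarrow> Inr e \<in> U \<Longrightarrow> Inr e \<in> sheaf_index r G U"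
  by (simp add: sheaf_index_def Inr_sub_points)

section \<open>Restriction and the sheaf axioms\<close>

lemma restrict_gmod_hom:
  assumes "edge_closed U" "edge_closed W" "W \<subseteq> U"
  shows "(\<lambda>s. restrict s (sheaf_index r G W)) \<in> gmod_hom r (gkm_sections r G M U) (gkm_sections r G M W)"
proof -
  note sub = sheaf_index_mono[OF assms(3), of r G]
  have cl: "restrict s (sheaf_index r G W) \<in> carrier (gkm_sections r G M W)"
    if s: "s \<in> carrier (gkm_sections r G M U)" for s
    unfolding gkm_sections_carrier
  proof (intro conjI ballI impI)
    fix e v assume e: "e \<in> nd_edges r G" "Inr e \<in> W" "v \<in> inc e"
    then have "Inl v \<in> sheaf_index r G W" "Inr e \<in> sheaf_index r G W" "Inr e \<in> U"
      using vertex_index[OF assms(2)] edge_index assms(3) by auto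
    then show "rho M v e (restrict s (sheaf_index r G W) (Inl v)) = restrict s (sheaf_index r G W) (Inr e)"
      using s e by (simp add: gkm_sections_carrier)
  qed (use s sub in \<open>auto simp: gkm_sections_carrier\<close>)
  show ?thesis
    unfolding gmod_hom_def
  proof (intro CollectI conjI ballI allI)
    show "(\<lambda>s. restrict s (sheaf_index r G W)) ` hdeg (gkm_sections r G M U) d
      \<subseteq> hdeg (gkm_sections r G M W) d" for d
      using cl subsetD[OF sub] by (fastforce simp: gkm_sections_simps)
  qed (use cl subsetD[OF sub] in \<open>auto simp: gkm_sections_simps restrict_def fun_eq_iff\<close>)
qed

text \<open>Sections are families indexed by points and restriction is restriction of functions, so
  gluing is pointwise. Compatibility at an edge can be checked in one member of the cover containing
  it, because that member also contains the endpoints.\<close>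

lemma gkm_sections_glue:
  assumes op: "\<And>U. U \<in> \<U> \<Longrightarrow> edge_closed U"
    and s: "\<And>U. U \<in> \<U> \<Longrightarrow> s U \<in> carrier (gkm_sections r G M U)"
    and agree: "\<And>U W. U \<in> \<U> \<Longrightarrow> W \<in> \<U> \<Longrightarrow>
      restrict (s U) (sheaf_index r G (U \<inter> W)) = restrict (s W) (sheaf_index r G (U \<inter> W))"
  shows "\<exists>!t. t \<in> carrier (gkm_sections r G M (\<Union>\<U>)) \<and>
    (\<forall>U\<in>\<U>. restrict t (sheaf_index r G U) = s U)"
proof -
  have agree': "s U x = s W x" if "U \<in> \<U>" "W \<in> \<U>" "x \<in> sheaf_index r G U" "x \<in> W" for U W x
  proof -
    have "x \<in> sheaf_index r G (U \<inter> W)" using that by (auto simp: sheaf_index_def)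
    then show ?thesis using fun_cong[OF agree[OF that(1,2)], of x] by simp
  qed
  \<comment> \<open>The choice of a member of the cover containing \<open>x\<close> is immaterial by
    \<open>agree'\<close>.\<close>
  define t where "t = (\<lambda>x\<in>sheaf_index r G (\<Union>\<U>). s (SOME U. U \<in> \<U> \<and> x \<in> U) x)"
  have t: "t x = s U x" if "U \<in> \<U>" "x \<in> sheaf_index r G U" for U x
  proof -
    have "x \<in> U" using that(2) by (simp add: sheaf_index_def)
    then have "U \<in> \<U> \<and> x \<in> U" using that(1) by blast
    then have some: "(SOME U. U \<in> \<U> \<and> x \<in> U) \<in> \<U> \<and> x \<in> (SOME U. U \<in> \<U> \<and> x \<in> U)"
      by (rule someI)
    have "x \<in> sheaf_index r G (\<Union>\<U>)" using that by (auto simp: sheaf_index_def)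
    then have "t x = s (SOME U. U \<in> \<U> \<and> x \<in> U) x" by (simp only: t_def restrict_apply if_True)
    also have "\<dots> = s U x" using agree'[OF that(1) conjunct1[OF some] that(2) conjunct2[OF some]] by (rule sym)
    finally show ?thesis .
  qed
  have cover: "\<exists>U\<in>\<U>. x \<in> sheaf_index r G U" if "x \<in> sheaf_index r G (\<Union>\<U>)" for x
    using that by (auto simp: sheaf_index_def)
  have "t \<in> carrier (gkm_sections r G M (\<Union>\<U>))"
    unfolding gkm_sections_carrier
  proof (intro conjI ballI impI)
    show "t x \<in> carrier (stalk M x)" if x: "x \<in> sheaf_index r G (\<Union>\<U>)" for x
    proof -
      obtain U where "U \<in> \<U>" "x \<in> sheaf_index r G U" using cover[OF x] by blast
      then show ?thesis using s[of U] t[of U x] by (simp add: gkm_sections_carrier)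
    qed
    fix e v assume e: "e \<in> nd_edges r G" "Inr e \<in> \<Union>\<U>" "v \<in> inc e"
    then obtain U where U: "U \<in> \<U>" "Inr e \<in> U" by blast
    then have "Inl v \<in> sheaf_index r G U" "Inr e \<in> sheaf_index r G U"
      using vertex_index[OF op] edge_index e by auto
    then show "rho M v e (t (Inl v)) = t (Inr e)"
      using s[OF U(1)] e U t by (simp add: gkm_sections_carrier)
  qed (simp add: t_def)
  moreover have "restrict t (sheaf_index r G U) = s U" if "U \<in> \<U>" for U
    using s[OF that] t[OF that] by (intro extensionalityI[of _ "sheaf_index r G U"])
      (auto simp: gkm_sections_carrier)
  moreover have "t' = t"
    if t': "t' \<in> carrier (gkm_sections r G M (\<Union>\<U>))" "\<And>U. U \<in> \<U> \<Longrightarrow> restrict t' (sheaf_index r G U) = s U"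
    for t'
  proof (rule extensionalityI)
    show "t' \<in> extensional (sheaf_index r G (\<Union>\<U>))" using t'(1) by (simp add: gkm_sections_carrier)
    show "t \<in> extensional (sheaf_index r G (\<Union>\<U>))" by (simp add: t_def)
    fix x assume "x \<in> sheaf_index r G (\<Union>\<U>)"
    then obtain U where U: "U \<in> \<U>" "x \<in> sheaf_index r G U" using cover by blast
    then show "t' x = t x" using fun_cong[OF t'(2)[OF U(1)], of x] t[OF U] by simp
  qed
  ultimately show ?thesis by blast
qed

lemma sheaf_of_modules_assoc:
  assumes M: "gamma_sheaf r G M"
  shows "sheaf_of_modules r (Top r G) (assoc_sheaf r G M)"
  unfolding sheaf_of_modules_def
proof (intro conjI allI impI ballI)
  fix U assume U: "openin (Top r G) U"
  show "fg_graded_module r (sec (assoc_sheaf r G M) U)"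
    using limit_diagram.fg_graded_module_L[OF limit_diagram_gkm[OF M openin_Top_edge_closed[OF U]]]
    by (simp add: assoc_sheaf_def gkm_sections_def)
  show "rest (assoc_sheaf r G M) U U s = s" if "s \<in> carrier (sec (assoc_sheaf r G M) U)" for s
    using that by (simp add: assoc_sheaf_def gkm_sections_carrier extensional_restrict)
next
  fix U W assume "openin (Top r G) U \<and> openin (Top r G) W \<and> W \<subseteq> U"
  then show "rest (assoc_sheaf r G M) U W \<in>
      gmod_hom r (sec (assoc_sheaf r G M) U) (sec (assoc_sheaf r G M) W)"
    by (auto simp: assoc_sheaf_def intro: restrict_gmod_hom openin_Top_edge_closed)
next
  fix U W Z s assume "openin (Top r G) U \<and> openin (Top r G) W \<and> openin (Top r G) Z \<and> Z \<subseteq> W \<and> W \<subseteq> U"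
  then have "sheaf_index r G W \<inter> sheaf_index r G Z = sheaf_index r G Z"
    using sheaf_index_mono[of Z W r G] by blast
  then show "rest (assoc_sheaf r G M) W Z (rest (assoc_sheaf r G M) U W s) =
      rest (assoc_sheaf r G M) U Z s"
    by (simp add: assoc_sheaf_def)
next
  fix \<U> s
  assume "(\<forall>U\<in>\<U>. openin (Top r G) U \<and> s U \<in> carrier (sec (assoc_sheaf r G M) U)) \<and>
    (\<forall>U\<in>\<U>. \<forall>W\<in>\<U>. rest (assoc_sheaf r G M) U (U \<inter> W) (s U) = rest (assoc_sheaf r G M) W (U \<inter> W) (s W))"
  then show "\<exists>!t. t \<in> carrier (sec (assoc_sheaf r G M) (\<Union>\<U>)) \<and>
      (\<forall>U\<in>\<U>. rest (assoc_sheaf r G M) (\<Union>\<U>) U t = s U)"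
    unfolding assoc_sheaf_def mod_sheaf.simps
    by (intro gkm_sections_glue) (blast intro: openin_Top_edge_closed)+
qed

section \<open>Edge modules as quotients\<close>

lemma edge_src_inc:
  assumes e: "e \<in> nd_edges r G"
  obtains t where "inc e = {edge_src G e, t}" "edge_src G e \<noteq> t"
proof -
  obtain x y where xy: "inc e = {x, y}" "x \<noteq> y"
    using e by (auto simp: nd_edges_def card_2_iff)
  have po: "refl_on (verts G) (vle G)" "antisym (vle G)"
    using G by (auto simp: moment_graph_def partial_order_on_def preorder_on_def)
  have refl: "(x, x) \<in> vle G" "(y, y) \<in> vle G"
    using po(1) nd_edge_inc[OF e] xy by (auto simp: refl_on_def)
  have "(x, y) \<in> vle G \<or> (y, x) \<in> vle G" using G e xy by (auto simp: moment_graph_def)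
  \<comment> \<open>The endpoints are comparable, and antisymmetry leaves only one that is above
    both, so the definite description in \<open>edge_src\<close> denotes it.\<close>
  then have "edge_src G e = x \<or> edge_src G e = y"
  proof
    assume "(x, y) \<in> vle G"
    then have "edge_src G e = y"
      unfolding edge_src_def using xy refl po(2) by (intro the_equality) (auto dest: antisymD)
    then show ?thesis by simp
  next
    assume "(y, x) \<in> vle G"
    then have "edge_src G e = x"
      unfolding edge_src_def using xy refl po(2) by (intro the_equality) (auto dest: antisymD)
    then show ?thesis by simp
  qed
  then show ?thesis using that xy by auto
qed

text \<open>Purity factors \<rho> at the upper endpoint through the cosets of
  \<open>\<alpha>M(s)\<close>, followed by a bijection. Its image and kernel are extracted here, so
  that later arguments need no cosets.\<close>

lemma nd_edge_projection:
  assumes M: "pure_sheaf r G M" and e: "e \<in> nd_edges r G"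
  shows "rho M (edge_src G e) e ` carrier (stalk M (Inl (edge_src G e))) = carrier (stalk M (Inr e))"
    and "m \<in> carrier (stalk M (Inl (edge_src G e))) \<Longrightarrow>
      rho M (edge_src G e) e m = \<zero>\<^bsub>stalk M (Inr e)\<^esub> \<longleftrightarrow>
      m \<in> elt_mult_set (edge_elt r e) (stalk M (Inl (edge_src G e)))"
proof -
  define s where "s = edge_src G e"
  define S where "S = stalk M (Inl s)"
  define K where "K = elt_mult_set (edge_elt r e) S"
  have M': "gamma_sheaf r G M" using M by (simp add: pure_sheaf_def)
  have s: "s \<in> inc e" using edge_src_inc[OF e] by (auto simp: s_def)
  then have "s \<in> verts G" using nd_edge_inc[OF e] by blast
  then have gr: "graded_module r S" "graded_module r (stalk M (Inr e))"
    using M' e by (auto simp: gamma_sheaf_def S_def fg_graded_module_def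
        Inr_sub_points Inl_sub_points)
  interpret S: sym_module r S using gr(1) by (rule graded_module_sym_module)
  interpret E: sym_module r "stalk M (Inr e)" using gr(2) by (rule graded_module_sym_module)
  have "rho M s e \<in> gmod_hom r S (stalk M (Inr e))"
    using M' e s by (simp add: gamma_sheaf_def S_def)
  then interpret rho: lin_map r S "stalk M (Inr e)" "rho M s e"
    by (intro lin_mapI S.sym_module_axioms E.sym_module_axioms gmod_hom_lin_maps)
  obtain \<phi> where \<phi>: "\<phi> \<in> gmod_iso r (quot_module S K) (stalk M (Inr e))"
    and rho: "\<And>m. m \<in> carrier S \<Longrightarrow> rho M s e m = \<phi> (K +>\<^bsub>S\<^esub> m)"
    using M e unfolding pure_sheaf_def Let_def S_def K_def s_def by blast
  have bij: "bij_betw \<phi> (a_rcosets\<^bsub>S\<^esub> K) (carrier (stalk M (Inr e)))"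
    using \<phi> by (simp add: gmod_iso_def quot_module_def)
  have cosets: "a_rcosets\<^bsub>S\<^esub> K = (\<lambda>m. K +>\<^bsub>S\<^esub> m) ` carrier S"
    by (auto simp: A_RCOSETS_def RCOSETS_def a_r_coset_def)
  have "rho M s e ` carrier S = \<phi> ` (a_rcosets\<^bsub>S\<^esub> K)"
    unfolding cosets image_image by (intro image_cong rho) auto
  then show "rho M (edge_src G e) e ` carrier (stalk M (Inl (edge_src G e))) = carrier (stalk M (Inr e))"
    using bij by (simp add: bij_betw_def S_def s_def)
  assume "m \<in> carrier (stalk M (Inl (edge_src G e)))"
  then have m: "m \<in> carrier S" by (simp add: S_def s_def)
  \<comment> \<open>Writing zero as the image of zero leaves an equation between two values of
    \<open>\<phi>\<close>, and injectivity of \<open>\<phi>\<close> on cosets finishes.\<close>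
  have "rho M s e m = \<zero>\<^bsub>stalk M (Inr e)\<^esub> \<longleftrightarrow> rho M s e m = rho M s e \<zero>\<^bsub>S\<^esub>" by simp
  also have "\<dots> \<longleftrightarrow> \<phi> (K +>\<^bsub>S\<^esub> m) = \<phi> (K +>\<^bsub>S\<^esub> \<zero>\<^bsub>S\<^esub>)"
    by (simp only: rho[OF m] rho[OF S.M.zero_closed])
  also have "\<dots> \<longleftrightarrow> K +>\<^bsub>S\<^esub> m = K +>\<^bsub>S\<^esub> \<zero>\<^bsub>S\<^esub>"
    using m S.M.zero_closed by (intro inj_on_eq_iff[OF bij_betw_imp_inj_on[OF bij]]) (auto simp: cosets)
  also have "\<dots> \<longleftrightarrow> m \<in> K"
    unfolding K_def by (rule S.quotient_coset_eq_zero[OF dir_elt_closed m])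
  finally show "rho M (edge_src G e) e m = \<zero>\<^bsub>stalk M (Inr e)\<^esub> \<longleftrightarrow>
      m \<in> elt_mult_set (edge_elt r e) (stalk M (Inl (edge_src G e)))"
    by (simp add: K_def S_def s_def)
qed

text \<open>An element of \<open>M(e)\<close> lifts to some \<open>m\<close> in \<open>M(s)\<close>,
  and \<alpha> times \<open>m\<close> lies in the kernel. The conclusion concerns
  \<open>M(e)\<close> alone and so can be used at the lower endpoint too.\<close>

lemma edge_elt_kills:
  assumes M: "pure_sheaf r G M" and e: "e \<in> nd_edges r G" and x: "x \<in> carrier (stalk M (Inr e))"
  shows "edge_elt r e \<odot>\<^bsub>stalk M (Inr e)\<^esub> x = \<zero>\<^bsub>stalk M (Inr e)\<^esub>"
proof -
  let ?s = "edge_src G e" and ?a = "edge_elt r e"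
  have M': "gamma_sheaf r G M" using M by (simp add: pure_sheaf_def)
  have s: "?s \<in> inc e" using edge_src_inc[OF e] by auto
  then have "?s \<in> verts G" using nd_edge_inc[OF e] by blast
  then have gr: "graded_module r (stalk M (Inl ?s))"
    using M' by (auto simp: gamma_sheaf_def fg_graded_module_def Inl_sub_points)
  interpret S: sym_module r "stalk M (Inl ?s)" using gr by (rule graded_module_sym_module)
  obtain m where m: "m \<in> carrier (stalk M (Inl ?s))" "x = rho M ?s e m"
    using nd_edge_projection(1)[OF M e] x by blast
  have "rho M ?s e \<in> gmod_hom r (stalk M (Inl ?s)) (stalk M (Inr e))"
    using M' e s by (simp add: gamma_sheaf_def)
  then have "?a \<odot>\<^bsub>stalk M (Inr e)\<^esub> x = rho M ?s e (?a \<odot>\<^bsub>stalk M (Inl ?s)\<^esub> m)"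
    using m dir_elt_closed by (simp add: gmod_hom_def)
  also have "\<dots> = \<zero>\<^bsub>stalk M (Inr e)\<^esub>"
    using nd_edge_projection(2)[OF M e] m(1) dir_elt_closed by (simp add: elt_mult_set_def)
  finally show ?thesis .
qed

section \<open>Freeness over basic open sets\<close>

lemma gkm_sections_sym_module:
  "gamma_sheaf r G M \<Longrightarrow> edge_closed U \<Longrightarrow> sym_module r (gkm_sections r G M U)"
  using limit_diagram.sym_module_L[OF limit_diagram_gkm] by (simp add: gkm_sections_def)

lemma gkm_sections_eval:
  "gamma_sheaf r G M \<Longrightarrow> edge_closed U \<Longrightarrow> x \<in> sheaf_index r G U \<Longrightarrow>
    lin_map r (gkm_sections r G M U) (stalk M x) (\<lambda>m. m x)"
  using limit_diagram.eval_lin_map[OF limit_diagram_gkm] by (simp add: gkm_sections_def)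

lemma stalk_sym_module:
  "gamma_sheaf r G M \<Longrightarrow> x \<in> sub_points r G (verts G) \<Longrightarrow> sym_module r (stalk M x)"
  by (simp add: gamma_sheaf_def fg_graded_module_def graded_module_sym_module)

text \<open>Stated through the index set, so as to cover both a single vertex and a degenerate
  hyperedge at it: in either case a section is one element of the stalk.\<close>

lemma free_sections_vertex:
  fixes M :: "('v, 'm) gamma_sheaf"
  assumes M: "pure_sheaf r G M" and v: "v \<in> verts G" and U: "edge_closed U"
    and idx: "sheaf_index r G U = {Inl v}"
  shows "free_module r (gkm_sections r G M U)"
proof -
  have M': "gamma_sheaf r G M" using M by (simp add: pure_sheaf_def)
  have no_edge: "Inr e \<notin> U" if "e \<in> nd_edges r G" for e
    using edge_index[OF that] idx by blast
  have carr: "carrier (gkm_sections r G M U) = {m \<in> extensional {Inl v}. m (Inl v) \<in> carrier (stalk M (Inl v))}"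
    using no_edge by (auto simp: gkm_sections_carrier idx)
  define emb :: "'m \<Rightarrow> 'v point \<Rightarrow> 'm" where "emb m = (\<lambda>x\<in>{Inl v}. m)" for m
  interpret lin_map r "stalk M (Inl v)" "gkm_sections r G M U" emb
  proof (rule lin_mapI)
    show "sym_module r (stalk M (Inl v))"
      using M' v by (intro stalk_sym_module) (auto simp: Inl_sub_points)
    then interpret sym_module r "stalk M (Inl v)" .
    show "sym_module r (gkm_sections r G M U)" using M' U by (rule gkm_sections_sym_module)
    show "emb \<in> lin_maps r (stalk M (Inl v)) (gkm_sections r G M U)"
      by (auto simp: emb_def lin_maps_def carr gkm_sections_simps idx fun_eq_iff)
  qed
  show ?thesis
  proof (rule free_module_iso)
    show "inj_on emb (carrier (stalk M (Inl v)))"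
    proof (rule Fun.inj_onI)
      fix m n assume "emb m = emb n"
      from fun_cong[OF this, of "Inl v"] show "m = n" by (simp add: emb_def)
    qed
    show "carrier (gkm_sections r G M U) \<subseteq> emb ` carrier (stalk M (Inl v))"
    proof
      fix m assume m: "m \<in> carrier (gkm_sections r G M U)"
      then have "m = emb (m (Inl v))"
        by (auto simp: carr emb_def extensional_def)
      then show "m \<in> emb ` carrier (stalk M (Inl v))"
        using m by (auto simp: carr)
    qed
    show "free_module r (stalk M (Inl v))" using M v by (simp add: pure_sheaf_def)
  qed
qed

lemma free_sections_edge:
  assumes M: "pure_sheaf r G M" and e: "e \<in> nd_edges r G"
  shows "free_module r (gkm_sections r G M (basic_open (Inr e)))"
proof -
  let ?U = "basic_open (Inr e)" and ?a = "edge_elt r e"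
  have M': "gamma_sheaf r G M" using M by (simp add: pure_sheaf_def)
  define s where "s = edge_src G e"
  obtain t where st: "inc e = {s, t}" "s \<noteq> t" using edge_src_inc[OF e] unfolding s_def by blast
  have stV: "s \<in> verts G" "t \<in> verts G" using nd_edge_inc[OF e] st by auto
  have U: "?U = {Inr e, Inl s, Inl t}" using st by (auto simp: basic_open_def)
  have ec: "edge_closed ?U" by (auto simp: edge_closed_def basic_open_def)
  have idx: "sheaf_index r G ?U = {Inr e, Inl s, Inl t}"
    unfolding U using e stV by (auto simp: sheaf_index_def Inr_sub_points Inl_sub_points)
  let ?F = "gkm_sections r G M ?U" and ?S = "stalk M (Inl s)" and ?T = "stalk M (Inl t)"
    and ?E = "stalk M (Inr e)"
  have carr: "m \<in> carrier ?F \<longleftrightarrow> m \<in> extensional {Inr e, Inl s, Inl t} \<and> m (Inr e) \<in> carrier ?E \<and>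
      m (Inl s) \<in> carrier ?S \<and> m (Inl t) \<in> carrier ?T \<and>
      rho M s e (m (Inl s)) = m (Inr e) \<and> rho M t e (m (Inl t)) = m (Inr e)" for m
    unfolding gkm_sections_carrier idx using e st by (auto simp: U)
  interpret S: sym_module r ?S using M' stV by (intro stalk_sym_module) (auto simp: Inl_sub_points)
  interpret T: sym_module r ?T using M' stV by (intro stalk_sym_module) (auto simp: Inl_sub_points)
  interpret E: sym_module r ?E using M' e by (intro stalk_sym_module) (auto simp: Inr_sub_points)
  interpret rs: lin_map r ?S ?E "rho M s e"
    using M' e st by (intro lin_mapI S.sym_module_axioms E.sym_module_axioms gmod_hom_lin_maps)
      (auto simp: gamma_sheaf_def)
  interpret rt: lin_map r ?T ?E "rho M t e"
    using M' e st by (intro lin_mapI T.sym_module_axioms E.sym_module_axioms gmod_hom_lin_maps)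
      (auto simp: gamma_sheaf_def)
  have a: "?a \<in> carrier (sym_alg r)" by (rule dir_elt_closed)
  have "snd e \<in> proj_weights r" using nd_edge_hyperedge[OF e] by (auto simp: hyperedges_def)
  then have a0: "?a \<noteq> 0" by (rule dir_elt_nonzero)
  have free: "free_module r ?S" "free_module r ?T" using M stV by (simp_all add: pure_sheaf_def)
  note proj = nd_edge_projection[OF M e, folded s_def]
  have rho_a: "rho M s e (?a \<odot>\<^bsub>?S\<^esub> k) = \<zero>\<^bsub>?E\<^esub>" if "k \<in> carrier ?S" for k
    using proj(2)[of "?a \<odot>\<^bsub>?S\<^esub> k"] that a by (simp add: elt_mult_set_def del: rs.smult)
  \<comment> \<open>Multiplication by \<alpha> followed by extension by zero; the result is a
    section because \<rho> kills \<open>\<alpha>M(s)\<close>. This parametrizes the kernel of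
    evaluation at \<open>t\<close> by the free module \<open>M(s)\<close>.\<close>
  define i where "i k = (\<lambda>x\<in>{Inr e, Inl s, Inl t}. if x = Inl s then ?a \<odot>\<^bsub>?S\<^esub> k else \<zero>\<^bsub>stalk M x\<^esub>)" for k
  have iF: "i k \<in> carrier ?F" if "k \<in> carrier ?S" for k
    using that a st rho_a by (auto simp: carr i_def simp del: rs.smult)
  have i_lin: "i \<in> lin_maps r ?S ?F"
  proof -
    have "i (x \<oplus>\<^bsub>?S\<^esub> y) = i x \<oplus>\<^bsub>?F\<^esub> i y" if "x \<in> carrier ?S" "y \<in> carrier ?S" for x y
      using that a st S.smult_r_distr by (auto simp: i_def gkm_sections_simps idx fun_eq_iff)
    moreover have "i (b \<odot>\<^bsub>?S\<^esub> x) = b \<odot>\<^bsub>?F\<^esub> i x"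
      if "b \<in> carrier (sym_alg r)" "x \<in> carrier ?S" for b x
      using that a st
      by (auto simp: i_def gkm_sections_simps idx fun_eq_iff S.smult_mult[symmetric] mult.commute)
    ultimately show ?thesis using iF by (auto simp: lin_maps_def)
  qed
  have i: "lin_map r ?S ?F i"
    using i_lin by (intro lin_mapI S.sym_module_axioms gkm_sections_sym_module[OF M' ec])
  interpret i: lin_map r ?S ?F i by (rule i)
  have p: "lin_map r ?F ?T (\<lambda>m. m (Inl t))"
    using gkm_sections_eval[OF M' ec, of "Inl t"] idx by simp
  show ?thesis
  proof (rule free_module_extension[OF i p])
    show "inj_on i (carrier ?S)"
    proof (rule i.inj_onI)
      \<comment> \<open>Free modules are torsion-free and \<alpha> is nonzero, so the coordinate at
        \<open>s\<close> determines \<open>k\<close>.\<close>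
      fix k assume k: "k \<in> carrier ?S" "i k = \<zero>\<^bsub>?F\<^esub>"
      from fun_cong[OF k(2), of "Inl s"] have "?a \<odot>\<^bsub>?S\<^esub> k = \<zero>\<^bsub>?S\<^esub>"
        by (simp add: i_def gkm_sections_simps idx)
      then show "k = \<zero>\<^bsub>?S\<^esub>" by (rule S.free_module_torsion_free[OF free(1) a a0 k(1)])
    qed
    show "carrier ?T \<subseteq> (\<lambda>m. m (Inl t)) ` carrier ?F"
    proof
      fix n assume n: "n \<in> carrier ?T"
      then have "rho M t e n \<in> rho M s e ` carrier ?S" unfolding proj(1) by simp
      then obtain m where m: "m \<in> carrier ?S" "rho M s e m = rho M t e n" by auto
      \<comment> \<open>The projection from \<open>M(s)\<close> onto \<open>M(e)\<close> supplies an
        \<open>m\<close> that matches \<open>n\<close> at the edge, so \<open>n\<close> extends to a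
        section.\<close>
      define f where "f = (\<lambda>x\<in>{Inr e, Inl s, Inl t}. if x = Inl s then m else if x = Inl t then n else rho M t e n)"
      have "f \<in> carrier ?F" using m n st by (auto simp: carr f_def)
      moreover have "n = f (Inl t)" using st by (simp add: f_def)
      ultimately show "n \<in> (\<lambda>m. m (Inl t)) ` carrier ?F" by blast
    qed
    show "f (Inl t) = \<zero>\<^bsub>?T\<^esub> \<longleftrightarrow> f \<in> i ` carrier ?S" if f: "f \<in> carrier ?F" for f
    proof
      assume f0: "f (Inl t) = \<zero>\<^bsub>?T\<^esub>"
      then have fe: "f (Inr e) = \<zero>\<^bsub>?E\<^esub>" using f by (auto simp: carr)
      then have "f (Inl s) \<in> elt_mult_set ?a ?S" using f proj(2)[of "f (Inl s)"] by (simp add: carr)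
      then obtain k where k: "k \<in> carrier ?S" "f (Inl s) = ?a \<odot>\<^bsub>?S\<^esub> k" by (auto simp: elt_mult_set_def)
      have "f = i k"
      proof (rule extensionalityI[of _ "{Inr e, Inl s, Inl t}"])
        show "f x = i k x" if "x \<in> {Inr e, Inl s, Inl t}" for x
          using that f0 fe k(2) st by (auto simp: i_def)
      qed (use f in \<open>auto simp: carr i_def\<close>)
      then show "f \<in> i ` carrier ?S" using k(1) by blast
    next
      assume "f \<in> i ` carrier ?S"
      then show "f (Inl t) = \<zero>\<^bsub>?T\<^esub>" using st by (auto simp: i_def)
    qed
  qed (rule free)+
qed

section \<open>Restriction from a hyperedge to its vertices\<close>

lemma edge_closed_basic: "edge_closed (basic_open x)"
  by (cases x) (auto simp: edge_closed_def basic_open_def)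

lemma edge_closed_vertices: "edge_closed (Inl ` S)"
  by (auto simp: edge_closed_def)

text \<open>The coordinate at an edge is forced by that at any endpoint, and hyperedges are
  nonempty.\<close>

lemma restriction_inj:
  assumes e: "e \<in> hyperedges r G"
    and m: "m \<in> carrier (gkm_sections r G M (basic_open (Inr e)))"
    and n: "n \<in> carrier (gkm_sections r G M (basic_open (Inr e)))"
    and eq: "restrict m (sheaf_index r G (Inl ` inc e)) = restrict n (sheaf_index r G (Inl ` inc e))"
  shows "m = n"
proof (rule extensionalityI)
  let ?U = "basic_open (Inr e)"
  show "m \<in> extensional (sheaf_index r G ?U)" "n \<in> extensional (sheaf_index r G ?U)"
    using m n by (simp_all add: gkm_sections_carrier)
  have vert: "m (Inl v) = n (Inl v)" if "v \<in> inc e" for v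
  proof -
    have "v \<in> verts G" using hyperedge_inc(1)[OF e] that by blast
    then have "Inl v \<in> sheaf_index r G (Inl ` inc e)"
      using that by (auto simp: sheaf_index_def Inl_sub_points)
    then show ?thesis using fun_cong[OF eq, of "Inl v"] by simp
  qed
  fix x assume x: "x \<in> sheaf_index r G ?U"
  then consider v where "v \<in> inc e" "x = Inl v" | "x = Inr e" "e \<in> nd_edges r G"
    by (auto simp: sheaf_index_def basic_open_def Inr_sub_points)
  then show "m x = n x"
  proof cases
    case 1
    then show ?thesis using vert by simp
  next
    case 2
    obtain v where v: "v \<in> inc e" using hyperedge_inc(2)[OF e] by blast
    have "Inr e \<in> ?U" by (simp add: basic_open_def)
    then have "m (Inr e) = rho M v e (m (Inl v))" "n (Inr e) = rho M v e (n (Inl v))"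
      using m n v 2(2) by (simp_all add: gkm_sections_carrier)
    then show ?thesis using vert[OF v] 2(1) by simp
  qed
qed

text \<open>An equality of modules, not just an isomorphism: a degenerate hyperedge adds neither a
  coordinate nor a condition.\<close>

lemma degenerate_sections:
  assumes "e \<notin> nd_edges r G"
  shows "sheaf_index r G (basic_open (Inr e)) = sheaf_index r G (Inl ` inc e)"
    and "gkm_sections r G M (basic_open (Inr e)) = gkm_sections r G M (Inl ` inc e)"
proof -
  show *: "sheaf_index r G (basic_open (Inr e)) = sheaf_index r G (Inl ` inc e)"
    using assms by (auto simp: sheaf_index_def basic_open_def Inr_sub_points)
  have "sheaf_arrows r G (basic_open (Inr e)) = sheaf_arrows r G (Inl ` inc e)"
    using assms by (auto simp: sheaf_arrows_def basic_open_def)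
  then show "gkm_sections r G M (basic_open (Inr e)) = gkm_sections r G M (Inl ` inc e)"
    by (simp add: gkm_sections_def *)
qed

lemma restrict_self:
  "m \<in> carrier (gkm_sections r G M U) \<Longrightarrow> restrict m (sheaf_index r G U) = m"
  by (simp add: gkm_sections_carrier extensional_restrict)

text \<open>Restriction is injective before inverting anything. A family on the vertices extends
  after multiplication by \<alpha> if the edge is nondegenerate, and as it stands otherwise, whence
  the exponents 1 and 0.\<close>

lemma iso_after_inverting_restriction:
  assumes M: "pure_sheaf r G M" and e: "e \<in> hyperedges r G"
  shows "iso_after_inverting (edge_elt r e) (gkm_sections r G M (basic_open (Inr e)))
    (gkm_sections r G M (Inl ` inc e)) (\<lambda>m. restrict m (sheaf_index r G (Inl ` inc e)))"
proof -
  let ?U = "basic_open (Inr e)" and ?W = "Inl ` inc e" and ?a = "edge_elt r e"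
  let ?FU = "gkm_sections r G M ?U" and ?FW = "gkm_sections r G M ?W"
  have M': "gamma_sheaf r G M" using M by (simp add: pure_sheaf_def)
  have sub: "?W \<subseteq> ?U" by (auto simp: basic_open_def)
  interpret lin_map r ?FU ?FW "\<lambda>m. restrict m (sheaf_index r G ?W)"
    using sub by (intro lin_mapI gkm_sections_sym_module[OF M'] gmod_hom_lin_maps
        restrict_gmod_hom edge_closed_basic edge_closed_vertices)
  show ?thesis
  proof (rule iso_after_invertingI[OF dir_elt_closed])
    show "inj_on (\<lambda>m. restrict m (sheaf_index r G ?W)) (carrier ?FU)"
      using restriction_inj[OF e] by (intro Fun.inj_onI) blast
    fix n assume n: "n \<in> carrier ?FW"
    show "\<exists>k. ?a ^ k \<odot>\<^bsub>?FW\<^esub> n \<in> (\<lambda>m. restrict m (sheaf_index r G ?W)) ` carrier ?FU"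
    proof (cases "e \<in> nd_edges r G")
      case False
      have "?a ^ 0 \<odot>\<^bsub>?FW\<^esub> n = restrict n (sheaf_index r G ?W)"
        using n restrict_self[OF n] by simp
      moreover have "n \<in> carrier ?FU" using n degenerate_sections(2)[OF False, of M] by simp
      ultimately show ?thesis by blast
    next
      case True
      have inV: "inc e \<subseteq> verts G" using nd_edge_inc[OF True] .
      have idxW: "sheaf_index r G ?W = ?W"
        using inV by (auto simp: sheaf_index_def Inl_sub_points)
      have idxU: "sheaf_index r G ?U = insert (Inr e) ?W"
        using inV True by (auto simp: sheaf_index_def basic_open_def Inr_sub_points Inl_sub_points)
      have nv: "n (Inl v) \<in> carrier (stalk M (Inl v))" if "v \<in> inc e" for v
        using n that by (simp add: gkm_sections_carrier idxW)
      \<comment> \<open>Both endpoints map \<open>\<alpha>n\<close> to zero in \<open>M(e)\<close>,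
        so zero is the coordinate to take at the edge.\<close>
      define m where "m = (\<lambda>x\<in>sheaf_index r G ?U.
        if x = Inr e then \<zero>\<^bsub>stalk M (Inr e)\<^esub> else ?a \<odot>\<^bsub>stalk M x\<^esub> n x)"
      have zE: "\<zero>\<^bsub>stalk M (Inr e)\<^esub> \<in> carrier (stalk M (Inr e))"
      proof -
        interpret sym_module r "stalk M (Inr e)"
          using True by (intro stalk_sym_module M') (simp add: Inr_sub_points)
        show ?thesis by simp
      qed
      have av: "?a \<odot>\<^bsub>stalk M (Inl v)\<^esub> n (Inl v) \<in> carrier (stalk M (Inl v))" if "v \<in> inc e" for v
      proof -
        interpret sym_module r "stalk M (Inl v)"
          using that inV by (intro stalk_sym_module M') (auto simp: Inl_sub_points)
        show ?thesis using nv[OF that] dir_elt_closed by simp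
      qed
      have rv: "rho M v e (?a \<odot>\<^bsub>stalk M (Inl v)\<^esub> n (Inl v)) = \<zero>\<^bsub>stalk M (Inr e)\<^esub>"
        if v: "v \<in> inc e" for v
      proof -
        have h: "rho M v e \<in> gmod_hom r (stalk M (Inl v)) (stalk M (Inr e))"
          using M' True v by (simp add: gamma_sheaf_def)
        then have "rho M v e (n (Inl v)) \<in> carrier (stalk M (Inr e))"
          using nv[OF v] by (auto simp: gmod_hom_def)
        then show ?thesis
          using edge_elt_kills[OF M True] h nv[OF v] dir_elt_closed by (simp add: gmod_hom_def)
      qed
      have "m \<in> carrier ?FU"
        unfolding gkm_sections_carrier
      proof (intro conjI ballI impI)
        show "m x \<in> carrier (stalk M x)" if "x \<in> sheaf_index r G ?U" for x
          using that zE av by (auto simp: m_def idxU)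
        fix e' v assume e': "e' \<in> nd_edges r G" "Inr e' \<in> ?U" "v \<in> inc e'"
        then have "e' = e" by (auto simp: basic_open_def)
        then show "rho M v e' (m (Inl v)) = m (Inr e')"
          using e' rv by (auto simp: m_def idxU)
      qed (simp add: m_def)
      moreover have "?a ^ 1 \<odot>\<^bsub>?FW\<^esub> n = restrict m (sheaf_index r G ?W)"
        by (auto simp: gkm_sections_simps m_def idxU idxW fun_eq_iff)
      ultimately show ?thesis by blast
    qed
  qed
qed

lemma gkm_sheaf_assoc:
  assumes M: "pure_sheaf r G M"
  shows "gkm_sheaf r G (assoc_sheaf r G M)"
  unfolding gkm_sheaf_def
proof (intro conjI ballI)
  have M': "gamma_sheaf r G M" using M by (simp add: pure_sheaf_def)
  show "sheaf_of_modules r (Top r G) (assoc_sheaf r G M)" by (rule sheaf_of_modules_assoc[OF M'])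
  show "free_module r (sec (assoc_sheaf r G M) (basic_open x))" if x: "x \<in> hg_points r G" for x
  proof (cases x)
    case (Inl v)
    then have v: "v \<in> verts G" using x by (auto simp: hg_points_def)
    have "sheaf_index r G (basic_open x) = {Inl v}"
      using v by (auto simp: sheaf_index_def basic_open_def Inl_sub_points Inl)
    then show ?thesis
      using free_sections_vertex[OF M v edge_closed_basic] by (simp add: assoc_sheaf_def)
  next
    case (Inr e)
    then have e: "e \<in> hyperedges r G" using x by (auto simp: hg_points_def)
    show ?thesis
    proof (cases "e \<in> nd_edges r G")
      case True
      then show ?thesis using free_sections_edge[OF M] by (simp add: Inr assoc_sheaf_def)
    next
      case False
      obtain v where v: "v \<in> verts G" "inc e = {v}" using degenerate_inc[OF e False] .
      have "sheaf_index r G (basic_open x) = {Inl v}"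
        using v False by (auto simp: sheaf_index_def basic_open_def Inl_sub_points Inr_sub_points Inr)
      then show ?thesis
        using free_sections_vertex[OF M v(1) edge_closed_basic] by (simp add: assoc_sheaf_def)
    qed
  qed
  show "iso_after_inverting (edge_elt r e) (sec (assoc_sheaf r G M) (basic_open (Inr e)))
      (sec (assoc_sheaf r G M) (Inl ` inc e))
      (rest (assoc_sheaf r G M) (basic_open (Inr e)) (Inl ` inc e))" if "e \<in> hyperedges r G" for e
    using iso_after_inverting_restriction[OF M that] by (simp add: assoc_sheaf_def)
  \<comment> \<open>Over a degenerate hyperedge restriction is the identity, so any exception is one
    of the finitely many nondegenerate edges.\<close>
  have iso: "rest (assoc_sheaf r G M) (basic_open (Inr e)) (Inl ` inc e)
      \<in> gmod_iso r (sec (assoc_sheaf r G M) (basic_open (Inr e))) (sec (assoc_sheaf r G M) (Inl ` inc e))"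
    if e: "e \<in> hyperedges r G" "e \<notin> nd_edges r G" for e
  proof -
    let ?W = "Inl ` inc e :: 'v point set" and ?f = "\<lambda>m. restrict m (sheaf_index r G (Inl ` inc e))"
    have "?f \<in> gmod_hom r (gkm_sections r G M ?W) (gkm_sections r G M ?W)"
      by (intro restrict_gmod_hom edge_closed_vertices) simp
    moreover have "bij_betw ?f (carrier (gkm_sections r G M ?W)) (carrier (gkm_sections r G M ?W))
        \<longleftrightarrow> bij_betw id (carrier (gkm_sections r G M ?W)) (carrier (gkm_sections r G M ?W))"
      by (rule bij_betw_cong) (simp add: restrict_self)
    ultimately show ?thesis
      by (simp add: gmod_iso_def assoc_sheaf_def degenerate_sections(2)[OF e(2)])
  qed
  have "finite (nd_edges r G)" using G by (simp add: moment_graph_def)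
  then show "finite {e \<in> hyperedges r G. rest (assoc_sheaf r G M) (basic_open (Inr e)) (Inl ` inc e) \<notin>
        gmod_iso r (sec (assoc_sheaf r G M) (basic_open (Inr e))) (sec (assoc_sheaf r G M) (Inl ` inc e))}"
    by (rule finite_subset[rotated]) (use iso in blast)
qed

section \<open>Global sections and functoriality\<close>

lemma sheaf_index_topspace: "sheaf_index r G (topspace (Top r G)) = sub_points r G (verts G)"
proof -
  have "topspace (Top r G) = (\<Union>x\<in>hg_points r G. basic_open x)"
    by (simp add: Top_def topology_generated_by_topspace)
  moreover have "x \<in> basic_open x" for x :: "'v point"
    by (cases x) (simp_all add: basic_open_def)
  moreover have "sub_points r G (verts G) \<subseteq> hg_points r G"
    using nd_edge_hyperedge by (auto simp: sub_points_def hg_points_def)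
  ultimately show ?thesis by (auto simp: sheaf_index_def)
qed

text \<open>Both sides consist of families on the same points with the same operations. It only has
  to be matched that every nondegenerate edge lies in the whole space and has its endpoints among
  the vertices.\<close>

lemma gamma_H0_iso: "(\<lambda>s. s) \<in> gmod_iso r (gamma_H0 r G M) (sheaf_H0 r G (assoc_sheaf r G M))"
proof -
  let ?X = "topspace (Top r G)"
  have edge: "Inr e \<in> ?X" if "e \<in> nd_edges r G" for e
    using that sheaf_index_topspace Inr_sub_points[of e] by (auto simp: sheaf_index_def)
  have carr: "carrier (gamma_H0 r G M) = carrier (gkm_sections r G M ?X)"
    using nd_edge_inc edge
    by (auto simp: gamma_H0_def gamma_sections_def Let_def gkm_sections_carrier
        sheaf_index_topspace PiE_iff)
  have "m \<in> hdeg (gamma_H0 r G M) d \<longleftrightarrow>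
      m \<in> carrier (gamma_H0 r G M) \<and> (\<forall>x\<in>sub_points r G (verts G). m x \<in> hdeg (stalk M x) d)" for m d
    by (simp add: gamma_H0_def gamma_sections_def Let_def)
  then have deg: "hdeg (gamma_H0 r G M) d = hdeg (gkm_sections r G M ?X) d" for d
    by (simp add: set_eq_iff carr gkm_sections_simps sheaf_index_topspace)
  have ops: "m \<oplus>\<^bsub>gamma_H0 r G M\<^esub> n = m \<oplus>\<^bsub>gkm_sections r G M ?X\<^esub> n"
    "a \<odot>\<^bsub>gamma_H0 r G M\<^esub> m = a \<odot>\<^bsub>gkm_sections r G M ?X\<^esub> m" for m n a
    by (simp_all add: gamma_H0_def gamma_sections_def Let_def gkm_sections_simps
        sheaf_index_topspace)
  show ?thesis
    by (simp add: gmod_iso_def gmod_hom_def carr deg ops sheaf_H0_def assoc_sheaf_def bij_betw_def)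
qed

text \<open>A morphism acts coordinatewise and hence commutes with restriction; its commuting
  squares with \<rho> carry compatible families to compatible families.\<close>

lemma assoc_map_hom:
  assumes M: "gamma_sheaf r G M" and N: "gamma_sheaf r G N" and f: "f \<in> gamma_hom r G M N"
  shows "assoc_map r G f \<in> sheaf_hom r (Top r G) (assoc_sheaf r G M) (assoc_sheaf r G N)"
  unfolding sheaf_hom_def
proof (intro CollectI conjI allI impI ballI)
  have fx: "f x \<in> gmod_hom r (stalk M x) (stalk N x)" if "x \<in> sheaf_index r G U" for x U
    using f that by (simp add: gamma_hom_def sheaf_index_def)
  fix U assume "openin (Top r G) U"
  then have U: "edge_closed U" by (rule openin_Top_edge_closed)
  have cl: "assoc_map r G f U s \<in> carrier (gkm_sections r G N U)"
    if s: "s \<in> carrier (gkm_sections r G M U)" for s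
    unfolding gkm_sections_carrier
  proof (intro conjI ballI impI)
    show "assoc_map r G f U s x \<in> carrier (stalk N x)" if "x \<in> sheaf_index r G U" for x
      using s fx[OF that] that by (auto simp: assoc_map_def gkm_sections_carrier gmod_hom_def)
    fix e v assume e: "e \<in> nd_edges r G" "Inr e \<in> U" "v \<in> inc e"
    have idx: "Inl v \<in> sheaf_index r G U" "Inr e \<in> sheaf_index r G U"
      using vertex_index[OF U] edge_index e by auto
    have "s (Inl v) \<in> carrier (stalk M (Inl v))" "rho M v e (s (Inl v)) = s (Inr e)"
      using s e idx by (simp_all add: gkm_sections_carrier)
    moreover have "f (Inr e) (rho M v e m) = rho N v e (f (Inl v) m)"
      if "m \<in> carrier (stalk M (Inl v))" for m
      using f e that unfolding gamma_hom_def by blast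
    ultimately have "rho N v e (f (Inl v) (s (Inl v))) = f (Inr e) (s (Inr e))" by metis
    then show "rho N v e (assoc_map r G f U s (Inl v)) = assoc_map r G f U s (Inr e)"
      using idx by (simp add: assoc_map_def)
  qed (simp add: assoc_map_def)
  have at: "s x \<in> carrier (stalk M x)" if "s \<in> carrier (gkm_sections r G M U)" "x \<in> sheaf_index r G U" for s x
    using that by (simp add: gkm_sections_carrier)
  have "assoc_map r G f U \<in> gmod_hom r (gkm_sections r G M U) (gkm_sections r G N U)"
    unfolding gmod_hom_def
  proof (intro CollectI conjI ballI allI)
    show "assoc_map r G f U \<in> carrier (gkm_sections r G M U) \<rightarrow> carrier (gkm_sections r G N U)"
      using cl by blast
    show "assoc_map r G f U (s \<oplus>\<^bsub>gkm_sections r G M U\<^esub> t) =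
        assoc_map r G f U s \<oplus>\<^bsub>gkm_sections r G N U\<^esub> assoc_map r G f U t"
      if "s \<in> carrier (gkm_sections r G M U)" "t \<in> carrier (gkm_sections r G M U)" for s t
      using fx at that
      by (auto simp: assoc_map_def gkm_sections_simps fun_eq_iff gmod_hom_def)
    show "assoc_map r G f U (a \<odot>\<^bsub>gkm_sections r G M U\<^esub> s) =
        a \<odot>\<^bsub>gkm_sections r G N U\<^esub> assoc_map r G f U s"
      if "a \<in> carrier (sym_alg r)" "s \<in> carrier (gkm_sections r G M U)" for a s
      using fx at that
      by (auto simp: assoc_map_def gkm_sections_simps fun_eq_iff gmod_hom_def)
    show "assoc_map r G f U ` hdeg (gkm_sections r G M U) d \<subseteq> hdeg (gkm_sections r G N U) d" for d
    proof
      fix n assume "n \<in> assoc_map r G f U ` hdeg (gkm_sections r G M U) d"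
      then obtain s where s: "s \<in> hdeg (gkm_sections r G M U) d" "n = assoc_map r G f U s" by blast
      have "f x (s x) \<in> hdeg (stalk N x) d" if "x \<in> sheaf_index r G U" for x
      proof -
        have "f x ` hdeg (stalk M x) d \<subseteq> hdeg (stalk N x) d"
          using fx[OF that] unfolding gmod_hom_def by blast
        moreover have "s x \<in> hdeg (stalk M x) d"
          using s(1) that by (simp add: gkm_sections_simps)
        ultimately show ?thesis by blast
      qed
      then show "n \<in> hdeg (gkm_sections r G N U) d"
        using cl[of s] s by (simp add: gkm_sections_simps assoc_map_def)
    qed
  qed
  then show "assoc_map r G f U \<in> gmod_hom r (sec (assoc_sheaf r G M) U) (sec (assoc_sheaf r G N) U)"
    by (simp add: assoc_sheaf_def)
next
  fix U W s assume "openin (Top r G) U \<and> openin (Top r G) W \<and> W \<subseteq> U"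
  then have "sheaf_index r G W \<subseteq> sheaf_index r G U" by (intro sheaf_index_mono) simp
  then show "assoc_map r G f W (rest (assoc_sheaf r G M) U W s) =
      rest (assoc_sheaf r G N) U W (assoc_map r G f U s)"
    by (auto simp: assoc_sheaf_def assoc_map_def fun_eq_iff)
qed

lemma pure_to_gkm_functor_assoc:
  "pure_to_gkm_functor r G (assoc_sheaf r G) (\<lambda>M N. assoc_map r G)"
  unfolding pure_to_gkm_functor_def
proof (intro conjI allI impI ballI)
  show "gkm_sheaf r G (assoc_sheaf r G M)" if "pure_sheaf r G M" for M
    using that by (rule gkm_sheaf_assoc)
  show "assoc_map r G f \<in> sheaf_hom r (Top r G) (assoc_sheaf r G M) (assoc_sheaf r G N)"
    if "pure_sheaf r G M \<and> pure_sheaf r G N \<and> f \<in> gamma_hom r G M N" for M N f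
    using that by (intro assoc_map_hom) (auto simp: pure_sheaf_def)
next
  fix M f U s
  assume f: "pure_sheaf r G M \<and> f \<in> gamma_hom r G M M \<and>
      (\<forall>x\<in>sub_points r G (verts G). \<forall>m\<in>carrier (stalk M x). f x m = m)"
    and s: "s \<in> carrier (sec (assoc_sheaf r G M) U)"
  have s': "s \<in> carrier (gkm_sections r G M U)" using s by (simp add: assoc_sheaf_def)
  have "f x (s x) = s x" if "x \<in> sheaf_index r G U" for x
    using f s' that by (simp add: gkm_sections_carrier) (simp add: sheaf_index_def)
  \<comment> \<open>Off the index set both sides take the default value, and a section is
    extensional, so restricting it changes nothing.\<close>
  then have "assoc_map r G f U s = restrict s (sheaf_index r G U)"
    by (auto simp: assoc_map_def fun_eq_iff)
  then show "assoc_map r G f U s = s" using restrict_self[OF s'] by simp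
next
  fix M N K f g h U s
  assume h: "pure_sheaf r G M \<and> pure_sheaf r G N \<and> pure_sheaf r G K \<and>
      f \<in> gamma_hom r G M N \<and> g \<in> gamma_hom r G N K \<and> h \<in> gamma_hom r G M K \<and>
      (\<forall>x\<in>sub_points r G (verts G). \<forall>m\<in>carrier (stalk M x). h x m = g x (f x m))"
    and s: "s \<in> carrier (sec (assoc_sheaf r G M) U)"
  have s': "s \<in> carrier (gkm_sections r G M U)" using s by (simp add: assoc_sheaf_def)
  have "h x (s x) = g x (f x (s x))" if "x \<in> sheaf_index r G U" for x
    using h s' that by (simp add: gkm_sections_carrier) (simp add: sheaf_index_def)
  then show "assoc_map r G h U s = assoc_map r G g U (assoc_map r G f U s)"
    by (auto simp: assoc_map_def fun_eq_iff)
qed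

end

text \<open>Canonicity is expressed by functoriality on pure sheaves together with naturality of the
  isomorphisms \<open>\<eta>\<close>. As the two modules of global sections consist of the same
  families, the identity serves as \<open>\<eta>\<close>, and naturality compares two instances of
  one coordinatewise formula.\<close>

theorem proposition2p24:
  fixes r :: nat and G :: "'v moment_graph"
  assumes "moment_graph r G"
  shows "\<exists>(F :: ('v, 'm) gamma_sheaf \<Rightarrow> ('v point, 'v point \<Rightarrow> 'm) mod_sheaf) Fm \<eta>.
    pure_to_gkm_functor r G F Fm \<and>
    (\<forall>M. pure_sheaf r G M \<longrightarrow> \<eta> M \<in> gmod_iso r (gamma_H0 r G M) (sheaf_H0 r G (F M))) \<and>
    (\<forall>M N f. pure_sheaf r G M \<and> pure_sheaf r G N \<and> f \<in> gamma_hom r G M N \<longrightarrow>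
      (\<forall>s \<in> carrier (gamma_H0 r G M).
        \<eta> N (gamma_H0_map r G f s) = Fm M N f (topspace (Top r G)) (\<eta> M s)))"
proof (intro exI[of _ "assoc_sheaf r G"] exI[of _ "\<lambda>M N. assoc_map r G"] exI[of _ "\<lambda>M s. s"]
    conjI allI impI ballI)
  show "pure_to_gkm_functor r G (assoc_sheaf r G) (\<lambda>M N. assoc_map r G)"
    by (rule pure_to_gkm_functor_assoc[OF assms])
  show "(\<lambda>s. s) \<in> gmod_iso r (gamma_H0 r G M) (sheaf_H0 r G (assoc_sheaf r G M))" for M
    by (rule gamma_H0_iso[OF assms])
  show "gamma_H0_map r G f s = assoc_map r G f (topspace (Top r G)) s" for f s
    by (simp add: gamma_H0_map_def assoc_map_def sheaf_index_topspace[OF assms])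
qed

end
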